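(* For every real number $\sigma >1$ there exist two families (sequences indexed by $d\in\mathbb{N}$) of number fields $\{K_{d,\sigma}\}_d$ and $\{K'_{d,\sigma}\}_d$ such that $\zeta_{K_{d,\sigma}}(\sigma) \to 1$ and $\zeta_{K'_{d,\sigma}}(\sigma) \to +\infty$ as $d \to +\infty$. In particular, the function $h_\sigma$ does not have the Bogomolov property for every real $\sigma>1$.
   Context: For a number field $K$, $\zeta_K(s)=\sum_{\mathfrak a}\mathrm{N}(\mathfrak a)^{-s}$ is its Dedekind zeta function (sum over nonzero ideals of the ring of integers), which converges absolutely for $\mathrm{Re}(s)>1$. $\mathcal{N}$ denotes the set of isomorphism classes of number fields; $h_s([K]) := \lvert\zeta_K^\ast(s)\rvert$, where $\zeta_K^\ast(s)$ is the first non-vanishing Laurent coefficient of $\zeta_K$ at $s$ (which equals $\zeta_K(s)$ for real $s>1$). A function $h\colon\mathcal{N}\to\mathbb{R}_{\ge 0}$ has the Bogomolov property if $\inf h(\mathcal{N})$ is isolated in $h(\mathcal{N})$, i.e. there is $\varepsilon>0$ with $h(\mathcal{N})\cap(\inf h(\mathcal{N}),\inf h(\mathcal{N})+\varepsilon)=\emptyset$. *)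

theory Defs
  imports
    "HOL-Complex_Analysis.Complex_Analysis"
    "HOL-Algebra.Algebraic_Closure_Type"
    "HOL-Algebra.Embedded_Algebras"
    "HOL-Algebra.QuotRing"
begin

abbreviation CC :: "complex ring" where
  "CC \<equiv> ring_of_type_algebra"

text \<open>
  Number fields are realised inside the complex numbers, as subfields of finite dimension over
  the rationals. Every finite extension of the rationals is isomorphic to such a subfield, so
  the set of isomorphism classes below is the set of isomorphism classes of all number fields.
\<close>

definition number_field :: "complex set \<Rightarrow> bool" where
  "number_field K \<longleftrightarrow> subfield K CC \<and> ring.finite_dimension CC \<rat> K"

definition ring_of_integers :: "complex set \<Rightarrow> complex ring" where
  "ring_of_integers K = CC\<lparr>carrier := {x \<in> K. algebraic_int x}\<rparr>"

definition nonzero_ideals :: "complex set \<Rightarrow> complex set set" where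
  "nonzero_ideals K = {I. ideal I (ring_of_integers K) \<and> I \<noteq> {0}}"

definition ideal_norm :: "complex set \<Rightarrow> complex set \<Rightarrow> nat" where
  "ideal_norm K I = card (carrier (ring_of_integers K Quot I))"

text \<open>
  This is the Dirichlet series only. It represents the Dedekind zeta function for real part
  greater than 1; no meromorphic continuation is built in. Accordingly the leading coefficient
  and the function \<open>zeta_height\<close> below have their intended meaning in that half-plane.
\<close>

definition dedekind_zeta :: "complex set \<Rightarrow> complex \<Rightarrow> complex" where
  "dedekind_zeta K s = (\<Sum>\<^sub>\<infinity>I\<in>nonzero_ideals K. of_nat (ideal_norm K I) powr (-s))"

definition leading_laurent_coeff :: "(complex \<Rightarrow> complex) \<Rightarrow> complex \<Rightarrow> complex" where
  "leading_laurent_coeff f s =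
     fls_nth (laurent_expansion f s) (fls_subdegree (laurent_expansion f s))"

definition number_field_iso :: "(complex set \<times> complex set) set" where
  "number_field_iso = {(K, L). number_field K \<and> number_field L \<and>
     CC\<lparr>carrier := K\<rparr> \<simeq> CC\<lparr>carrier := L\<rparr>}"

definition number_field_classes :: "complex set set set" where
  "number_field_classes = {K. number_field K} // number_field_iso"

text \<open>
  The value on an isomorphism class is the common value at all of its members.
\<close>

definition zeta_height :: "complex \<Rightarrow> complex set set \<Rightarrow> real" where
  "zeta_height s c = the_elem ((\<lambda>K. cmod (leading_laurent_coeff (dedekind_zeta K) s)) ` c)"

definition bogomolov_property :: "(complex set set \<Rightarrow> real) \<Rightarrow> bool" where
  "bogomolov_property h \<longleftrightarrow>
     (\<exists>\<epsilon>>0. h ` number_field_classes \<inter>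
        {Inf (h ` number_field_classes)<..<Inf (h ` number_field_classes) + \<epsilon>} = {})"

end

theory Submission
  imports Defs "Jordan_Normal_Form.Char_Poly" "HOL-Number_Theory.Cong" "HOL-Real_Asymp.Real_Asymp"
begin

text \<open>
  Unique factorisation is only needed as an upper bound: a maximal ideal \<open>P\<close> is inverted by an element
  \<open>q\<close> of the field with \<open>a + q * b = 1\<close> for some \<open>a, b \<in> P\<close>, so every nonzero ideal
  \<open>J \<subseteq> P\<close> can be recovered from \<open>(J : P)\<close>, whose norm is smaller by at least the factor \<open>N P\<close>. Stripping
  off primes one at a time bounds the zeta function of a field of degree \<open>n\<close> by its Euler product, in
  which at most \<open>n\<close> primes lie above each rational prime. This gives convergence for \<open>s > 1\<close>.

  For values near 1, take a root of a monic integer polynomial of degree \<open>n\<close> that is irreducible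
  modulo all primes up to a bound \<open>B\<close>. These primes only contribute norms at least \<open>p ^ n\<close>, and the
  remaining ones contribute at most \<open>n\<close> times the tail of a convergent series, which is small once \<open>B\<close>
  is large compared to \<open>n\<close>.

  For large values, iterate quadratic extensions \<open>K(sqrt d)\<close> with \<open>d\<close> congruent to 1 modulo 8 and not a
  square: every ideal of norm 2 splits into two ideals of norm 2.

  Every zeta value is greater than 1, so the infimum 1 of the height is a limit point that is not attained.
\<close>

hide_const (open) Polynomials.degree Polynomials.lead_coeff up_ring.coeff up_ring.monom
  Divisibility.prime module.smult

text \<open>The two limits need opposite control. Large values only require exhibiting many ideals,
  whereas small values require a bound over all of them, and a field of degree \<open>n\<close> may
  have \<open>n\<close> primes of norm \<open>p\<close> above each \<open>p\<close>. The order of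
  choices beats this factor \<open>n\<close>: first \<open>n\<close> is fixed, and inertness of the
  primes up to \<open>B\<close> makes their share of order \<open>n / 2^n\<close>; only then is
  \<open>B\<close> chosen, depending on \<open>n\<close> and the exponent, so that the tail beyond
  \<open>B\<close> is below \<open>1 / n^2\<close> and remains small after multiplication by
  \<open>n\<close>. The fields involved come without an explicit integral basis. Degree therefore
  enters only as the statement that \<open>n + 1\<close> elements satisfy an integer relation, and
  polynomials over a prime field are handled through integer lifts and membership in an ideal
  \<open>P\<close>. The congruence modulo 8 spends its three factors 2 as follows: two clear
  possible halves in the coordinates of the two factors of a product, and the third puts the
  resulting error term into an ideal of norm 2.\<close>

section \<open>Sums and products of algebraic integers\<close>

definition int_span :: "complex set \<Rightarrow> complex set" where
  "int_span B = {s. \<exists>c::complex \<Rightarrow> int. s = (\<Sum>b\<in>B. of_int (c b) * b)}"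

lemma int_spanI: "s = (\<Sum>b\<in>B. of_int (c b) * b) \<Longrightarrow> s \<in> int_span B"
  by (auto simp: int_span_def)

lemma int_span_base:
  assumes "finite B" "b \<in> B"
  shows "b \<in> int_span B"
proof -
  have "(\<Sum>x\<in>B. of_int (if x = b then 1 else 0) * x) = (\<Sum>x\<in>B. if x = b then x else 0)"
    by (intro sum.cong) auto
  also have "\<dots> = b"
    using assms by simp
  finally have "b = (\<Sum>x\<in>B. of_int (if x = b then 1 else 0) * x)" ..
  thus ?thesis
    by (rule int_spanI)
qed

lemma int_span_add:
  assumes "u \<in> int_span B" "v \<in> int_span B"
  shows "u + v \<in> int_span B"
proof -
  obtain c d :: "complex \<Rightarrow> int" where "u = (\<Sum>b\<in>B. of_int (c b) * b)" "v = (\<Sum>b\<in>B. of_int (d b) * b)"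
    using assms by (auto simp: int_span_def)
  hence "u + v = (\<Sum>b\<in>B. of_int (c b + d b) * b)"
    by (simp add: sum.distrib algebra_simps)
  thus ?thesis
    by (rule int_spanI)
qed

lemma int_span_mult_int:
  assumes "u \<in> int_span B"
  shows "of_int k * u \<in> int_span B"
proof -
  obtain c :: "complex \<Rightarrow> int" where "u = (\<Sum>b\<in>B. of_int (c b) * b)"
    using assms by (auto simp: int_span_def)
  hence "of_int k * u = (\<Sum>b\<in>B. of_int (k * c b) * b)"
    by (simp add: sum_distrib_left mult.assoc)
  thus ?thesis
    by (rule int_spanI)
qed

lemma int_span_sum:
  assumes "\<And>i. i \<in> S \<Longrightarrow> f i \<in> int_span B"
  shows "(\<Sum>i\<in>S. of_int (c i) * f i) \<in> int_span B"
proof -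
  have z: "0 \<in> int_span B"
    unfolding int_span_def by (auto intro!: exI[of _ "\<lambda>_. 0"])
  show ?thesis
    using assms
    by (induction S rule: infinite_finite_induct) (auto intro: z int_span_add int_span_mult_int)
qed

text \<open>Multiplication by \<open>z\<close> on the generators is given by an integer matrix
  \<open>A\<close>, and the vector of generators is an eigenvector for \<open>z\<close>, nonzero
  because of \<open>b0\<close>. So \<open>z\<close> is a root of the monic integer polynomial
  \<open>char_poly A\<close>.\<close>

lemma algebraic_int_if_stable_int_span:
  fixes z :: complex
  assumes fin: "finite B" and b0: "b0 \<in> B" "b0 \<noteq> 0"
    and stable: "\<And>b. b \<in> B \<Longrightarrow> z * b \<in> int_span B"
  shows "algebraic_int z"
proof -
  have "\<forall>b. \<exists>c::complex \<Rightarrow> int. b \<in> B \<longrightarrow> z * b = (\<Sum>x\<in>B. of_int (c x) * x)"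
    using stable by (auto simp: int_span_def)
  then obtain c :: "complex \<Rightarrow> complex \<Rightarrow> int"
    where c: "\<And>b. b \<in> B \<Longrightarrow> z * b = (\<Sum>x\<in>B. of_int (c b x) * x)"
    by metis
  define n where "n = card B"
  obtain f where f: "bij_betw f {0..<n} B"
    using ex_bij_betw_nat_finite[OF fin] n_def by blast
  define A where "A = Matrix.mat n n (\<lambda>(i,j). c (f i) (f j))"
  define v where "v = Matrix.vec n f"
  let ?A = "map_mat of_int A :: complex mat"
  have A: "A \<in> carrier_mat n n" by (simp add: A_def)
  hence cA: "?A \<in> carrier_mat n n" by simp
  have "?A *\<^sub>v v = z \<cdot>\<^sub>v v"
  proof (rule eq_vecI)
    fix i assume "i < dim_vec (z \<cdot>\<^sub>v v)"
    hence i: "i < n" by (simp add: v_def)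
    have "vec_index (?A *\<^sub>v v) i = (\<Sum>j\<in>{0..<n}. of_int (c (f i) (f j)) * f j)"
      using i by (simp add: A_def v_def scalar_prod_def)
    also have "\<dots> = (\<Sum>x\<in>B. of_int (c (f i) x) * x)"
      by (rule sum.reindex_bij_betw[OF f])
    also have "\<dots> = z * f i"
      using c i f by (metis atLeastLessThan_iff bij_betwE zero_le)
    finally show "vec_index (?A *\<^sub>v v) i = vec_index (z \<cdot>\<^sub>v v) i"
      using i by (simp add: v_def)
  qed (use A in \<open>simp add: v_def\<close>)
  moreover have "v \<noteq> 0\<^sub>v n"
  proof
    assume v0: "v = 0\<^sub>v n"
    obtain i where "i < n" "f i = b0"
      using f b0(1) by (metis atLeastLessThan_iff bij_betw_def imageE)
    thus False
      using v0 b0(2) by (metis index_vec index_zero_vec(1) v_def)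
  qed
  ultimately have "eigenvalue ?A z"
    using A unfolding eigenvalue_def eigenvector_def by (intro exI[of _ v]) (auto simp: v_def)
  hence "poly (char_poly ?A) z = 0"
    using eigenvalue_root_char_poly[OF cA] by simp
  hence "poly (map_poly of_int (char_poly A)) z = 0"
    by (simp add: of_int_hom.char_poly_hom[OF A])
  moreover have "lead_coeff (char_poly A) = 1"
    using degree_monic_char_poly[OF A] by simp
  ultimately show ?thesis
    unfolding algebraic_int_altdef_ipoly by blast
qed

lemma algebraic_int_power_relation:
  fixes x :: complex
  assumes "algebraic_int x"
  obtains p :: "int poly" where "degree p > 0"
    "x ^ degree p = (\<Sum>k<degree p. of_int (- coeff p k) * x ^ k)"
proof -
  obtain p :: "int poly" where p: "poly (map_poly of_int p) x = 0" "lead_coeff p = 1"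
    using assms by (auto simp: algebraic_int_altdef_ipoly)
  have d: "degree (map_poly of_int p :: complex poly) = degree p"
    by simp
  have "0 = (\<Sum>k\<le>degree p. of_int (coeff p k) * x ^ k)"
    using p(1) by (simp add: poly_altdef d coeff_map_poly)
  also have "\<dots> = (\<Sum>k<degree p. of_int (coeff p k) * x ^ k) + x ^ degree p"
    using p(2) by (simp flip: lessThan_Suc_atMost)
  finally have "x ^ degree p = (\<Sum>k<degree p. of_int (- coeff p k) * x ^ k)"
    by (simp add: sum_negf eq_neg_iff_add_eq_0 add.commute)
  moreover have "degree p > 0"
  proof (rule ccontr)
    assume "\<not> degree p > 0"
    then obtain a where "p = [:a:]"
      using degree_eq_zeroE by blast
    thus False using p by (auto simp: map_poly_pCons)
  qed
  ultimately show ?thesis using that by blast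
qed

lemma algebraic_int_add_mult:
  fixes x y :: complex
  assumes "algebraic_int x" "algebraic_int y"
  shows "algebraic_int (x + y)" "algebraic_int (x * y)"
proof -
  obtain p :: "int poly" where p: "degree p > 0"
    "x ^ degree p = (\<Sum>k<degree p. of_int (- coeff p k) * x ^ k)"
    using algebraic_int_power_relation[OF assms(1)] .
  obtain q :: "int poly" where q: "degree q > 0"
    "y ^ degree q = (\<Sum>k<degree q. of_int (- coeff q k) * y ^ k)"
    using algebraic_int_power_relation[OF assms(2)] .
  \<comment> \<open>The monomials below both degrees span a set stable under multiplication by
    \<open>x\<close> and by \<open>y\<close>, hence by their sum and product.\<close>
  define B where "B = (\<lambda>(i,j). x ^ i * y ^ j) ` ({..<degree p} \<times> {..<degree q})"
  have fin: "finite B" by (simp add: B_def)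
  have memB: "x ^ i * y ^ j \<in> B" if "i < degree p" "j < degree q" for i j
    using that by (auto simp: B_def)
  have one: "1 \<in> B" using memB[of 0 0] p(1) q(1) by simp
  have xB: "x * b \<in> int_span B" if bB: "b \<in> B" for b
  proof -
    obtain i j where ij: "b = x ^ i * y ^ j" "i < degree p" "j < degree q"
      using bB by (auto simp: B_def)
    show ?thesis
    proof (cases "Suc i < degree p")
      case True
      have "x * b = x ^ Suc i * y ^ j" by (simp add: ij(1))
      thus ?thesis using int_span_base[OF fin memB[OF True ij(3)]] by metis
    next
      case False
      hence "Suc i = degree p" using ij by simp
      hence "x * b = x ^ degree p * y ^ j" unfolding ij(1) by (metis mult.assoc power_Suc)
      also have "\<dots> = (\<Sum>k<degree p. of_int (- coeff p k) * (x ^ k * y ^ j))"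
        unfolding p(2) by (simp add: sum_distrib_right mult.assoc)
      also have "\<dots> \<in> int_span B"
        by (rule int_span_sum) (use fin memB ij in \<open>auto intro: int_span_base\<close>)
      finally show ?thesis .
    qed
  qed
  have yB: "y * b \<in> int_span B" if bB: "b \<in> B" for b
  proof -
    obtain i j where ij: "b = x ^ i * y ^ j" "i < degree p" "j < degree q"
      using bB by (auto simp: B_def)
    show ?thesis
    proof (cases "Suc j < degree q")
      case True
      have "y * b = x ^ i * y ^ Suc j" by (simp add: ij(1))
      thus ?thesis using int_span_base[OF fin memB[OF ij(2) True]] by metis
    next
      case False
      hence "Suc j = degree q" using ij by simp
      hence "y * b = x ^ i * y ^ degree q" unfolding ij(1) by (metis mult.left_commute power_Suc)
      also have "\<dots> = (\<Sum>k<degree q. of_int (- coeff q k) * (x ^ i * y ^ k))"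
        unfolding q(2) by (simp add: sum_distrib_left mult.left_commute)
      also have "\<dots> \<in> int_span B"
        by (rule int_span_sum) (use fin memB ij in \<open>auto intro: int_span_base\<close>)
      finally show ?thesis .
    qed
  qed
  have xs: "x * u \<in> int_span B" if uB: "u \<in> int_span B" for u
  proof -
    obtain c :: "complex \<Rightarrow> int" where u: "u = (\<Sum>b\<in>B. of_int (c b) * b)"
      using uB by (auto simp: int_span_def)
    have "x * u = (\<Sum>b\<in>B. of_int (c b) * (x * b))"
      by (simp add: u sum_distrib_left mult.left_commute)
    thus ?thesis using int_span_sum[of B "\<lambda>b. x * b" B c] xB by simp
  qed
  show "algebraic_int (x + y)"
    by (rule algebraic_int_if_stable_int_span[OF fin one])
       (auto simp: distrib_right intro: int_span_add xB yB)
  show "algebraic_int (x * y)"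
    by (rule algebraic_int_if_stable_int_span[OF fin one])
       (auto simp: mult.assoc intro: xs yB)
qed

lemma algebraic_int_diff:
  fixes x y :: complex
  assumes "algebraic_int x" "algebraic_int y"
  shows "algebraic_int (x - y)"
  using algebraic_int_add_mult(1)[OF assms(1), of "- y"] assms(2) by simp

section \<open>Subfields of bounded degree, their integers and ideals\<close>

text \<open>Degree at most \<open>n\<close> over the rationals, with denominators already cleared:
  integer coefficients can be reduced modulo a prime, which is how the bound is used.\<close>

definition rat_dim_le :: "complex set \<Rightarrow> nat \<Rightarrow> bool" where
  "rat_dim_le K n \<longleftrightarrow> (\<forall>x. (\<forall>i\<le>n. x i \<in> K) \<longrightarrow>
     (\<exists>c::nat \<Rightarrow> int. (\<exists>i\<le>n. c i \<noteq> 0) \<and> (\<Sum>i\<le>n. of_int (c i) * x i) = 0))"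

text \<open>\<open>n\<close> is only an upper bound for the degree. \<open>ints\<close>,
  \<open>index\<close> and \<open>zeta_real\<close> depend on \<open>K\<close> alone, so results
  obtained with different bounds fit together.\<close>

locale numfield =
  fixes K :: "complex set" and n :: nat
  assumes rat_mem: "x \<in> \<rat> \<Longrightarrow> x \<in> K"
    and add_mem: "\<lbrakk>x \<in> K; y \<in> K\<rbrakk> \<Longrightarrow> x + y \<in> K"
    and mult_mem: "\<lbrakk>x \<in> K; y \<in> K\<rbrakk> \<Longrightarrow> x * y \<in> K"
    and inverse_mem: "x \<in> K \<Longrightarrow> inverse x \<in> K"
    and dim_le: "rat_dim_le K n"
begin

definition ints :: "complex set" where
  "ints = {x \<in> K. algebraic_int x}"

lemma int_mem: "of_int k \<in> K" by (rule rat_mem) simp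
lemma nat_mem: "of_nat k \<in> K" by (rule rat_mem) simp
lemma zero_mem: "0 \<in> K" and one_mem: "1 \<in> K" by (rule rat_mem; simp)+
lemma uminus_mem: "x \<in> K \<Longrightarrow> - x \<in> K" using mult_mem[of "of_int (-1)" x] int_mem[of "-1"] by simp
lemma diff_mem: "\<lbrakk>x \<in> K; y \<in> K\<rbrakk> \<Longrightarrow> x - y \<in> K" using add_mem[of x "- y"] uminus_mem by simp
lemma divide_mem: "\<lbrakk>x \<in> K; y \<in> K\<rbrakk> \<Longrightarrow> x / y \<in> K" by (simp add: divide_inverse mult_mem inverse_mem)

lemma ints_mem: "x \<in> ints \<Longrightarrow> x \<in> K" by (simp add: ints_def)
lemma ints_add: "\<lbrakk>x \<in> ints; y \<in> ints\<rbrakk> \<Longrightarrow> x + y \<in> ints"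
  by (simp add: ints_def add_mem algebraic_int_add_mult)
lemma ints_mult: "\<lbrakk>x \<in> ints; y \<in> ints\<rbrakk> \<Longrightarrow> x * y \<in> ints"
  by (simp add: ints_def mult_mem algebraic_int_add_mult)
lemma ints_diff: "\<lbrakk>x \<in> ints; y \<in> ints\<rbrakk> \<Longrightarrow> x - y \<in> ints"
  by (simp add: ints_def diff_mem algebraic_int_diff)
lemma ints_uminus: "x \<in> ints \<Longrightarrow> - x \<in> ints"
  by (simp add: ints_def uminus_mem)
lemma ints_of_int: "of_int k \<in> ints"
  by (simp add: ints_def int_mem)
lemma ints_of_nat: "of_nat k \<in> ints"
  by (simp add: ints_def nat_mem)
lemma ints_0: "0 \<in> ints" and ints_1: "1 \<in> ints"
  by (simp_all add: ints_def zero_mem one_mem)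
lemma ints_numeral: "numeral w \<in> ints"
  using ints_of_nat[of "numeral w"] by simp
lemma ints_power: "x \<in> ints \<Longrightarrow> x ^ k \<in> ints"
  by (induction k) (auto intro: ints_1 ints_mult)
lemma ints_sum: "(\<And>i. i \<in> S \<Longrightarrow> f i \<in> ints) \<Longrightarrow> sum f S \<in> ints"
  by (induction S rule: infinite_finite_induct) (auto intro: ints_0 ints_add)
lemma ints_prod: "(\<And>i. i \<in> S \<Longrightarrow> f i \<in> ints) \<Longrightarrow> prod f S \<in> ints"
  by (induction S rule: infinite_finite_induct) (auto intro: ints_1 ints_mult)

lemmas ints_closed = ints_add ints_mult ints_diff ints_uminus ints_of_int ints_of_nat
  ints_0 ints_1 ints_numeral ints_power ints_sum ints_prod

lemma ints_poly:
  assumes "x \<in> ints"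
  shows "poly (map_poly of_int p) x \<in> ints"
  by (induction p) (auto simp: map_poly_pCons intro!: ints_closed assms)

definition is_ideal :: "complex set \<Rightarrow> bool" where
  "is_ideal I \<longleftrightarrow> I \<subseteq> ints \<and> 0 \<in> I \<and> (\<forall>x\<in>I. \<forall>y\<in>I. x + y \<in> I) \<and> (\<forall>r\<in>ints. \<forall>x\<in>I. r * x \<in> I)"

lemma is_idealI:
  assumes "I \<subseteq> ints" "0 \<in> I" "\<And>x y. \<lbrakk>x \<in> I; y \<in> I\<rbrakk> \<Longrightarrow> x + y \<in> I"
    "\<And>r x. \<lbrakk>r \<in> ints; x \<in> I\<rbrakk> \<Longrightarrow> r * x \<in> I"
  shows "is_ideal I"
  using assms by (auto simp: is_ideal_def)

lemma ideal_ints: "\<lbrakk>is_ideal I; x \<in> I\<rbrakk> \<Longrightarrow> x \<in> ints"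
  and ideal_0: "is_ideal I \<Longrightarrow> 0 \<in> I"
  and ideal_add: "\<lbrakk>is_ideal I; x \<in> I; y \<in> I\<rbrakk> \<Longrightarrow> x + y \<in> I"
  and ideal_mult: "\<lbrakk>is_ideal I; r \<in> ints; x \<in> I\<rbrakk> \<Longrightarrow> r * x \<in> I"
  by (auto simp: is_ideal_def)

lemma ideal_mult_right: "\<lbrakk>is_ideal I; r \<in> ints; x \<in> I\<rbrakk> \<Longrightarrow> x * r \<in> I"
  using ideal_mult[of I r x] by (simp add: mult.commute)
lemma ideal_uminus: "\<lbrakk>is_ideal I; x \<in> I\<rbrakk> \<Longrightarrow> - x \<in> I"
  using ideal_mult[of I "-1" x] ints_uminus[OF ints_1] by simp
lemma ideal_diff: "\<lbrakk>is_ideal I; x \<in> I; y \<in> I\<rbrakk> \<Longrightarrow> x - y \<in> I"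
  using ideal_add[of I x "- y"] ideal_uminus[of I y] by simp
lemma ideal_sum: "\<lbrakk>is_ideal I; \<And>i. i \<in> S \<Longrightarrow> f i \<in> I\<rbrakk> \<Longrightarrow> sum f S \<in> I"
  by (induction S rule: infinite_finite_induct) (auto intro: ideal_0 ideal_add)
lemma ideal_eq_ints: "\<lbrakk>is_ideal I; 1 \<in> I\<rbrakk> \<Longrightarrow> I = ints"
  using ideal_mult[of I _ 1] ideal_ints by auto
lemma ints_ideal: "is_ideal ints"
  by (auto intro!: is_idealI ints_closed)

text \<open>Said elementwise, the quotient by \<open>P\<close> is a field: whatever lies outside
  \<open>P\<close> is invertible modulo \<open>P\<close>.\<close>

definition is_maximal :: "complex set \<Rightarrow> bool" where
  "is_maximal P \<longleftrightarrow> is_ideal P \<and> P \<noteq> {0} \<and> 1 \<notin> P \<and> (\<forall>x\<in>ints - P. \<exists>r\<in>ints. 1 - r * x \<in> P)"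

lemma maximal_ideal: "is_maximal P \<Longrightarrow> is_ideal P"
  by (simp add: is_maximal_def)

lemma maximal_one: "is_maximal P \<Longrightarrow> 1 \<notin> P"
  by (simp add: is_maximal_def)

lemma maximal_prime:
  assumes "is_maximal P" "x \<in> ints" "y \<in> ints" "x * y \<in> P"
  shows "x \<in> P \<or> y \<in> P"
proof (rule ccontr)
  assume n: "\<not> (x \<in> P \<or> y \<in> P)"
  then obtain r where r: "r \<in> ints" "1 - r * x \<in> P"
    using assms by (auto simp: is_maximal_def)
  have "(1 - r * x) * y + r * (x * y) \<in> P"
    using ideal_add[OF maximal_ideal[OF assms(1)] ideal_mult_right[OF maximal_ideal[OF assms(1)] assms(3) r(2)]
      ideal_mult[OF maximal_ideal[OF assms(1)] r(1) assms(4)]] .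
  also have "(1 - r * x) * y + r * (x * y) = y" by (simp add: algebra_simps)
  finally show False using n by simp
qed

lemma maximal_prod:
  assumes "is_maximal P" "finite S" "\<And>i. i \<in> S \<Longrightarrow> f i \<in> ints - P"
  shows "prod f S \<in> ints - P"
  using assms(2,3)
proof (induction S rule: finite_induct)
  case empty
  thus ?case using maximal_one[OF assms(1)] ints_1 by simp
next
  case (insert i S)
  thus ?case using maximal_prime[OF assms(1), of "f i" "prod f S"] by (auto intro: ints_mult)
qed

lemma maximal_power:
  assumes "is_maximal P" "x \<in> ints" "x ^ k \<in> P"
  shows "x \<in> P"
  using assms(3)
proof (induction k)
  case 0
  thus ?case using maximal_one[OF assms(1)] by simp
next
  case (Suc k)
  thus ?case using maximal_prime[OF assms(1,2), of "x ^ k"] ints_power[OF assms(2)] by auto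
qed

lemma maximal_int_dvd:
  assumes "is_maximal P" "prime p" "of_nat p \<in> P" "of_int k \<in> P"
  shows "int p dvd k"
proof (rule ccontr)
  assume "\<not> int p dvd k"
  hence "coprime (int p) k"
    using assms(2) by (simp add: prime_imp_coprime)
  then obtain a b where "a * int p + b * k = 1"
    by (metis bezout_int coprime_imp_gcd_eq_1)
  hence "(of_int a * of_nat p + of_int b * of_int k :: complex) = 1"
    by (metis of_int_1 of_int_add of_int_mult of_int_of_nat_eq)
  moreover have "of_int a * of_nat p + of_int b * of_int k \<in> P"
    using assms maximal_ideal by (intro ideal_add ideal_mult) (auto intro: ints_closed)
  ultimately show False using maximal_one[OF assms(1)] by simp
qed

section \<open>Finiteness of residue rings\<close>

text \<open>Descent: while \<open>p\<close> divides every coefficient, divide the relation by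
  \<open>p\<close>; the sum of the absolute values drops strictly.\<close>

lemma relation_not_dvd:
  assumes p: "prime p" and x: "\<And>i. i \<le> n \<Longrightarrow> x i \<in> K"
  obtains c :: "nat \<Rightarrow> int" where "\<exists>i\<le>n. \<not> int p dvd c i" "(\<Sum>i\<le>n. of_int (c i) * x i) = 0"
proof -
  have "\<exists>c'::nat \<Rightarrow> int. (\<exists>i\<le>n. \<not> int p dvd c' i) \<and> (\<Sum>i\<le>n. of_int (c' i) * x i) = 0"
    if "\<exists>i\<le>n. c i \<noteq> 0" "(\<Sum>i\<le>n. of_int (c i) * x i) = 0" for c :: "nat \<Rightarrow> int"
    using that
  proof (induction "nat (\<Sum>i\<le>n. \<bar>c i\<bar>)" arbitrary: c rule: less_induct)
    case less
    show ?case
    proof (cases "\<exists>i\<le>n. \<not> int p dvd c i")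
      case True
      thus ?thesis using less.prems by blast
    next
      case False
      define d where "d = (\<lambda>i. c i div int p)"
      have cd: "c i = int p * d i" if "i \<le> n" for i
        using False that by (auto simp: d_def)
      have p1: "int p > 1" using p prime_gt_1_nat by simp
      obtain i0 where i0: "i0 \<le> n" "c i0 \<noteq> 0" using less.prems by blast
      have "0 = (\<Sum>i\<le>n. of_int (c i) * x i)" using less.prems by simp
      also have "\<dots> = of_nat p * (\<Sum>i\<le>n. of_int (d i) * x i)"
        by (simp add: sum_distrib_left cd mult.assoc)
      finally have s0: "(\<Sum>i\<le>n. of_int (d i) * x i) = 0" using p by auto
      have d0: "d i0 \<noteq> 0" using cd[OF i0(1)] i0(2) by auto
      have sc: "(\<Sum>i\<le>n. \<bar>c i\<bar>) = int p * (\<Sum>i\<le>n. \<bar>d i\<bar>)"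
        by (simp add: sum_distrib_left cd abs_mult)
      have "\<bar>d i0\<bar> \<le> (\<Sum>i\<le>n. \<bar>d i\<bar>)"
        by (rule member_le_sum) (use i0 in auto)
      hence pos: "(\<Sum>i\<le>n. \<bar>d i\<bar>) > 0" using d0 by linarith
      hence "1 * (\<Sum>i\<le>n. \<bar>d i\<bar>) < (\<Sum>i\<le>n. \<bar>c i\<bar>)"
        unfolding sc using p1 by (intro mult_strict_right_mono) auto
      hence "nat (\<Sum>i\<le>n. \<bar>d i\<bar>) < nat (\<Sum>i\<le>n. \<bar>c i\<bar>)" using pos by simp
      thus ?thesis using less.hyps[of d] d0 i0 s0 by blast
    qed
  qed
  moreover obtain c :: "nat \<Rightarrow> int" where "\<exists>i\<le>n. c i \<noteq> 0" "(\<Sum>i\<le>n. of_int (c i) * x i) = 0"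
    using dim_le x unfolding rat_dim_le_def by blast
  ultimately show ?thesis using that by blast
qed

text \<open>The quotient of \<open>ints\<close> by \<open>p\<close> has dimension at most
  \<open>n\<close> over the prime field, because \<open>n + 1\<close> elements carry a relation that
  is nontrivial modulo \<open>p\<close>. A largest independent family generates, and its
  combinations with coefficients in \<open>{0..<int p}\<close> are the representatives.\<close>

lemma finite_residues_prime:
  assumes p: "prime p"
  obtains A where "finite A" "A \<subseteq> ints" "\<And>y. y \<in> ints \<Longrightarrow> \<exists>a\<in>A. (y - a) / of_nat p \<in> ints"
proof -
  define ind where "ind r x \<longleftrightarrow> (\<forall>i<r. x i \<in> ints) \<and>
    (\<forall>c::nat \<Rightarrow> int. (\<Sum>i<r. of_int (c i) * x i) / of_nat p \<in> ints \<longrightarrow> (\<forall>i<r. int p dvd c i))"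
    for r and x :: "nat \<Rightarrow> complex"
  have bound: "r \<le> n" if r: "ind r x" for r x
  proof (rule ccontr)
    assume "\<not> r \<le> n"
    hence rn: "n < r" by simp
    have xi: "\<And>i. i < r \<Longrightarrow> x i \<in> ints" using r by (auto simp: ind_def)
    have xK: "x i \<in> K" if "i \<le> n" for i using ints_mem[OF xi] that rn by simp
    obtain c :: "nat \<Rightarrow> int" where c: "\<exists>i\<le>n. \<not> int p dvd c i" "(\<Sum>i\<le>n. of_int (c i) * x i) = 0"
      by (rule relation_not_dvd[OF p xK])
    define d where "d = (\<lambda>i. if i \<le> n then c i else 0)"
    have "(\<Sum>i<r. of_int (d i) * x i) = (\<Sum>i\<le>n. of_int (d i) * x i)"
      by (rule sum.mono_neutral_right) (use rn in \<open>auto simp: d_def\<close>)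
    also have "\<dots> = 0" using c(2) by (simp add: d_def)
    finally have "\<forall>i<r. int p dvd d i"
      using r ints_0 by (auto simp: ind_def)
    hence "int p dvd c i" if "i \<le> n" for i using that rn by (metis d_def le_less_trans)
    thus False using c(1) by blast
  qed
  have "\<exists>x. ind 0 x" by (auto simp: ind_def)
  hence "\<exists>r. (\<exists>x. ind r x) \<and> (\<forall>r'. (\<exists>x. ind r' x) \<longrightarrow> r' \<le> r)"
    using bound by (intro Nat.ex_has_greatest_nat[of "\<lambda>r. \<exists>x. ind r x" 0 n]) auto
  then obtain r x where r: "ind r x" and greatest: "\<And>r' x'. ind r' x' \<Longrightarrow> r' \<le> r"
    by blast
  have xi: "\<And>i. i < r \<Longrightarrow> x i \<in> ints" using r by (auto simp: ind_def)
  define A where "A = (\<lambda>c::nat \<Rightarrow> int. \<Sum>i<r. of_int (c i) * x i) ` ({..<r} \<rightarrow>\<^sub>E {0..<int p})"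
  have "finite A" unfolding A_def by (intro finite_imageI finite_PiE) auto
  moreover have "A \<subseteq> ints" unfolding A_def by (auto intro!: ints_closed xi)
  moreover have "\<exists>a\<in>A. (y - a) / of_nat p \<in> ints" if y: "y \<in> ints" for y
  proof -
    have "\<not> ind (Suc r) (x(r := y))" using greatest by fastforce
    then obtain c :: "nat \<Rightarrow> int" where c:
      "(\<Sum>i<Suc r. of_int (c i) * (x(r := y)) i) / of_nat p \<in> ints" "\<not> (\<forall>i<Suc r. int p dvd c i)"
      using xi y by (auto simp: ind_def less_Suc_eq)
    define s where "s = (\<Sum>i<r. of_int (c i) * x i)"
    have "(\<Sum>i<Suc r. of_int (c i) * (x(r := y)) i) = s + of_int (c r) * y"
      by (simp add: s_def)
    hence sp: "(s + of_int (c r) * y) / of_nat p \<in> ints" using c(1) by simp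
    have "\<not> int p dvd c r"
    proof
      assume d: "int p dvd c r"
      then obtain k where k: "c r = int p * k" by blast
      have "s / of_nat p = (s + of_int (c r) * y) / of_nat p - of_int k * y"
        using p by (simp add: k field_simps)
      also have "\<dots> \<in> ints" using sp y by (intro ints_closed)
      finally have "\<forall>i<r. int p dvd c i" using r by (auto simp: ind_def s_def)
      thus False using d c(2) less_Suc_eq by auto
    qed
    hence "coprime (c r) (int p)"
      using p by (simp add: prime_imp_coprime coprime_commute)
    then obtain u v where uv: "u * c r + v * int p = 1"
      by (metis bezout_int coprime_imp_gcd_eq_1)
    \<comment> \<open>\<open>u\<close> inverts \<open>c r\<close> modulo \<open>p\<close>, so
      solving the relation for \<open>y\<close> gives the coefficients \<open>- u * c i\<close>,
      which are then reduced modulo \<open>p\<close>.\<close>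
    define e where "e = (\<lambda>i\<in>{..<r}. (- u * c i) mod int p)"
    define a where "a = (\<Sum>i<r. of_int (e i) * x i)"
    have "a \<in> A" using prime_gt_0_nat[OF p] unfolding a_def A_def e_def by (intro imageI) (auto split: if_splits)
    moreover have "(y - a) / of_nat p \<in> ints"
    proof -
      have ec: "of_int (e i) = - of_int u * of_int (c i) - of_nat p * (of_int ((- u * c i) div int p) :: complex)"
        if "i < r" for i
      proof -
        have "e i = - u * c i - int p * ((- u * c i) div int p)"
          using that by (simp add: e_def minus_mult_div_eq_mod)
        thus ?thesis by (metis of_int_diff of_int_minus of_int_mult of_int_of_nat_eq)
      qed
      define t where "t = (\<Sum>i<r. of_int ((- u * c i) div int p) * x i)"
      have "a = (\<Sum>i<r. - of_int u * (of_int (c i) * x i) - of_nat p * (of_int ((- u * c i) div int p) * x i))"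
        unfolding a_def by (intro sum.cong refl) (simp add: ec algebra_simps)
      also have "\<dots> = - of_int u * s - of_nat p * t"
        by (simp add: s_def t_def sum_subtractf sum_distrib_left sum_negf)
      finally have a: "a = - of_int u * s - of_nat p * t" .
      have "(of_int u * of_int (c r) + of_int v * of_nat p :: complex) = 1"
        using uv by (metis of_int_1 of_int_add of_int_mult of_int_of_nat_eq)
      hence "y = (of_int u * of_int (c r) + of_int v * of_nat p) * y" by simp
      hence "y - a = of_int u * (s + of_int (c r) * y) + of_nat p * (of_int v * y + t)"
        unfolding a by (simp add: algebra_simps)
      hence "(y - a) / of_nat p = of_int u * ((s + of_int (c r) * y) / of_nat p) + (of_int v * y + t)"
        using p by (simp add: field_simps)
      also have "\<dots> \<in> ints"
        using sp y xi unfolding t_def by (intro ints_closed) auto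
      finally show ?thesis .
    qed
    ultimately show ?thesis by blast
  qed
  ultimately show ?thesis using that by blast
qed

text \<open>Representatives modulo \<open>p * k\<close> are \<open>a + p * b\<close>, with
  \<open>a\<close> taken modulo \<open>p\<close> and \<open>b\<close> modulo
  \<open>k\<close>.\<close>

lemma finite_residues:
  assumes "m > 0"
  shows "\<exists>A. finite A \<and> A \<subseteq> ints \<and> (\<forall>y\<in>ints. \<exists>a\<in>A. (y - a) / of_nat m \<in> ints)"
  using assms
proof (induction m rule: less_induct)
  case (less m)
  show ?case
  proof (cases "m = 1")
    case True
    thus ?thesis by (intro exI[of _ "{0}"]) (auto simp: ints_0)
  next
    case False
    then obtain p k where p: "prime p" "m = p * k"
      using prime_factor_nat by (metis dvdE)
    have k: "k > 0" "k < m" using p less.prems prime_gt_1_nat[OF p(1)] by auto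
    obtain A where A: "finite A" "A \<subseteq> ints" "\<And>y. y \<in> ints \<Longrightarrow> \<exists>a\<in>A. (y - a) / of_nat p \<in> ints"
      using finite_residues_prime[OF p(1)] by metis
    obtain B where B: "finite B" "B \<subseteq> ints" "\<And>y. y \<in> ints \<Longrightarrow> \<exists>a\<in>B. (y - a) / of_nat k \<in> ints"
      using less.IH[OF k(2,1)] by blast
    define C where "C = (\<lambda>(a,b). a + of_nat p * b) ` (A \<times> B)"
    have "finite C" "C \<subseteq> ints"
      using A B by (auto simp: C_def intro!: ints_closed)
    moreover have "\<exists>c\<in>C. (y - c) / of_nat m \<in> ints" if y: "y \<in> ints" for y
    proof -
      obtain a where a: "a \<in> A" "(y - a) / of_nat p \<in> ints" using A(3)[OF y] by blast
      obtain b where b: "b \<in> B" "((y - a) / of_nat p - b) / of_nat k \<in> ints" using B(3)[OF a(2)] by blast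
      have "(y - (a + of_nat p * b)) / of_nat m = ((y - a) / of_nat p - b) / of_nat k"
        using p k less.prems by (simp add: field_simps)
      thus ?thesis using a b by (force simp: C_def)
    qed
    ultimately show ?thesis by blast
  qed
qed

text \<open>In a monic equation for \<open>x\<close> the constant coefficient is a multiple of
  \<open>x\<close>. If it vanishes, cancel the nonzero factor \<open>x\<close> and continue with the
  shorter polynomial, which is still monic.\<close>

lemma multiple_integer:
  assumes x: "x \<in> ints" "x \<noteq> 0"
  obtains m :: nat and z where "m > 0" "z \<in> ints" "of_nat m = x * z"
proof -
  have *: "\<exists>m z. m > 0 \<and> z \<in> ints \<and> of_nat m = x * z"
    if "poly (map_poly of_int p) x = 0" "lead_coeff p = 1" for p :: "int poly"
    using that
  proof (induction p)
    case 0
    thus ?case by simp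
  next
    case (pCons a p)
    have e: "of_int a = x * (- poly (map_poly of_int p) x)"
      using pCons.prems(1) by (simp add: of_int_hom.map_poly_pCons_hom eq_neg_iff_add_eq_0)
    show ?case
    proof (cases "a = 0")
      case True
      hence "p \<noteq> 0" using pCons.hyps by simp
      moreover have "poly (map_poly of_int p) x = 0" using e True x(2) by simp
      ultimately show ?thesis using pCons.IH pCons.prems(2) by simp
    next
      case False
      have "int (nat \<bar>a\<bar>) = sgn a * a" by (simp add: sgn_if)
      hence "of_nat (nat \<bar>a\<bar>) = of_int (sgn a) * (of_int a :: complex)"
        by (metis of_int_mult of_int_of_nat_eq)
      also have "\<dots> = x * (of_int (sgn a) * - poly (map_poly of_int p) x)"
        unfolding e by (simp add: algebra_simps)
      finally have "of_nat (nat \<bar>a\<bar>) = x * (of_int (sgn a) * - poly (map_poly of_int p) x)" .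
      moreover have "of_int (sgn a) * - poly (map_poly of_int p) x \<in> ints"
        using ints_poly[OF x(1)] by (intro ints_closed) auto
      moreover have "nat \<bar>a\<bar> > 0" using False by simp
      ultimately show ?thesis by blast
    qed
  qed
  show ?thesis
    using x(1) * that by (auto simp: ints_def algebraic_int_altdef_ipoly)
qed

lemma ideal_integer:
  assumes "is_ideal I" "I \<noteq> {0}"
  obtains m :: nat where "m > 0" "of_nat m \<in> I"
proof -
  obtain x where x: "x \<in> I" "x \<noteq> 0" using assms ideal_0 by blast
  obtain m z where "m > 0" "z \<in> ints" "of_nat m = x * z"
    using multiple_integer[OF ideal_ints[OF assms(1) x(1)] x(2)] .
  thus ?thesis using that[of m] ideal_mult_right[OF assms(1), of z x] x(1) by simp
qed

section \<open>Integral closedness and existence of maximal ideals\<close>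

text \<open>Pigeonhole: there are finitely many residues modulo \<open>D\<close>, so
  \<open>D * y^i\<close> and \<open>D * y^j\<close> agree modulo \<open>D\<close> for some
  \<open>i < j\<close>. Then \<open>y^j - y^i\<close> is integral, and \<open>y\<close> is a root of
  a monic equation over the algebraic integers.\<close>

lemma completely_integrally_closed:
  assumes y: "y \<in> K" and D: "D > 0" "\<And>k. of_nat D * y ^ k \<in> ints"
  shows "y \<in> ints"
proof -
  obtain A where A: "finite A" "A \<subseteq> ints" "\<And>z. z \<in> ints \<Longrightarrow> \<exists>a\<in>A. (z - a) / of_nat D \<in> ints"
    using finite_residues[OF D(1)] by blast
  have "\<forall>k. \<exists>a. a \<in> A \<and> (of_nat D * y ^ k - a) / of_nat D \<in> ints" using A(3) D(2) by blast
  then obtain f where f: "\<And>k. f k \<in> A" "\<And>k. (of_nat D * y ^ k - f k) / of_nat D \<in> ints" by metis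
  have "finite (range f)" using A(1) f(1) by (meson finite_subset image_subsetI)
  hence "\<not> inj f" using range_inj_infinite by blast
  then obtain i j where ij: "i < j" "f i = f j"
    by (metis injI linorder_neqE_nat)
  have "y ^ j - y ^ i = (of_nat D * y ^ j - f j) / of_nat D - (of_nat D * y ^ i - f i) / of_nat D"
    using D(1) ij(2) by (simp add: field_simps)
  also have "\<dots> \<in> ints" by (intro ints_diff f)
  finally have alg: "algebraic_int (y ^ j - y ^ i)" by (simp add: ints_def)
  have deg: "degree (monom 1 j - monom 1 i :: complex poly) = j"
  proof -
    have "degree (- monom 1 i + monom 1 j :: complex poly) = degree (monom 1 j :: complex poly)"
      by (rule degree_add_eq_right) (use ij in \<open>simp add: degree_monom_eq\<close>)
    thus ?thesis by (simp add: degree_monom_eq)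
  qed
  have "algebraic_int y"
  proof (rule algebraic_int_root[OF alg])
    show "poly (monom 1 j - monom 1 i) y = y ^ j - y ^ i" by (simp add: poly_monom)
    show "\<forall>k. coeff (monom 1 j - monom 1 i :: complex poly) k \<in> \<int>" by simp
    show "lead_coeff (monom 1 j - monom 1 i :: complex poly) = 1" unfolding deg using ij by simp
    show "degree (monom 1 j - monom 1 i :: complex poly) > 0" unfolding deg using ij by simp
  qed
  thus ?thesis using y by (simp add: ints_def)
qed

text \<open>Any positive integer \<open>D\<close> in \<open>I\<close> is a common denominator for
  all powers of \<open>y\<close>, since \<open>D * y^k\<close> stays in \<open>I\<close>.\<close>

lemma multiplier_integral:
  assumes I: "is_ideal I" "I \<noteq> {0}" and y: "y \<in> K" "\<And>x. x \<in> I \<Longrightarrow> y * x \<in> I"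
  shows "y \<in> ints"
proof -
  obtain D :: nat where D: "D > 0" "of_nat D \<in> I" using ideal_integer[OF I] .
  have "of_nat D * y ^ k \<in> I" for k
  proof (induction k)
    case (Suc k)
    thus ?case using y(2)[OF Suc] by (simp add: mult.left_commute)
  qed (use D in simp)
  thus ?thesis using completely_integrally_closed[OF y(1) D(1)] ideal_ints[OF I(1)] by blast
qed

text \<open>An ideal containing \<open>m\<close> is a union of residue classes modulo
  \<open>m\<close>, hence determined by the representatives it contains.\<close>

lemma finite_ideals_above:
  assumes "m > 0"
  shows "finite {J. is_ideal J \<and> of_nat m \<in> J}"
proof -
  obtain A where A: "finite A" "A \<subseteq> ints" "\<And>z. z \<in> ints \<Longrightarrow> \<exists>a\<in>A. (z - a) / of_nat m \<in> ints"
    using finite_residues[OF assms] by blast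
  have mem: "z \<in> J \<longleftrightarrow> a \<in> J" if "is_ideal J" "of_nat m \<in> J" "(z - a) / of_nat m \<in> ints" for z a J
  proof -
    have "z - a = (z - a) / of_nat m * of_nat m" using assms by simp
    hence "z - a \<in> J" using ideal_mult[OF that(1,3,2)] by simp
    thus ?thesis using ideal_add[OF that(1), of "z - a" a] ideal_diff[OF that(1), of z "z - a"] by auto
  qed
  have "inj_on (\<lambda>J. J \<inter> A) {J. is_ideal J \<and> of_nat m \<in> J}"
  proof (rule inj_onI)
    have sub: "J \<subseteq> J'" if J: "is_ideal J" "of_nat m \<in> J" "is_ideal J'" "of_nat m \<in> J'" "J \<inter> A = J' \<inter> A" for J J'
    proof
      fix z assume z: "z \<in> J"
      then obtain a where "a \<in> A" "(z - a) / of_nat m \<in> ints" using A(3) ideal_ints[OF J(1)] by blast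
      thus "z \<in> J'" using mem[OF J(1,2)] mem[OF J(3,4)] J(5) z by blast
    qed
    fix J J' assume "J \<in> {J. is_ideal J \<and> of_nat m \<in> J}" "J' \<in> {J. is_ideal J \<and> of_nat m \<in> J}" "J \<inter> A = J' \<inter> A"
    thus "J = J'" using sub[of J J'] sub[of J' J] by blast
  qed
  moreover have "(\<lambda>J. J \<inter> A) ` {J. is_ideal J \<and> of_nat m \<in> J} \<subseteq> Pow A" by auto
  ultimately show ?thesis using A(1) by (meson finite_Pow_iff finite_subset inj_on_finite)
qed

lemma exists_maximal:
  assumes I: "is_ideal I" "I \<noteq> {0}" "1 \<notin> I"
  obtains P where "is_maximal P" "I \<subseteq> P"
proof -
  obtain m :: nat where m: "m > 0" "of_nat m \<in> I" using ideal_integer[OF I(1,2)] .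
  define S where "S = {J. is_ideal J \<and> I \<subseteq> J \<and> 1 \<notin> J}"
  have "S \<subseteq> {J. is_ideal J \<and> of_nat m \<in> J}" using m by (auto simp: S_def)
  hence "finite S" using finite_ideals_above[OF m(1)] finite_subset by blast
  moreover have "I \<in> S" using I by (simp add: S_def)
  ultimately obtain P where P: "P \<in> S" "\<And>J. J \<in> S \<Longrightarrow> P \<subseteq> J \<Longrightarrow> P = J"
    using finite_has_maximal[of S] by blast
  have Pi: "is_ideal P" "I \<subseteq> P" "1 \<notin> P" using P(1) by (auto simp: S_def)
  have "\<exists>r\<in>ints. 1 - r * x \<in> P" if x: "x \<in> ints - P" for x
  proof (rule ccontr)
    assume no: "\<not> ?thesis"
    define J where "J = {y + r * x | y r. y \<in> P \<and> r \<in> ints}"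
    have PJ: "P \<subseteq> J"
    proof
      fix y assume "y \<in> P"
      hence "y + 0 * x \<in> J" unfolding J_def using ints_0 by blast
      thus "y \<in> J" by simp
    qed
    have "is_ideal J"
    proof (rule is_idealI)
      show "J \<subseteq> ints" using x ideal_ints[OF Pi(1)] by (auto simp: J_def intro!: ints_closed)
      show "0 \<in> J" using PJ ideal_0[OF Pi(1)] by blast
    next
      fix a b assume "a \<in> J" "b \<in> J"
      then obtain y r y' r' where ab: "a = y + r * x" "b = y' + r' * x" "y \<in> P" "y' \<in> P" "r \<in> ints" "r' \<in> ints"
        by (auto simp: J_def)
      have "a + b = (y + y') + (r + r') * x" using ab by (simp add: algebra_simps)
      thus "a + b \<in> J" using ab ideal_add[OF Pi(1)] ints_add unfolding J_def by blast
    next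
      fix c a assume c: "c \<in> ints" and "a \<in> J"
      then obtain y r where ab: "a = y + r * x" "y \<in> P" "r \<in> ints"
        by (auto simp: J_def)
      have "c * a = c * y + (c * r) * x" using ab by (simp add: algebra_simps)
      thus "c * a \<in> J" using ab ideal_mult[OF Pi(1) c] ints_mult[OF c] unfolding J_def by blast
    qed
    moreover have "1 \<notin> J"
    proof
      assume "1 \<in> J"
      then obtain y r where "1 = y + r * x" "y \<in> P" "r \<in> ints" by (auto simp: J_def)
      hence "1 - r * x \<in> P" by (metis add_diff_cancel_right')
      thus False using no \<open>r \<in> ints\<close> by blast
    qed
    ultimately have "J \<in> S" using Pi PJ by (auto simp: S_def)
    hence "P = J" using P(2) PJ by blast
    moreover have "0 + 1 * x \<in> J" unfolding J_def using ideal_0[OF Pi(1)] ints_1 by blast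
    ultimately show False using x by simp
  qed
  hence "is_maximal P" using Pi I ideal_0[OF I(1)] unfolding is_maximal_def by blast
  thus ?thesis using that Pi(2) by blast
qed

section \<open>Inverting a maximal ideal\<close>

text \<open>With a positive integer \<open>m\<close> in \<open>P\<close>, it suffices to find
  \<open>x\<close> outside \<open>m * ints\<close> with \<open>x * P\<close> inside it, and to take
  \<open>q = x / m\<close>. Such an \<open>x\<close> arises from the finite ring of residues modulo
  \<open>m\<close>, localised at \<open>P\<close>: elements of \<open>P\<close> are nilpotent there,
  so together they annihilate something nonzero.\<close>

lemma maximal_dual_element:
  assumes P: "is_maximal P"
  obtains q where "q \<in> K" "q \<notin> ints" "\<And>x. x \<in> P \<Longrightarrow> q * x \<in> ints"
proof -
  have Pi: "is_ideal P" "P \<noteq> {0}" "1 \<notin> P" using P by (auto simp: is_maximal_def)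
  obtain m :: nat where m: "m > 0" "of_nat m \<in> P" using ideal_integer[OF Pi(1,2)] .
  define M where "M = {z. z / of_nat m \<in> ints}"
  have M_mult: "r * z \<in> M" if "r \<in> ints" "z \<in> M" for r z
    using ints_mult[OF that(1), of "z / of_nat m"] that(2) by (simp add: M_def)
  have M_diff: "y - z \<in> M" if "y \<in> M" "z \<in> M" for y z
    using ints_diff[of "y / of_nat m" "z / of_nat m"] that by (simp add: M_def diff_divide_distrib)
  have M_P: "z \<in> P" if "z \<in> M" for z
  proof -
    have "z = z / of_nat m * of_nat m" using m by simp
    thus ?thesis using ideal_mult[OF Pi(1), of "z / of_nat m" "of_nat m"] that m by (simp add: M_def)
  qed
  obtain A where A: "finite A" "A \<subseteq> ints" "\<And>z. z \<in> ints \<Longrightarrow> \<exists>a\<in>A. z - a \<in> M"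
    using finite_residues[OF m(1)] unfolding M_def by auto
  \<comment> \<open>Two powers of \<open>y\<close> agree modulo \<open>m\<close>, so
    \<open>(1 - y^(j-i)) * y^i\<close> lies in \<open>M\<close>; the first factor is outside
    \<open>P\<close> because \<open>y\<close> is inside. Thus \<open>y\<close> becomes nilpotent
    after localising at \<open>P\<close>.\<close>
  have nilp: "\<exists>s k. s \<in> ints - P \<and> s * y ^ k \<in> M" if y: "y \<in> P" for y
  proof -
    have yi: "y \<in> ints" using ideal_ints[OF Pi(1) y] .
    have "\<forall>k. \<exists>a. a \<in> A \<and> y ^ k - a \<in> M" using A(3) ints_power[OF yi] by blast
    then obtain f where f: "\<And>k. f k \<in> A" "\<And>k. y ^ k - f k \<in> M" by metis
    have "finite (range f)" using A(1) f(1) by (meson finite_subset image_subsetI)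
    hence "\<not> inj f" using range_inj_infinite by blast
    then obtain i j where ij: "i < j" "f i = f j"
      by (metis injI linorder_neqE_nat)
    have "y ^ i - y ^ j = (y ^ i - f i) - (y ^ j - f j)" using ij by simp
    also have "\<dots> \<in> M" by (intro M_diff f)
    also have "y ^ i - y ^ j = (1 - y ^ (j - i)) * y ^ i"
      using ij by (simp add: left_diff_distrib flip: power_add)
    finally have "(1 - y ^ (j - i)) * y ^ i \<in> M" .
    moreover have "1 - y ^ (j - i) \<notin> P"
    proof
      assume "1 - y ^ (j - i) \<in> P"
      moreover have "y ^ (j - i) \<in> P"
      proof -
        obtain l where "j - i = Suc l" using ij by (metis Suc_diff_Suc)
        thus ?thesis using ideal_mult_right[OF Pi(1) ints_power[OF yi] y] by simp
      qed
      ultimately have "1 - y ^ (j - i) + y ^ (j - i) \<in> P" by (rule ideal_add[OF Pi(1)])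
      thus False using Pi(3) by simp
    qed
    moreover have "1 - y ^ (j - i) \<in> ints" using yi by (intro ints_closed)
    ultimately show ?thesis by blast
  qed
  \<comment> \<open>Invariant: \<open>x\<close> stays nonzero modulo \<open>M\<close> after
    localising at \<open>P\<close>, and it kills every element of \<open>Y\<close> modulo
    \<open>M\<close>.\<close>
  have key: "\<exists>x\<in>ints. (\<forall>s\<in>ints - P. s * x \<notin> M) \<and> (\<forall>y\<in>Y. x * y \<in> M)"
    if "finite Y" "Y \<subseteq> P" for Y
    using that
  proof (induction Y rule: finite_induct)
    case empty
    show ?case using M_P by (intro bexI[of _ 1]) (auto intro: ints_1)
  next
    case (insert y Y)
    then obtain x where x: "x \<in> ints" "\<And>s. s \<in> ints - P \<Longrightarrow> s * x \<notin> M" "\<And>z. z \<in> Y \<Longrightarrow> x * z \<in> M"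
      by auto
    have y: "y \<in> P" "y \<in> ints" using insert.prems ideal_ints[OF Pi(1)] by auto
    obtain s0 k0 where sk0: "s0 \<in> ints - P" "s0 * y ^ k0 \<in> M" using nilp[OF y(1)] by blast
    define Q where "Q = (\<lambda>k. \<exists>s\<in>ints - P. s * (x * y ^ k) \<in> M)"
    have "s0 * (x * y ^ k0) = x * (s0 * y ^ k0)" by (simp add: algebra_simps)
    hence "Q k0" using sk0 M_mult[OF x(1) sk0(2)] unfolding Q_def by metis
    \<comment> \<open>The first power of \<open>y\<close> that kills \<open>x\<close> in the
      localisation. The power before it, times \<open>x\<close>, survives, and multiplying by the
      witness \<open>s\<close> makes \<open>y\<close> kill it modulo \<open>M\<close>
      itself.\<close>
    define k where "k = (LEAST k. Q k)"
    have Qk: "Q k" unfolding k_def by (rule LeastI) (rule \<open>Q k0\<close>)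
    then obtain s where s: "s \<in> ints - P" "s * (x * y ^ k) \<in> M" by (auto simp: Q_def)
    have "k \<noteq> 0"
    proof
      assume "k = 0"
      thus False using s x(2)[of s] by simp
    qed
    then obtain l where l: "k = Suc l" by (cases k) auto
    have nQ: "\<not> Q l" using not_less_Least[of l Q] l by (simp add: k_def)
    show ?case
    proof (intro bexI conjI ballI)
      show "s * (x * y ^ l) \<in> ints" using s x(1) y(2) by (intro ints_closed) auto
    next
      fix t assume t: "t \<in> ints - P"
      hence "t * s \<in> ints - P" using s maximal_prime[OF P, of t s] by (auto intro: ints_mult)
      thus "t * (s * (x * y ^ l)) \<notin> M" using nQ unfolding Q_def by (metis mult.assoc)
    next
      fix z assume "z \<in> insert y Y"
      thus "s * (x * y ^ l) * z \<in> M"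
      proof
        assume "z = y"
        thus ?thesis using s(2) by (simp add: l mult_ac)
      next
        assume "z \<in> Y"
        moreover have "s * y ^ l \<in> ints" using s y by (intro ints_closed) auto
        ultimately have "(s * y ^ l) * (x * z) \<in> M" using x(3) M_mult by blast
        thus ?thesis by (simp add: mult_ac)
      qed
    qed
  qed
  \<comment> \<open>Representatives suffice: any \<open>y\<close> in \<open>P\<close> differs from
    some \<open>a\<close> in \<open>A\<close> by an element of \<open>M\<close>, and since
    \<open>M\<close> lies in \<open>P\<close>, this \<open>a\<close> is in \<open>P\<close>
    too.\<close>
  obtain x where x: "x \<in> ints" "\<And>s. s \<in> ints - P \<Longrightarrow> s * x \<notin> M" "\<And>z. z \<in> A \<inter> P \<Longrightarrow> x * z \<in> M"
    using key[of "A \<inter> P"] A(1) by auto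
  have "x / of_nat m \<in> K" using x(1) by (intro divide_mem nat_mem ints_mem)
  moreover have "x / of_nat m \<notin> ints" using x(2)[of 1] Pi(3) ints_1 by (simp add: M_def)
  moreover have "x / of_nat m * y \<in> ints" if y: "y \<in> P" for y
  proof -
    obtain a where a: "a \<in> A" "y - a \<in> M" using A(3) ideal_ints[OF Pi(1) y] by blast
    have "y - (y - a) \<in> P" using y M_P[OF a(2)] by (rule ideal_diff[OF Pi(1)])
    hence "x * a \<in> M" using a x(3) by simp
    hence "x * a / of_nat m + x * ((y - a) / of_nat m) \<in> ints"
      using a(2) x(1) by (intro ints_closed) (auto simp: M_def)
    also have "x * a / of_nat m + x * ((y - a) / of_nat m) = x / of_nat m * y"
      by (simp add: algebra_simps flip: add_divide_distrib)
    finally show ?thesis .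
  qed
  ultimately show ?thesis using that by blast
qed

text \<open>\<open>q * P\<close> is not inside \<open>P\<close>, for otherwise \<open>q\<close>
  would be integral. So some \<open>q * b\<close> is invertible modulo \<open>P\<close>; scaling
  \<open>b\<close> by that inverse puts \<open>1 - q * b\<close> into \<open>P\<close>. This is the
  invertibility of \<open>P\<close> as a fractional ideal.\<close>

lemma maximal_inverse:
  assumes P: "is_maximal P"
  obtains q a b where "q \<in> K" "q \<notin> ints" "\<And>x. x \<in> P \<Longrightarrow> q * x \<in> ints" "a \<in> P" "b \<in> P" "a + q * b = 1"
proof -
  have Pi: "is_ideal P" "P \<noteq> {0}" using P by (auto simp: is_maximal_def)
  obtain q where q: "q \<in> K" "q \<notin> ints" "\<And>x. x \<in> P \<Longrightarrow> q * x \<in> ints"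
    using maximal_dual_element[OF P] by blast
  obtain b where b: "b \<in> P" "q * b \<notin> P"
    using multiplier_integral[OF Pi q(1)] q(2) by blast
  then obtain r where r: "r \<in> ints" "1 - r * (q * b) \<in> P"
    using P q(3)[OF b(1)] by (auto simp: is_maximal_def)
  show ?thesis
    by (rule that[OF q r(2), of "r * b"]) (use ideal_mult[OF Pi(1) r(1) b(1)] in \<open>auto simp: algebra_simps\<close>)
qed

text \<open>The quotient of \<open>J\<close> by \<open>P\<close> as fractional ideals, formed inside
  \<open>K\<close>; it consists of integers once \<open>J\<close> lies in \<open>P\<close>.\<close>

definition colon :: "complex set \<Rightarrow> complex set \<Rightarrow> complex set" where
  "colon P J = {y \<in> K. \<forall>x\<in>P. y * x \<in> J}"

lemma colon_ideal:
  assumes P: "is_maximal P" and J: "is_ideal J" "J \<subseteq> P"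
  shows "is_ideal (colon P J)" "J \<subseteq> colon P J"
proof -
  have Pi: "is_ideal P" "P \<noteq> {0}" using P by (auto simp: is_maximal_def)
  show "is_ideal (colon P J)"
  proof (rule is_idealI)
    show "colon P J \<subseteq> ints" using J multiplier_integral[OF Pi] by (auto simp: colon_def)
    show "0 \<in> colon P J" using ideal_0[OF J(1)] zero_mem by (auto simp: colon_def)
  next
    fix x y assume "x \<in> colon P J" "y \<in> colon P J"
    thus "x + y \<in> colon P J" using ideal_add[OF J(1)] by (auto simp: colon_def distrib_right intro: add_mem)
  next
    fix r x assume "r \<in> ints" "x \<in> colon P J"
    thus "r * x \<in> colon P J" using ideal_mult[OF J(1)] by (auto simp: colon_def mult.assoc intro: mult_mem ints_mem)
  qed
  show "J \<subseteq> colon P J"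
    using ideal_ints[OF J(1)] ideal_mult_right[OF J(1)] ideal_ints[OF Pi(1)] by (auto simp: colon_def intro: ints_mem)
qed

text \<open>If equality held, \<open>q * J\<close> would be inside \<open>J\<close>: for
  \<open>x\<close> in \<open>J\<close> and \<open>y\<close> in \<open>P\<close>, the product
  \<open>(q * x) * y = (q * y) * x\<close> lies in \<open>J\<close>. That forces \<open>q\<close> to
  be integral.\<close>

lemma colon_neq:
  assumes P: "is_maximal P" and J: "is_ideal J" "J \<noteq> {0}" "J \<subseteq> P"
  shows "colon P J \<noteq> J"
proof
  assume e: "colon P J = J"
  obtain q where q: "q \<in> K" "q \<notin> ints" "\<And>x. x \<in> P \<Longrightarrow> q * x \<in> ints"
    using maximal_dual_element[OF P] by blast
  have "q * x \<in> J" if x: "x \<in> J" for x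
  proof -
    have "q * x * y \<in> J" if "y \<in> P" for y
      using ideal_mult[OF J(1) q(3)[OF that] x] by (simp add: mult_ac)
    hence "q * x \<in> colon P J" using q(1) ideal_ints[OF J(1) x] by (auto simp: colon_def intro: mult_mem ints_mem)
    thus ?thesis using e by simp
  qed
  thus False using multiplier_integral[OF J(1,2) q(1)] q(2) by blast
qed

text \<open>In \<open>x = a * x + b * (q * x)\<close> both \<open>x\<close> and \<open>q * x\<close>
  lie in the colon ideal, which expresses \<open>J\<close> through \<open>colon P J\<close>.\<close>

lemma colon_inj_on:
  assumes P: "is_maximal P"
  shows "inj_on (colon P) {J. is_ideal J \<and> J \<subseteq> P}"
proof -
  obtain q a b where q: "q \<in> K" "q \<notin> ints" "\<And>x. x \<in> P \<Longrightarrow> q * x \<in> ints"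
    and ab: "a \<in> P" "b \<in> P" "a + q * b = 1"
    using maximal_inverse[OF P] by blast
  have *: "J = {a * u + b * v | u v. u \<in> colon P J \<and> v \<in> colon P J}" if J: "is_ideal J" "J \<subseteq> P" for J
  proof (intro equalityI subsetI)
    fix x assume x: "x \<in> J"
    have "q * x * y \<in> J" if "y \<in> P" for y
      using ideal_mult[OF J(1) q(3)[OF that] x] by (simp add: mult_ac)
    hence "q * x \<in> colon P J" using q(1) ideal_ints[OF J(1) x] by (auto simp: colon_def intro: mult_mem ints_mem)
    moreover have "x \<in> colon P J" using colon_ideal(2)[OF P J] x by blast
    moreover have "x = a * x + b * (q * x)"
    proof -
      have "x = (a + q * b) * x" using ab by simp
      thus ?thesis by (simp add: algebra_simps)
    qed
    ultimately show "x \<in> {a * u + b * v | u v. u \<in> colon P J \<and> v \<in> colon P J}" by blast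
  next
    fix x assume "x \<in> {a * u + b * v | u v. u \<in> colon P J \<and> v \<in> colon P J}"
    then obtain u v where "x = u * a + v * b" "u * a \<in> J" "v * b \<in> J"
      using ab by (auto simp: colon_def mult.commute)
    thus "x \<in> J" using ideal_add[OF J(1)] by simp
  qed
  show ?thesis
  proof (rule inj_onI)
    fix J J' assume "J \<in> {J. is_ideal J \<and> J \<subseteq> P}" "J' \<in> {J. is_ideal J \<and> J \<subseteq> P}" "colon P J = colon P J'"
    thus "J = J'" using *[of J] *[of J'] by simp
  qed
qed

end

context numfield begin

section \<open>Norms of ideals\<close>

definition cosets :: "complex set \<Rightarrow> complex set set" where
  "cosets I = (\<lambda>x. (+) x ` I) ` ints"

definition index :: "complex set \<Rightarrow> nat" where
  "index I = card (cosets I)"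

lemma coset_eq_iff:
  assumes "is_ideal I"
  shows "(+) x ` I = (+) y ` I \<longleftrightarrow> x - y \<in> I"
proof
  assume "(+) x ` I = (+) y ` I"
  moreover have "x + 0 \<in> (+) x ` I" using ideal_0[OF assms] by blast
  ultimately have "x \<in> (+) y ` I" by simp
  thus "x - y \<in> I" by auto
next
  have *: "(+) a ` I \<subseteq> (+) b ` I" if "a - b \<in> I" for a b
  proof
    fix z assume "z \<in> (+) a ` I"
    then obtain i where "i \<in> I" "z = b + ((a - b) + i)" by auto
    thus "z \<in> (+) b ` I" using ideal_add[OF assms that] by blast
  qed
  assume "x - y \<in> I"
  moreover from this have "y - x \<in> I" using ideal_uminus[OF assms, of "x - y"] by simp
  ultimately show "(+) x ` I = (+) y ` I" using * by blast
qed

lemma finite_cosets: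
  assumes "is_ideal I" "I \<noteq> {0}"
  shows "finite (cosets I)"
proof -
  obtain m :: nat where m: "m > 0" "of_nat m \<in> I" using ideal_integer[OF assms] .
  obtain A where A: "finite A" "A \<subseteq> ints" "\<And>z. z \<in> ints \<Longrightarrow> \<exists>a\<in>A. (z - a) / of_nat m \<in> ints"
    using finite_residues[OF m(1)] by blast
  have "cosets I \<subseteq> (\<lambda>x. (+) x ` I) ` A"
  proof
    fix C assume "C \<in> cosets I"
    then obtain z where z: "z \<in> ints" "C = (+) z ` I" by (auto simp: cosets_def)
    obtain a where a: "a \<in> A" "(z - a) / of_nat m \<in> ints" using A(3)[OF z(1)] by blast
    have "(z - a) / of_nat m * of_nat m \<in> I" using ideal_mult[OF assms(1) a(2) m(2)] .
    hence "z - a \<in> I" using m by simp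
    thus "C \<in> (\<lambda>x. (+) x ` I) ` A" using a z coset_eq_iff[OF assms(1)] by blast
  qed
  thus ?thesis using A(1) finite_surj by blast
qed

lemma card_le_index:
  assumes "is_ideal I" "I \<noteq> {0}" "\<And>s. s \<in> S \<Longrightarrow> f s \<in> ints"
    "\<And>s t. \<lbrakk>s \<in> S; t \<in> S; f s - f t \<in> I\<rbrakk> \<Longrightarrow> s = t"
  shows "card S \<le> index I"
  unfolding index_def
proof (rule card_inj_on_le[OF _ _ finite_cosets[OF assms(1,2)]])
  show "inj_on (\<lambda>s. (+) (f s) ` I) S"
    using assms(4) by (auto simp: inj_on_def coset_eq_iff[OF assms(1)])
  show "(\<lambda>s. (+) (f s) ` I) ` S \<subseteq> cosets I"
    using assms(3) by (auto simp: cosets_def)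
qed

lemma coset_representatives:
  assumes "is_ideal I"
  obtains S where "S \<subseteq> ints" "card S = index I" "\<And>s t. \<lbrakk>s \<in> S; t \<in> S; s - t \<in> I\<rbrakk> \<Longrightarrow> s = t"
proof -
  obtain S where "S \<subseteq> ints" "inj_on (\<lambda>x. (+) x ` I) S" "cosets I = (\<lambda>x. (+) x ` I) ` S"
    by (metis cosets_def subset_image_inj subset_refl)
  thus ?thesis
    using that[of S] by (auto simp: index_def card_image inj_on_def coset_eq_iff[OF assms])
qed

lemma index_pos:
  assumes "is_ideal I" "I \<noteq> {0}"
  shows "index I > 0"
  using finite_cosets[OF assms] ints_0 by (auto simp: index_def card_gt_0_iff cosets_def)

lemma index_ints: "index ints = 1"
proof -
  have "(+) x ` ints = (+) 0 ` ints" if "x \<in> ints" for x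
    using coset_eq_iff[OF ints_ideal, of x 0] that by simp
  hence "cosets ints = {(+) 0 ` ints}" unfolding cosets_def using ints_0 by blast
  thus ?thesis by (simp add: index_def)
qed

lemma index_proper:
  assumes "is_ideal I" "I \<noteq> {0}" "1 \<notin> I"
  shows "index I \<ge> 2"
proof -
  have "card {0::complex,1} \<le> index I"
  proof (rule card_le_index[OF assms(1,2), of _ id])
    show "\<And>s t. \<lbrakk>s \<in> {0,1}; t \<in> {0,1}; id s - id t \<in> I\<rbrakk> \<Longrightarrow> s = t"
      using assms(3) ideal_uminus[OF assms(1), of "-1"] by auto
  qed (auto intro: ints_closed)
  thus ?thesis by simp
qed

text \<open>Take \<open>u\<close> in \<open>colon P J\<close> but not in \<open>J\<close>. Its
  annihilator modulo \<open>J\<close> is exactly \<open>P\<close>, so the sums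
  \<open>t + s * u\<close>, with \<open>t\<close> modulo \<open>colon P J\<close> and
  \<open>s\<close> modulo \<open>P\<close>, are pairwise incongruent modulo
  \<open>J\<close>.\<close>

lemma index_colon:
  assumes P: "is_maximal P" and J: "is_ideal J" "J \<noteq> {0}" "J \<subseteq> P"
  shows "index P * index (colon P J) \<le> index J"
proof -
  have Pi: "is_ideal P" "P \<noteq> {0}" using P by (auto simp: is_maximal_def)
  have C: "is_ideal (colon P J)" "J \<subseteq> colon P J" using colon_ideal[OF P J(1,3)] by auto
  obtain u where u: "u \<in> colon P J" "u \<notin> J" using colon_neq[OF P J] C by blast
  have ui: "u \<in> ints" using ideal_ints[OF C(1) u(1)] .
  have ker: "a \<in> P" if a: "a \<in> ints" "a * u \<in> J" for a
  proof (rule ccontr)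
    assume "a \<notin> P"
    then obtain r where r: "r \<in> ints" "1 - r * a \<in> P" using P a by (auto simp: is_maximal_def)
    have "(1 - r * a) * u \<in> J" using u r by (auto simp: colon_def mult.commute)
    moreover have "r * (a * u) \<in> J" using ideal_mult[OF J(1) r(1) a(2)] .
    ultimately have "(1 - r * a) * u + r * (a * u) \<in> J" by (rule ideal_add[OF J(1)])
    thus False using u by (simp add: algebra_simps)
  qed
  obtain S where S: "S \<subseteq> ints" "card S = index P" "\<And>s t. \<lbrakk>s \<in> S; t \<in> S; s - t \<in> P\<rbrakk> \<Longrightarrow> s = t"
    using coset_representatives[OF Pi(1)] by blast
  obtain T where T: "T \<subseteq> ints" "card T = index (colon P J)"
      "\<And>s t. \<lbrakk>s \<in> T; t \<in> T; s - t \<in> colon P J\<rbrakk> \<Longrightarrow> s = t"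
    using coset_representatives[OF C(1)] by blast
  have "card (S \<times> T) \<le> index J"
  proof (rule card_le_index[OF J(1,2), of _ "\<lambda>(s,t). t + s * u"])
    fix x assume "x \<in> S \<times> T"
    thus "(case x of (s, t) \<Rightarrow> t + s * u) \<in> ints" using S T ui by (auto intro!: ints_closed)
  next
    fix x y assume xy: "x \<in> S \<times> T" "y \<in> S \<times> T"
      "(case x of (s, t) \<Rightarrow> t + s * u) - (case y of (s, t) \<Rightarrow> t + s * u) \<in> J"
    then obtain s t s' t' where st: "x = (s,t)" "y = (s',t')" "s \<in> S" "s' \<in> S" "t \<in> T" "t' \<in> T"
      "(t + s * u) - (t' + s' * u) \<in> J" by auto
    have si: "s - s' \<in> ints" using st S by (intro ints_diff) auto
    have "(t + s * u) - (t' + s' * u) - (s - s') * u \<in> colon P J"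
      by (rule ideal_diff[OF C(1)]) (use st(7) C u(1) si in \<open>auto intro: ideal_mult\<close>)
    hence "t = t'" using T(3)[OF st(5,6)] by (simp add: algebra_simps)
    hence "(s - s') * u \<in> J" using st(7) by (simp add: algebra_simps)
    hence "s = s'" using ker[OF si] S(3) st by blast
    thus "x = y" using st \<open>t = t'\<close> by simp
  qed
  thus ?thesis using S T by (simp add: card_cartesian_product)
qed

section \<open>The Euler product bound\<close>

definition nz_ideals :: "complex set set" where
  "nz_ideals = {I. is_ideal I \<and> I \<noteq> {0}}"

text \<open>Induction over \<open>T\<close>. When \<open>P\<close> is added, the ideals not inside
  \<open>P\<close> are covered by the smaller product, while \<open>colon P\<close> carries those
  inside \<open>P\<close> injectively to ideals of norm smaller by the factor
  \<open>index P\<close>. This suggests the self-referential estimate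
  \<open>S \<le> B + x * S\<close>.\<close>

lemma euler_bound_partial:
  assumes s: "s > 1" and T: "finite T" "\<And>P. P \<in> T \<Longrightarrow> is_maximal P"
    and F: "finite F" "F \<subseteq> nz_ideals" "\<And>I P. \<lbrakk>I \<in> F; is_maximal P; I \<subseteq> P\<rbrakk> \<Longrightarrow> P \<in> T"
  shows "(\<Sum>I\<in>F. real (index I) powr - s) \<le> (\<Prod>P\<in>T. 1 / (1 - real (index P) powr - s))"
  using T F
proof (induction T arbitrary: F rule: finite_induct)
  case empty
  have "F \<subseteq> {ints}"
  proof
    fix I assume I: "I \<in> F"
    hence "is_ideal I" "I \<noteq> {0}" using empty.prems by (auto simp: nz_ideals_def)
    hence "1 \<in> I" using exists_maximal[of I] empty.prems(4)[OF I] by blast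
    thus "I \<in> {ints}" using ideal_eq_ints \<open>is_ideal I\<close> by blast
  qed
  hence "(\<Sum>I\<in>F. real (index I) powr - s) \<le> (\<Sum>I\<in>{ints}. real (index I) powr - s)"
    by (intro sum_mono2) auto
  thus ?case by (simp add: index_ints)
next
  case (insert P T)
  define x where "x = real (index P) powr - s"
  define B where "B = (\<Prod>P\<in>T. 1 / (1 - real (index P) powr - s))"
  have P: "is_maximal P" using insert.prems by simp
  have Pi: "is_ideal P" "P \<noteq> {0}" "1 \<notin> P" using P by (auto simp: is_maximal_def)
  have P2: "index P \<ge> 2" using index_proper[OF Pi] .
  hence x: "x > 0" "x < 1"
    using s powr_less_mono2_neg[of "-s" 1 "real (index P)"] by (auto simp: x_def)
  \<comment> \<open>The images under \<open>colon P\<close> need not belong to \<open>F\<close>, so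
    the estimate is proved for all admissible \<open>F\<close> at once, by induction on a bound
    \<open>m\<close> for the norms; \<open>colon P\<close> at least halves the norm.\<close>
  have main: "(\<Sum>I\<in>F. real (index I) powr - s) \<le> B / (1 - x)"
    if "finite F" "F \<subseteq> nz_ideals" "\<And>I Q. \<lbrakk>I \<in> F; is_maximal Q; I \<subseteq> Q\<rbrakk> \<Longrightarrow> Q \<in> insert P T"
      "\<And>I. I \<in> F \<Longrightarrow> index I \<le> m" for F m
    using that
  proof (induction m arbitrary: F)
    case 0
    have "F = {}"
    proof (rule ccontr)
      assume "F \<noteq> {}"
      then obtain I where I: "I \<in> F" by blast
      hence "index I > 0" using "0.prems"(2) by (intro index_pos) (auto simp: nz_ideals_def)
      thus False using "0.prems"(4)[OF I] by simp
    qed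
    moreover have "(\<Sum>I\<in>{}. real (index I) powr - s) \<le> B"
      unfolding B_def by (rule insert.IH) (use insert.prems in auto)
    ultimately show ?case using x by (simp add: divide_nonneg_pos)
  next
    case (Suc m)
    define F0 where "F0 = {I\<in>F. \<not> I \<subseteq> P}"
    define F1 where "F1 = {I\<in>F. I \<subseteq> P}"
    have FU: "F = F0 \<union> F1" "F0 \<inter> F1 = {}" "finite F0" "finite F1"
      using Suc.prems(1) by (auto simp: F0_def F1_def)
    have s0: "(\<Sum>I\<in>F0. real (index I) powr - s) \<le> B"
      unfolding B_def
    proof (rule insert.IH)
      show "Q \<in> T" if "I \<in> F0" "is_maximal Q" "I \<subseteq> Q" for I Q
        using Suc.prems(3)[of I Q] that by (auto simp: F0_def)
    qed (use insert.prems Suc.prems in \<open>auto simp: F0_def\<close>)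
    have I1: "is_ideal I" "I \<noteq> {0}" "I \<subseteq> P" "I \<in> F" if "I \<in> F1" for I
      using that Suc.prems(2) by (auto simp: F1_def nz_ideals_def)
    have C1: "is_ideal (colon P I)" "I \<subseteq> colon P I" "colon P I \<noteq> {0}"
        "index P * index (colon P I) \<le> index I" "index (colon P I) > 0" if "I \<in> F1" for I
    proof -
      show c: "is_ideal (colon P I)" "I \<subseteq> colon P I" using colon_ideal[OF P] I1[OF that] by auto
      show c0: "colon P I \<noteq> {0}" using c I1[OF that] ideal_0 by blast
      show "index P * index (colon P I) \<le> index I" using index_colon[OF P] I1[OF that] by auto
      show "index (colon P I) > 0" using index_pos[OF c(1) c0] .
    qed
    have inj: "inj_on (colon P) F1"
      using colon_inj_on[OF P] by (rule inj_on_subset) (use I1 in blast)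
    have s1': "(\<Sum>I\<in>colon P ` F1. real (index I) powr - s) \<le> B / (1 - x)"
    proof (rule Suc.IH)
      show "finite (colon P ` F1)" using FU by simp
      show "colon P ` F1 \<subseteq> nz_ideals" using C1 by (auto simp: nz_ideals_def)
    next
      fix I Q assume "I \<in> colon P ` F1" "is_maximal Q" "I \<subseteq> Q"
      then obtain J where "J \<in> F1" "I = colon P J" by blast
      thus "Q \<in> insert P T" using Suc.prems(3)[of J Q] C1(2)[of J] I1(4)[of J] \<open>is_maximal Q\<close> \<open>I \<subseteq> Q\<close> by blast
    next
      fix I assume "I \<in> colon P ` F1"
      then obtain J where J: "J \<in> F1" "I = colon P J" by blast
      have "2 * index I \<le> index P * index I" using P2 by simp
      also have "\<dots> \<le> index J" using C1(4)[OF J(1)] J(2) by simp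
      also have "\<dots> \<le> Suc m" using Suc.prems(4) I1(4)[OF J(1)] by blast
      finally show "index I \<le> m" using C1(5)[OF J(1)] J(2) by simp
    qed
    have "(\<Sum>I\<in>F1. real (index I) powr - s) \<le> (\<Sum>I\<in>F1. x * real (index (colon P I)) powr - s)"
    proof (rule sum_mono)
      fix I assume I: "I \<in> F1"
      have "real (index I) powr - s \<le> (real (index P) * real (index (colon P I))) powr - s"
      proof (rule powr_mono2')
        show "real (index P) * real (index (colon P I)) \<le> real (index I)"
          using C1(4)[OF I] by (metis of_nat_le_iff of_nat_mult)
        show "0 < real (index P) * real (index (colon P I))" using P2 C1(5)[OF I] by simp
      qed (use s in simp)
      thus "real (index I) powr - s \<le> x * real (index (colon P I)) powr - s"
        by (simp add: x_def powr_mult)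
    qed
    also have "\<dots> = x * (\<Sum>I\<in>colon P ` F1. real (index I) powr - s)"
      by (simp add: sum.reindex[OF inj] sum_distrib_left)
    also have "\<dots> \<le> x * (B / (1 - x))" using s1' x by (intro mult_left_mono) auto
    finally have "(\<Sum>I\<in>F. real (index I) powr - s) \<le> B + x * (B / (1 - x))"
      using s0 FU by (simp add: sum.union_disjoint)
    \<comment> \<open>\<open>B / (1 - x)\<close> is the fixed point of the estimate, which closes
      the induction with the Euler factor of \<open>P\<close>.\<close>
    also have "\<dots> = B / (1 - x)" using x by (simp add: field_simps)
    finally show ?case .
  qed
  have "(\<Sum>I\<in>F. real (index I) powr - s) \<le> B / (1 - x)"
    by (rule main[of F "\<Sum>I\<in>F. index I"]) (use insert.prems in \<open>auto intro: member_le_sum\<close>)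
  thus ?case using insert.hyps by (simp add: B_def x_def)
qed

lemma maximal_incomparable:
  assumes "is_maximal P" "is_maximal Q" "P \<noteq> Q"
  obtains y where "y \<in> Q" "y \<notin> P"
proof -
  have "\<not> Q \<subseteq> P"
  proof
    assume sub: "Q \<subseteq> P"
    then obtain x where x: "x \<in> P" "x \<notin> Q" using assms(3) by blast
    hence xi: "x \<in> ints" using ideal_ints[OF maximal_ideal[OF assms(1)]] by blast
    then obtain r where r: "r \<in> ints" "1 - r * x \<in> Q" using assms(2) x by (auto simp: is_maximal_def)
    have "1 - r * x + r * x \<in> P"
      using maximal_ideal[OF assms(1)] r x sub by (intro ideal_add ideal_mult) auto
    thus False using maximal_one[OF assms(1)] by simp
  qed
  thus ?thesis using that by blast
qed

text \<open>Given \<open>n + 1\<close> such ideals \<open>Q i\<close>, choose integers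
  \<open>e i\<close> outside \<open>Q i\<close> but inside all the others. A relation among them,
  read modulo \<open>Q i\<close>, leaves only \<open>c i * e i\<close>, so \<open>p\<close> divides
  every \<open>c i\<close>, against \<open>relation_not_dvd\<close>.\<close>

lemma card_maximal_above:
  assumes p: "prime p" and S: "finite S" "\<And>P. P \<in> S \<Longrightarrow> is_maximal P \<and> of_nat p \<in> P"
  shows "card S \<le> n"
proof (rule ccontr)
  assume "\<not> card S \<le> n"
  hence "card {..n} \<le> card S" by simp
  then obtain Q where Q: "Q ` {..n} \<subseteq> S" "inj_on Q {..n}"
    using card_le_inj[OF _ S(1)] by (metis finite_atMost)
  have Qm: "is_maximal (Q i)" "of_nat p \<in> Q i" if "i \<le> n" for i
    using Q(1) S(2) that by blast+
  have "\<exists>e. e \<in> ints \<and> e \<notin> Q i \<and> (\<forall>j\<le>n. j \<noteq> i \<longrightarrow> e \<in> Q j)" if i: "i \<le> n" for i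
  proof -
    have "\<forall>j\<in>{..n} - {i}. \<exists>y. y \<in> Q j \<and> y \<notin> Q i"
    proof
      fix j assume j: "j \<in> {..n} - {i}"
      hence "Q i \<noteq> Q j" using Q(2) i by (auto simp: inj_on_def)
      thus "\<exists>y. y \<in> Q j \<and> y \<notin> Q i" using maximal_incomparable[OF Qm(1)[OF i] Qm(1)[of j]] j by auto
    qed
    then obtain y where y: "\<And>j. j \<in> {..n} - {i} \<Longrightarrow> y j \<in> Q j \<and> y j \<notin> Q i" by metis
    have yi: "y j \<in> ints" if "j \<in> {..n} - {i}" for j
      using y[OF that] ideal_ints[OF maximal_ideal[OF Qm(1)[of j]]] that by auto
    have "prod y ({..n} - {i}) \<in> ints - Q i"
      by (rule maximal_prod[OF Qm(1)[OF i]]) (use y yi in auto)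
    moreover have "prod y ({..n} - {i}) \<in> Q j" if j: "j \<le> n" "j \<noteq> i" for j
    proof -
      have "prod y ({..n} - {i}) = y j * prod y ({..n} - {i} - {j})"
        using j by (intro prod.remove) auto
      also have "\<dots> \<in> Q j"
        using ideal_mult_right[OF maximal_ideal[OF Qm(1)[OF j(1)]]] y[of j] yi j ints_prod[of "{..n} - {i} - {j}" y]
        by auto
      finally show ?thesis .
    qed
    ultimately show ?thesis by blast
  qed
  then obtain e where e: "\<And>i. i \<le> n \<Longrightarrow> e i \<in> ints" "\<And>i. i \<le> n \<Longrightarrow> e i \<notin> Q i"
      "\<And>i j. \<lbrakk>i \<le> n; j \<le> n; j \<noteq> i\<rbrakk> \<Longrightarrow> e i \<in> Q j"
    by metis
  obtain c :: "nat \<Rightarrow> int" where c: "\<exists>i\<le>n. \<not> int p dvd c i" "(\<Sum>i\<le>n. of_int (c i) * e i) = 0"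
    by (rule relation_not_dvd[OF p ints_mem[OF e(1)]])
  then obtain i where i: "i \<le> n" "\<not> int p dvd c i" by blast
  have Qi: "is_ideal (Q i)" using maximal_ideal[OF Qm(1)[OF i(1)]] .
  have "0 = of_int (c i) * e i + (\<Sum>j\<in>{..n} - {i}. of_int (c j) * e j)"
    using c(2) i by (subst (asm) sum.remove[of _ i]) auto
  hence "of_int (c i) * e i = - (\<Sum>j\<in>{..n} - {i}. of_int (c j) * e j)"
    by (simp add: eq_neg_iff_add_eq_0)
  also have "\<dots> \<in> Q i"
    using e(3) i by (intro ideal_uminus[OF Qi] ideal_sum[OF Qi] ideal_mult[OF Qi] ints_of_int) auto
  finally have "of_int (c i) \<in> Q i"
    using maximal_prime[OF Qm(1)[OF i(1)] ints_of_int e(1)[OF i(1)]] e(2)[OF i(1)] by blast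
  thus False using maximal_int_dvd[OF Qm(1)[OF i(1)] p Qm(2)[OF i(1)]] i by blast
qed

lemma maximal_contains_prime:
  assumes "is_maximal P"
  obtains p :: nat where "prime p" "of_nat p \<in> P"
proof -
  have P: "is_ideal P" "P \<noteq> {0}" using assms by (auto simp: is_maximal_def)
  have *: "\<exists>p. prime p \<and> of_nat p \<in> P" if "m > 0" "of_nat m \<in> P" for m :: nat
    using that
  proof (induction m rule: less_induct)
    case (less m)
    have "m \<noteq> 1" using less.prems maximal_one[OF assms] by auto
    then obtain p k where p: "prime p" "m = p * k" using prime_factor_nat by (metis dvdE)
    have k: "k > 0" "k < m" using p less.prems prime_gt_1_nat[OF p(1)] by auto
    have "of_nat p * of_nat k \<in> P" using less.prems p by simp
    hence "of_nat p \<in> P \<or> of_nat k \<in> P" using maximal_prime[OF assms ints_of_nat ints_of_nat] by blast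
    thus ?case using p less.IH[OF k(2,1)] by blast
  qed
  obtain m :: nat where m: "m > 0" "of_nat m \<in> P" using ideal_integer[OF P] .
  thus ?thesis using *[OF m] that by blast
qed

lemma prime_le_index:
  assumes "is_maximal P" "prime p" "of_nat p \<in> P"
  shows "p \<le> index P"
proof -
  have "card {..<p} \<le> index P"
  proof (rule card_le_index[of P _ of_nat])
    fix s t assume st: "s \<in> {..<p}" "t \<in> {..<p}" "of_nat s - of_nat t \<in> P"
    hence "of_int (int s - int t) \<in> P" by simp
    hence "int p dvd int s - int t" using maximal_int_dvd[OF assms] by blast
    moreover have "\<bar>int s - int t\<bar> < int p" using st by auto
    ultimately show "s = t" using dvd_imp_le_int by (metis abs_of_nat eq_iff_diff_eq_0 not_le of_nat_eq_iff)
  qed (use assms in \<open>auto simp: is_maximal_def intro: ints_of_nat\<close>)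
  thus ?thesis by simp
qed

text \<open>\<open>w p\<close> bounds the contribution of each single prime ideal above
  \<open>p\<close>, and \<open>W\<close> the sum of these weights. With \<open>w\<close> left free,
  the same bound serves both convergence and the sharp estimate for fields with inert
  primes.\<close>

theorem sum_index_le_exp:
  assumes s: "s > 1" and F: "finite F" "F \<subseteq> nz_ideals"
    and w: "\<And>P p. \<lbrakk>is_maximal P; prime p; of_nat p \<in> P\<rbrakk> \<Longrightarrow> real (index P) powr - s \<le> w p"
    and W: "\<And>Q. \<lbrakk>finite Q; Q \<subseteq> {p. prime p}\<rbrakk> \<Longrightarrow> (\<Sum>p\<in>Q. w p) \<le> W"
  shows "(\<Sum>I\<in>F. real (index I) powr - s) \<le> exp (2 * real n * W)"
proof -
  define T where "T = {P. is_maximal P \<and> (\<exists>I\<in>F. I \<subseteq> P)}"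
  have "finite {P. is_maximal P \<and> I \<subseteq> P}" if I: "I \<in> F" for I
  proof -
    have "is_ideal I" "I \<noteq> {0}" using F I by (auto simp: nz_ideals_def)
    then obtain m :: nat where m: "m > 0" "of_nat m \<in> I" using ideal_integer by blast
    have "{P. is_maximal P \<and> I \<subseteq> P} \<subseteq> {J. is_ideal J \<and> of_nat m \<in> J}"
      using m maximal_ideal by blast
    thus ?thesis using finite_ideals_above[OF m(1)] finite_subset by blast
  qed
  moreover have "T = (\<Union>I\<in>F. {P. is_maximal P \<and> I \<subseteq> P})" by (auto simp: T_def)
  ultimately have finT: "finite T" using F(1) by auto
  have Tm: "is_maximal P" if "P \<in> T" for P using that by (simp add: T_def)
  have "\<forall>P\<in>T. \<exists>p. prime p \<and> of_nat p \<in> P" using maximal_contains_prime[OF Tm] by metis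
  then obtain g where g: "\<And>P. P \<in> T \<Longrightarrow> prime (g P) \<and> of_nat (g P) \<in> P" by metis
  have sumT: "(\<Sum>P\<in>T. real (index P) powr - s) \<le> real n * W"
  proof -
    have w0: "w p \<ge> 0" if "p \<in> g ` T" for p
    proof -
      obtain P where "P \<in> T" "p = g P" using \<open>p \<in> g ` T\<close> by blast
      thus ?thesis using w[OF Tm] g by (meson order_trans powr_ge_zero)
    qed
    have "(\<Sum>P\<in>T. real (index P) powr - s) \<le> (\<Sum>P\<in>T. w (g P))"
      by (intro sum_mono w Tm) (use g in auto)
    also have "\<dots> = (\<Sum>p\<in>g ` T. \<Sum>P\<in>{P\<in>T. g P = p}. w (g P))"
      by (rule sum.image_gen[OF finT])
    also have "\<dots> \<le> (\<Sum>p\<in>g ` T. real n * w p)"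
    proof (rule sum_mono)
      fix p assume p: "p \<in> g ` T"
      have "card {P\<in>T. g P = p} \<le> n"
      proof (rule card_maximal_above[of p])
        show "prime p" using p g by blast
        show "finite {P\<in>T. g P = p}" using finT by simp
        show "is_maximal P \<and> of_nat p \<in> P" if "P \<in> {P\<in>T. g P = p}" for P
          using g[of P] Tm[of P] that by auto
      qed
      hence "real (card {P\<in>T. g P = p}) * w p \<le> real n * w p" using w0[OF p] by (intro mult_right_mono) auto
      thus "(\<Sum>P\<in>{P\<in>T. g P = p}. w (g P)) \<le> real n * w p" by simp
    qed
    also have "\<dots> = real n * (\<Sum>p\<in>g ` T. w p)" by (simp add: sum_distrib_left)
    also have "\<dots> \<le> real n * W" by (intro mult_left_mono W) (use finT g in auto)
    finally show ?thesis .
  qed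
  have "(\<Sum>I\<in>F. real (index I) powr - s) \<le> (\<Prod>P\<in>T. 1 / (1 - real (index P) powr - s))"
    by (rule euler_bound_partial[OF s finT Tm F]) (auto simp: T_def)
  also have "\<dots> \<le> (\<Prod>P\<in>T. exp (2 * real (index P) powr - s))"
  proof (rule prod_mono, intro conjI)
    fix P assume P: "P \<in> T"
    define x where "x = real (index P) powr - s"
    have i2: "real (index P) \<ge> 2" using index_proper[of P] Tm[OF P] by (auto simp: is_maximal_def)
    have "x \<le> 2 powr - s" unfolding x_def using i2 s by (intro powr_mono2') auto
    also have "\<dots> \<le> 2 powr (-1)" using s by (intro powr_mono) auto
    finally have x: "x \<ge> 0" "x \<le> 1/2" by (auto simp: x_def powr_minus)
    show "0 \<le> 1 / (1 - real (index P) powr - s)" using x by (simp add: x_def)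
    \<comment> \<open>For \<open>x\<close> between 0 and 1/2,
      \<open>1 / (1 - x) \<le> 1 + 2 * x \<le> exp (2 * x)\<close>; hence the 2 in the
      exponent.\<close>
    have "x * x \<le> x * (1/2)" using x by (intro mult_left_mono) auto
    hence "1 \<le> (1 - x) * (1 + 2 * x)" by (simp add: algebra_simps)
    hence "1 / (1 - x) \<le> 1 + 2 * x" using x by (simp add: divide_le_eq mult.commute)
    also have "\<dots> \<le> exp (2 * x)" by (rule exp_ge_add_one_self)
    finally show "1 / (1 - real (index P) powr - s) \<le> exp (2 * real (index P) powr - s)" by (simp add: x_def)
  qed
  also have "\<dots> = exp (2 * (\<Sum>P\<in>T. real (index P) powr - s))"
    using finT by (simp add: exp_sum sum_distrib_left)
  also have "\<dots> \<le> exp (2 * real n * W)" using sumT by simp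
  finally show ?thesis .
qed

end

section \<open>Number fields as subrings of the complex numbers\<close>

lemma CC_simps [simp]:
  "carrier CC = UNIV" "x \<otimes>\<^bsub>CC\<^esub> y = x * y" "x \<oplus>\<^bsub>CC\<^esub> y = x + y" "\<zero>\<^bsub>CC\<^esub> = 0" "\<one>\<^bsub>CC\<^esub> = 1"
  by (simp_all add: ring_of_type_algebra_def)

interpretation CC: cring CC
  by (rule cring_from_type_algebra)

lemma CC_minus [simp]: "\<ominus>\<^bsub>CC\<^esub> x = - x"
  using CC.minus_equality[of "- x" x] by simp

lemma CC_inv: "x \<noteq> 0 \<Longrightarrow> inv\<^bsub>CC\<^esub> x = inverse x"
  using CC.comm_inv_char[of x "inverse x"] by simp

lemma subfield_CC_iff:
  "subfield K CC \<longleftrightarrow> \<rat> \<subseteq> K \<and> (\<forall>x\<in>K. \<forall>y\<in>K. x + y \<in> K \<and> x * y \<in> K) \<and> (\<forall>x\<in>K. inverse x \<in> K)"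
proof
  assume K: "subfield K CC"
  have K': "subring K CC" using subfieldE(1)[OF K] .
  have c: "1 \<in> K" "0 \<in> K" "\<And>x. x \<in> K \<Longrightarrow> - x \<in> K" "\<And>x y. \<lbrakk>x \<in> K; y \<in> K\<rbrakk> \<Longrightarrow> x * y \<in> K"
    "\<And>x y. \<lbrakk>x \<in> K; y \<in> K\<rbrakk> \<Longrightarrow> x + y \<in> K"
    using subringE[OF K'] by simp_all
  have i: "inverse x \<in> K" if "x \<in> K" for x
  proof (cases "x = 0")
    case False
    thus ?thesis using CC.subfield_m_inv(1)[OF K, of x] that by (simp add: CC_inv)
  qed (use c in simp)
  have n: "of_nat k \<in> K" for k by (induction k) (auto intro: c)
  have z: "of_int k \<in> K" for k
    using n[of "nat k"] c(3)[OF n[of "nat (- k)"]] by (cases "k \<ge> 0") auto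
  have "\<rat> \<subseteq> K"
  proof
    fix x :: complex assume "x \<in> \<rat>"
    then obtain a b where "x = of_int a / of_int b" by (auto elim: Rats_cases')
    thus "x \<in> K" using c(4)[OF z i[OF z]] by (simp add: divide_inverse)
  qed
  thus "\<rat> \<subseteq> K \<and> (\<forall>x\<in>K. \<forall>y\<in>K. x + y \<in> K \<and> x * y \<in> K) \<and> (\<forall>x\<in>K. inverse x \<in> K)"
    using c(4,5) i by simp
next
  assume K: "\<rat> \<subseteq> K \<and> (\<forall>x\<in>K. \<forall>y\<in>K. x + y \<in> K \<and> x * y \<in> K) \<and> (\<forall>x\<in>K. inverse x \<in> K)"
  have m1: "-1 \<in> K" using K by (meson Rats_1 Rats_minus_iff subsetD)
  show "subfield K CC"
  proof (rule field.subfieldI'[OF field_from_type_algebra CC.subringI])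
    show "\<ominus>\<^bsub>CC\<^esub> h \<in> K" if "h \<in> K" for h
      using K m1 that by (metis CC_minus mult_minus1)
  qed (use K in \<open>auto simp: CC_inv\<close>)
qed

lemma subfield_Rats: "subfield \<rat> CC"
  unfolding subfield_CC_iff by auto

lemma Span_dimension_le:
  "\<exists>n\<le>length Us. CC.dimension n \<rat> (CC.Span \<rat> Us)"
proof (induction Us)
  case Nil
  thus ?case using CC.zero_dim[of "\<rat>"] by auto
next
  case (Cons u Us)
  then obtain n where n: "n \<le> length Us" "CC.dimension n \<rat> (CC.Span \<rat> Us)" by blast
  show ?case
  proof (cases "u \<in> CC.Span \<rat> Us")
    case True
    have "set Us \<subseteq> carrier CC" by simp
    note sub = CC.Span_is_subalgebra[OF subfield_Rats this]
    have "CC.Span \<rat> (u # Us) = CC.Span \<rat> Us"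
    proof
      show "CC.Span \<rat> (u # Us) \<subseteq> CC.Span \<rat> Us"
        by (rule CC.subalgebra_Span_incl[OF subfield_Rats sub])
           (use True CC.Span_base_incl[OF subfield_Rats, of Us] in auto)
      show "CC.Span \<rat> Us \<subseteq> CC.Span \<rat> (u # Us)"
        by (rule CC.subalgebra_Span_incl[OF subfield_Rats CC.Span_is_subalgebra[OF subfield_Rats]])
           (use CC.Span_base_incl[OF subfield_Rats, of "u # Us"] in auto)
    qed
    thus ?thesis using n by (metis le_SucI length_Cons)
  next
    case False
    hence "CC.dimension (Suc n) \<rat> (CC.Span \<rat> (u # Us))"
      using CC.Suc_dim[OF _ False n(2)] by simp
    thus ?thesis using n by (metis Suc_le_mono length_Cons)
  qed
qed

declare CC.Span.simps [simp del]

lemma combine_eq_sum: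
  "length Ks = length Us \<Longrightarrow> CC.combine Ks Us = (\<Sum>i<length Us. Ks ! i * Us ! i)"
proof (induction Ks Us rule: list_induct2)
  case (Cons k Ks u Us)
  thus ?case by (simp add: sum.lessThan_Suc_shift del: sum.lessThan_Suc)
qed simp

lemma rational_common_denominator:
  assumes "\<And>i. i \<in> S \<Longrightarrow> q i \<in> (\<rat> :: complex set)" "finite S"
  obtains d :: int and c :: "'a \<Rightarrow> int" where "d \<noteq> 0" "\<And>i. i \<in> S \<Longrightarrow> of_int d * q i = of_int (c i)"
proof -
  have "\<exists>(d::int) c. d \<noteq> 0 \<and> (\<forall>i\<in>S. of_int d * q i = of_int (c i :: int))"
    using assms(2,1)
  proof (induction S rule: finite_induct)
    case empty
    show ?case by (intro exI[of _ 1]) auto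
  next
    case (insert j S)
    then obtain d c where d: "d \<noteq> 0" "\<And>i. i \<in> S \<Longrightarrow> of_int d * q i = of_int (c i :: int)" by auto
    obtain a b where ab: "b \<noteq> 0" "q j = of_int a / of_int b"
      using insert.prems[of j] by (metis Rats_cases' insertI1 less_irrefl)
    have "of_int (d * b) * q i = of_int (if i = j then d * a else b * c i)" if "i \<in> insert j S" for i
      using that d(2)[of i] ab by (auto simp: mult_ac)
    moreover have "d * b \<noteq> 0" using d ab by simp
    ultimately show ?case by (intro exI[of _ "d * b"] exI[of _ "\<lambda>i. if i = j then d * a else b * c i"]) blast
  qed
  thus ?thesis using that by blast
qed

lemma rat_dim_le_Span:
  assumes "K \<subseteq> CC.Span \<rat> Us" "length Us \<le> n"
  shows "rat_dim_le K n"
  unfolding rat_dim_le_def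
proof (intro allI impI)
  fix x :: "nat \<Rightarrow> complex" assume x: "\<forall>i\<le>n. x i \<in> K"
  define Xs where "Xs = map x [0..<Suc n]"
  have l: "length Xs = Suc n" by (simp add: Xs_def)
  have sX: "set Xs \<subseteq> CC.Span \<rat> Us" using x assms(1) by (auto simp: Xs_def)
  obtain m where m: "m \<le> length Us" "CC.dimension m \<rat> (CC.Span \<rat> Us)" using Span_dimension_le by blast
  have "\<not> CC.independent \<rat> Xs"
    using CC.independent_length_le_dimension[OF subfield_Rats m(2) _ sX] l m assms(2) by auto
  then obtain Ks where Ks: "set Ks \<subseteq> \<rat>" "CC.combine Ks Xs = 0" "\<not> set (take (length Xs) Ks) \<subseteq> {0}"
    using CC.trivial_combine_imp_independent[OF subfield_Rats, of Xs] by auto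
  \<comment> \<open>\<open>combine\<close> silently truncates to the shorter list, so the
    coefficients are first normalised to the exact length \<open>n + 1\<close>.\<close>
  obtain Ks' where Ks': "set (take (length Xs) Ks) \<subseteq> set Ks'" "set Ks' \<subseteq> set (take (length Xs) Ks) \<union> {0}"
      "length Ks' = length Xs" "CC.combine Ks' Xs = 0"
    using CC.combine_normalize[of Ks Xs 0] Ks(2) by auto
  have r: "Ks' ! i \<in> \<rat>" if "i \<in> {..n}" for i
  proof -
    have "Ks' ! i \<in> set Ks'" using that Ks'(3) l by simp
    hence "Ks' ! i \<in> set Ks \<or> Ks' ! i = 0" using Ks'(2) in_set_takeD[of _ "length Xs" Ks] by auto
    thus ?thesis using Ks(1) by auto
  qed
  obtain j where j: "j \<le> n" "Ks' ! j \<noteq> 0"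
  proof -
    obtain k where "k \<in> set Ks'" "k \<noteq> 0" using Ks(3) Ks'(1) by blast
    then obtain j where "j < length Ks'" "Ks' ! j \<noteq> 0" by (auto simp: in_set_conv_nth)
    thus ?thesis using that[of j] Ks'(3) l by simp
  qed
  have "{..<length Xs} = {..n}" using l by auto
  hence s: "(\<Sum>i\<le>n. Ks' ! i * Xs ! i) = 0" using combine_eq_sum[OF Ks'(3)] Ks'(4) by simp
  obtain d :: int and c :: "nat \<Rightarrow> int" where d: "d \<noteq> 0" "\<And>i. i \<in> {..n} \<Longrightarrow> of_int d * Ks' ! i = of_int (c i)"
    using rational_common_denominator[of "{..n}" "(!) Ks'", OF r finite_atMost] by blast
  have "(\<Sum>i\<le>n. of_int (c i) * x i) = of_int d * (\<Sum>i\<le>n. Ks' ! i * Xs ! i)"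
    unfolding sum_distrib_left
    by (intro sum.cong refl) (simp add: Xs_def mult.assoc flip: d(2) del: upt_Suc)
  moreover have "c j \<noteq> 0" using d(1) d(2)[of j] j by auto
  ultimately show "\<exists>c::nat \<Rightarrow> int. (\<exists>i\<le>n. c i \<noteq> 0) \<and> (\<Sum>i\<le>n. of_int (c i) * x i) = 0"
    using j(1) s by auto
qed

lemma number_field_imp_numfield:
  assumes "number_field K"
  obtains n where "numfield K n"
proof -
  have K: "subfield K CC" "CC.finite_dimension \<rat> K" using assms by (auto simp: number_field_def)
  then obtain n where "CC.dimension n \<rat> K" by (auto simp: CC.finite_dimension_def)
  then obtain Us where "length Us = n" "CC.Span \<rat> Us = K"
    using CC.exists_base[OF subfield_Rats] by blast
  hence "rat_dim_le K n" using rat_dim_le_Span by (metis order_refl)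
  hence "numfield K n" using K(1) unfolding subfield_CC_iff by unfold_locales blast+
  thus ?thesis using that by blast
qed

text \<open>A finite-dimensional domain is a field: \<open>x\<close> satisfies a nonzero integer
  polynomial, and once vanishing constant terms are cancelled, the constant term divided by
  \<open>x\<close> is a polynomial in \<open>x\<close>. This supplies the inverses in
  \<open>number_fieldI\<close>.\<close>

lemma inverse_mem_if_rat_dim_le:
  assumes K: "\<rat> \<subseteq> K" "\<And>x y. \<lbrakk>x \<in> K; y \<in> K\<rbrakk> \<Longrightarrow> x + y \<in> K" "\<And>x y. \<lbrakk>x \<in> K; y \<in> K\<rbrakk> \<Longrightarrow> x * y \<in> K"
    and dim: "rat_dim_le K n" and x: "x \<in> K"
  shows "inverse x \<in> K"
proof (cases "x = 0")
  case True
  thus ?thesis using K(1) by auto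
next
  case False
  have pw: "x ^ k \<in> K" for k using K x by (induction k) auto
  have pK: "poly (map_poly of_int p) x \<in> K" for p :: "int poly"
  proof (induction p)
    case (pCons a p)
    have "of_int a \<in> K" using K(1) by auto
    thus ?case using pCons K x by (auto simp: of_int_hom.map_poly_pCons_hom)
  qed (use K in auto)
  have *: "\<exists>y\<in>K. x * y = 1" if "p \<noteq> 0" "poly (map_poly of_int p) x = 0" for p :: "int poly"
    using that
  proof (induction p)
    case (pCons a p)
    have e: "x * poly (map_poly of_int p) x = - of_int a"
      using pCons.prems(2) by (simp add: of_int_hom.map_poly_pCons_hom eq_neg_iff_add_eq_0 add.commute)
    show ?case
    proof (cases "a = 0")
      case True
      thus ?thesis using pCons e False by auto
    next
      case a: False
      have "(- 1 / of_int a :: complex) \<in> K" using K(1) by (meson Rats_1 Rats_divide Rats_minus_iff Rats_of_int subsetD)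
      hence "- 1 / of_int a * poly (map_poly of_int p) x \<in> K" using pK K(3) by blast
      moreover have "x * (- 1 / of_int a * poly (map_poly of_int p) x) = 1"
        using e a by (simp add: field_simps)
      ultimately show ?thesis by blast
    qed
  qed simp
  obtain c :: "nat \<Rightarrow> int" where c: "\<exists>i\<le>n. c i \<noteq> 0" "(\<Sum>i\<le>n. of_int (c i) * x ^ i) = 0"
    using dim pw unfolding rat_dim_le_def by blast
  define p where "p = (\<Sum>i\<le>n. monom (c i) i)"
  have cp: "coeff p i = c i" if "i \<le> n" for i
    using that by (simp add: p_def coeff_sum)
  have "p \<noteq> 0" using c(1) cp by auto
  moreover have "poly (map_poly of_int p) x = 0"
  proof -
    have "map_poly of_int p = (\<Sum>i\<le>n. monom (of_int (c i) :: complex) i)"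
      by (rule poly_eqI) (simp add: p_def coeff_map_poly coeff_sum)
    thus ?thesis using c(2) by (simp add: poly_sum poly_monom)
  qed
  ultimately obtain y where "y \<in> K" "x * y = 1" using * by blast
  thus ?thesis by (metis inverse_unique)
qed

lemma number_fieldI:
  assumes K: "\<rat> \<subseteq> K" "\<And>x y. \<lbrakk>x \<in> K; y \<in> K\<rbrakk> \<Longrightarrow> x + y \<in> K" "\<And>x y. \<lbrakk>x \<in> K; y \<in> K\<rbrakk> \<Longrightarrow> x * y \<in> K"
    and U: "K \<subseteq> CC.Span \<rat> Us" "length Us \<le> n"
  shows "number_field K" "numfield K n"
proof -
  have dim: "rat_dim_le K n" using rat_dim_le_Span[OF U] .
  note inv = inverse_mem_if_rat_dim_le[OF K dim]
  show "numfield K n" by unfold_locales (use K inv dim in blast)+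
  have sf: "subfield K CC" unfolding subfield_CC_iff using K inv by blast
  have "subgroup K (add_monoid CC)"
    using subring.axioms(1)[OF subfieldE(1)[OF sf]] .
  hence "subalgebra \<rat> K CC"
    using K by (auto simp: subalgebra_def subalgebra_axioms_def)
  hence "CC.finite_dimension \<rat> K"
    using CC.subalbegra_incl_imp_finite_dimension[OF subfield_Rats CC.Span_finite_dimension[OF subfield_Rats] _ U(1)] by simp
  thus "number_field K" using sf by (simp add: number_field_def)
qed

lemma (in numfield) ring_of_integers_eq: "ring_of_integers K = CC\<lparr>carrier := ints\<rparr>"
  by (simp add: ring_of_integers_def ints_def)

lemma (in numfield) ideal_iff_is_ideal: "ideal I (ring_of_integers K) \<longleftrightarrow> is_ideal I"
proof
  assume I: "ideal I (ring_of_integers K)"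
  interpret ideal I "ring_of_integers K" by fact
  show "is_ideal I"
  proof (rule is_idealI)
    show "I \<subseteq> ints" using a_subset by (simp add: ring_of_integers_eq)
    show "0 \<in> I" using additive_subgroup.zero_closed[OF ideal.axioms(1)[OF I]] by (simp add: ring_of_integers_eq)
    show "x + y \<in> I" if "x \<in> I" "y \<in> I" for x y
      using additive_subgroup.a_closed[OF ideal.axioms(1)[OF I] that] by (simp add: ring_of_integers_eq)
    show "r * x \<in> I" if "r \<in> ints" "x \<in> I" for r x
      using I_l_closed[OF that(2), of r] that(1) by (simp add: ring_of_integers_eq)
  qed
next
  assume I: "is_ideal I"
  have sr: "subring ints CC"
    by (rule CC.subringI) (auto intro: ints_closed)
  show "ideal I (ring_of_integers K)"
    unfolding ring_of_integers_eq
  proof (rule idealI[OF CC.subring_is_ring[OF sr]])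
    interpret R: ring "CC\<lparr>carrier := ints\<rparr>" by (rule CC.subring_is_ring[OF sr])
    show "subgroup I (add_monoid (CC\<lparr>carrier := ints\<rparr>))"
    proof (rule R.add.subgroupI)
      show "I \<subseteq> carrier (CC\<lparr>carrier := ints\<rparr>)" "I \<noteq> {}" using ideal_ints[OF I] ideal_0[OF I] by auto
      show "\<ominus>\<^bsub>CC\<lparr>carrier := ints\<rparr>\<^esub> a \<in> I" if a: "a \<in> I" for a
      proof -
        have "\<ominus>\<^bsub>CC\<lparr>carrier := ints\<rparr>\<^esub> a = - a"
          by (rule R.minus_equality) (use a ideal_ints[OF I] in \<open>auto intro: ints_closed\<close>)
        thus ?thesis using ideal_uminus[OF I a] by simp
      qed
      show "a \<oplus>\<^bsub>CC\<lparr>carrier := ints\<rparr>\<^esub> b \<in> I" if "a \<in> I" "b \<in> I" for a b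
        using ideal_add[OF I that] by simp
    qed
  qed (use ideal_mult[OF I] ideal_mult_right[OF I] in auto)
qed

lemma (in numfield) nonzero_ideals_eq: "nonzero_ideals K = nz_ideals"
  by (simp add: nonzero_ideals_def nz_ideals_def ideal_iff_is_ideal)

lemma (in numfield) ideal_norm_eq: "ideal_norm K I = index I"
proof -
  have "I +>\<^bsub>ring_of_integers K\<^esub> x = (+) x ` I" for x
    by (auto simp: a_r_coset_def' ring_of_integers_eq add.commute)
  hence "carrier (ring_of_integers K Quot I) = cosets I"
    by (auto simp: FactRing_def A_RCOSETS_def' cosets_def ring_of_integers_eq)
  thus ?thesis by (simp add: ideal_norm_def index_def)
qed

section \<open>The Dirichlet series\<close>

context numfield begin

definition zeta_real :: "real \<Rightarrow> real" where
  "zeta_real s = (\<Sum>\<^sub>\<infinity>I\<in>nz_ideals. real (index I) powr - s)"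

lemma zeta_summable:
  assumes s: "s > 1"
  shows "(\<lambda>I. real (index I) powr - s) summable_on nz_ideals"
proof (rule nonneg_bdd_above_summable_on)
  have sm: "summable (\<lambda>k. real k powr - s)" using s by (subst summable_real_powr_iff) simp
  have "(\<Sum>I\<in>F. real (index I) powr - s) \<le> exp (2 * real n * (\<Sum>k. real k powr - s))"
    if "finite F" "F \<subseteq> nz_ideals" for F
  proof (rule sum_index_le_exp[OF s that])
    show "real (index P) powr - s \<le> real p powr - s"
      if "is_maximal P" "prime p" "of_nat p \<in> P" for P p
      using prime_le_index[OF that] prime_gt_0_nat[OF that(2)] s by (intro powr_mono2') auto
    show "(\<Sum>p\<in>Q. real p powr - s) \<le> (\<Sum>k. real k powr - s)" if "finite Q" for Q
      using that by (intro sum_le_suminf sm) auto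
  qed
  thus "bdd_above (sum (\<lambda>I. real (index I) powr - s) ` {F. F \<subseteq> nz_ideals \<and> finite F})"
    by (intro bdd_aboveI) auto
qed simp

lemma zeta_ge:
  assumes "s > 1" "finite F" "F \<subseteq> nz_ideals"
  shows "(\<Sum>I\<in>F. real (index I) powr - s) \<le> zeta_real s"
  unfolding zeta_real_def by (rule finite_sum_le_infsum[OF zeta_summable[OF assms(1)] assms(2,3)]) simp

lemma zeta_le:
  assumes "s > 1" "\<And>F. \<lbrakk>finite F; F \<subseteq> nz_ideals\<rbrakk> \<Longrightarrow> (\<Sum>I\<in>F. real (index I) powr - s) \<le> b"
  shows "zeta_real s \<le> b"
  unfolding zeta_real_def by (rule infsum_le_finite_sums[OF zeta_summable[OF assms(1)] assms(2)])

text \<open>Proper because \<open>1 / m\<close> is rational but not an integer, hence not an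
  algebraic integer. These ideals give maximal ideals containing a prescribed
  \<open>m\<close>.\<close>

lemma multiples_ideal:
  assumes m: "m \<ge> 2"
  defines "J \<equiv> (\<lambda>x. of_nat m * x) ` ints"
  shows "is_ideal J" "J \<noteq> {0}" "1 \<notin> J" "of_nat m \<in> J"
proof -
  show "is_ideal J"
  proof (rule is_idealI)
    show "J \<subseteq> ints" by (auto simp: J_def intro: ints_closed)
    show "0 \<in> J" using ints_0 by (auto simp: J_def)
    fix x y assume "x \<in> J" "y \<in> J"
    then obtain a b where "a \<in> ints" "b \<in> ints" "x = of_nat m * a" "y = of_nat m * b" by (auto simp: J_def)
    hence "x + y = of_nat m * (a + b)" "a + b \<in> ints" by (auto simp: distrib_left intro: ints_closed)
    thus "x + y \<in> J" unfolding J_def by (metis image_eqI)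
  next
    fix r x assume "r \<in> ints" "x \<in> J"
    then obtain a where "a \<in> ints" "x = of_nat m * a" by (auto simp: J_def)
    hence "r * x = of_nat m * (r * a)" "r * a \<in> ints" using \<open>r \<in> ints\<close> by (auto intro: ints_closed)
    thus "r * x \<in> J" unfolding J_def by (metis image_eqI)
  qed
  show mJ: "of_nat m \<in> J" using ints_1 by (force simp: J_def)
  show "J \<noteq> {0}" using m mJ by auto
  show "1 \<notin> J"
  proof
    assume "1 \<in> J"
    then obtain a where a: "a \<in> ints" "1 = of_nat m * a" by (auto simp: J_def)
    hence "a = 1 / of_nat m" using m by (simp add: field_simps)
    hence "a \<in> \<rat>" by simp
    moreover have "algebraic_int a" using a(1) by (simp add: ints_def)
    ultimately have "a \<in> \<int>" using rational_algebraic_int_is_int by blast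
    then obtain k where "a = of_int k" by (elim Ints_cases)
    hence "of_int (int m * k) = (of_int 1 :: complex)" using a(2) by simp
    hence "int m * k = 1" by (simp only: of_int_eq_iff)
    thus False using m by (simp add: zmult_eq_1_iff)
  qed
qed

text \<open>\<open>ints\<close> contributes exactly 1 and a second ideal something positive.
  Strictness later keeps the infimum 1 from being attained.\<close>

lemma zeta_gt_1:
  assumes s: "s > 1"
  shows "zeta_real s > 1"
proof -
  define J where "J = (\<lambda>x. of_nat 2 * x) ` ints"
  have J: "is_ideal J" "J \<noteq> {0}" "1 \<notin> J" using multiples_ideal[of 2] by (auto simp: J_def)
  hence ne: "ints \<noteq> J" using ints_1 by auto
  have "real (index J) powr - s > 0" using index_pos[OF J(1,2)] by simp
  moreover have "ints \<noteq> {0}" using ints_1 by force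
  hence "{ints, J} \<subseteq> nz_ideals" using J(1,2) ints_ideal by (simp add: nz_ideals_def)
  hence "(\<Sum>I\<in>{ints, J}. real (index I) powr - s) \<le> zeta_real s"
    using zeta_ge[OF s, of "{ints, J}"] by simp
  hence "1 + real (index J) powr - s \<le> zeta_real s" using ne by (simp add: index_ints)
  ultimately show ?thesis by linarith
qed

lemma dedekind_zeta_of_real:
  assumes "s > 1"
  shows "dedekind_zeta K (of_real s) = of_real (zeta_real s)"
proof -
  have "dedekind_zeta K (of_real s) = (\<Sum>\<^sub>\<infinity>I\<in>nz_ideals. of_real (real (index I) powr - s))"
    unfolding dedekind_zeta_def nonzero_ideals_eq ideal_norm_eq
  proof (rule infsum_cong)
    fix I assume "I \<in> nz_ideals"
    have "(of_nat (index I) :: complex) powr - of_real s = of_real (real (index I)) powr of_real (- s)" by simp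
    also have "\<dots> = of_real (real (index I) powr - s)" by (rule powr_of_real) simp
    finally show "of_nat (index I) powr - complex_of_real s = of_real (real (index I) powr - s)" .
  qed
  also have "\<dots> = of_real (zeta_real s)"
    unfolding zeta_real_def
    by (rule infsumI) (rule has_sum_of_real[OF has_sum_infsum[OF zeta_summable[OF assms]]])
  finally show ?thesis .
qed

text \<open>Heights are defined through a Laurent expansion, so the behaviour near \<open>s\<close>
  matters and not only the value there. The series at \<open>s - r\<close> dominates on the closed
  disc of radius \<open>r\<close>.\<close>

lemma dedekind_zeta_analytic:
  assumes "s > 1"
  shows "dedekind_zeta K analytic_on {of_real s}"
proof -
  define r where "r = (s - 1) / 2"
  have r: "r > 0" "s - r > 1" using assms by (auto simp: r_def field_simps)
  define z where "z = complex_of_real s"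
  define f where "f = (\<lambda>F y. \<Sum>I\<in>F. (of_nat (index I) :: complex) powr (- y))"
  have eq: "dedekind_zeta K = (\<lambda>y. \<Sum>\<^sub>\<infinity>I\<in>nz_ideals. of_nat (index I) powr (- y))"
    by (simp add: dedekind_zeta_def nonzero_ideals_eq ideal_norm_eq fun_eq_iff)
  have ulim: "uniform_limit (cball z r) f (dedekind_zeta K) (finite_subsets_at_top nz_ideals)"
    unfolding f_def eq
  proof (rule Weierstrass_m_test_general[OF _ zeta_summable[OF r(2)]])
    fix I y assume I: "I \<in> nz_ideals" and y: "y \<in> cball z r"
    have ip: "index I > 0" using I index_pos by (auto simp: nz_ideals_def)
    have "\<bar>Re (z - y)\<bar> \<le> r" using y abs_Re_le_cmod[of "z - y"] by (simp add: dist_norm)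
    hence "Re y \<ge> s - r" by (simp add: z_def)
    moreover have "norm (of_nat (index I) powr (- y) :: complex) = real (index I) powr - Re y"
      using ip by (simp add: norm_powr_real_powr)
    moreover have "real (index I) \<ge> 1" using ip by simp
    ultimately show "norm (of_nat (index I) powr (- y) :: complex) \<le> real (index I) powr - (s - r)"
      by (simp add: powr_mono)
  qed
  have hol: "f F holomorphic_on A" for F A
    unfolding f_def
    by (intro holomorphic_intros)
  have ev: "\<forall>\<^sub>F F in finite_subsets_at_top nz_ideals. continuous_on (cball z r) (f F) \<and> f F holomorphic_on ball z r"
    using hol holomorphic_on_imp_continuous_on
    by (intro eventually_finite_subsets_at_top_weakI) blast
  have "dedekind_zeta K holomorphic_on ball z r"
    by (rule holomorphic_uniform_limit[OF ev ulim finite_subsets_at_top_neq_bot])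
  thus ?thesis using r(1) by (intro holomorphic_on_imp_analytic_at[of _ "ball z r"]) (auto simp: z_def)
qed

end

lemma leading_laurent_coeff_analytic:
  assumes "f analytic_on {z}" "f z \<noteq> 0"
  shows "leading_laurent_coeff f z = f z"
proof -
  define F where "F = fps_expansion f z"
  have F: "(\<lambda>x. f (z + x)) has_fps_expansion F"
    using analytic_at_imp_has_fps_expansion[OF assms(1)] by (simp add: F_def)
  have L: "laurent_expansion f z = fps_to_fls F"
    by (rule laurent_expansion_eqI[OF has_laurent_expansion_fps[OF F]])
  have F0: "fps_nth F 0 = f z"
    using has_fps_expansion_imp_0_eq_fps_nth_0[OF F] by simp
  hence "subdegree F = 0" using assms(2) by simp
  thus ?thesis using F0 by (simp add: leading_laurent_coeff_def L fls_subdegree_fls_to_fps)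
qed

section \<open>Fields with many ideals of norm two\<close>

text \<open>The residues are represented by 0 and 1, so the quotient is the field with two elements.
  In this form the property passes to an extension without counting cosets.\<close>

definition ideals_of_norm_two :: "complex set \<Rightarrow> complex set set" where
  "ideals_of_norm_two K = {P. numfield.is_ideal K P \<and> 1 \<notin> P \<and> (\<forall>x\<in>numfield.ints K. x \<in> P \<or> x - 1 \<in> P)}"

context numfield begin

lemma norm_two_props:
  assumes "P \<in> ideals_of_norm_two K"
  shows "is_ideal P" "1 \<notin> P" "2 \<in> P" "P \<noteq> {0}" "index P = 2"
proof -
  show P: "is_ideal P" "1 \<notin> P" using assms by (auto simp: ideals_of_norm_two_def)
  have alt: "x \<in> P \<or> x - 1 \<in> P" if "x \<in> ints" for x using assms that by (auto simp: ideals_of_norm_two_def)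
  show t: "2 \<in> P" using alt[OF ints_numeral[of "num.Bit0 num.One"]] P(2) by auto
  thus nz: "P \<noteq> {0}" by auto
  have "cosets P \<subseteq> {(+) 0 ` P, (+) 1 ` P}"
  proof
    fix C assume "C \<in> cosets P"
    then obtain x where x: "x \<in> ints" "C = (+) x ` P" by (auto simp: cosets_def)
    thus "C \<in> {(+) 0 ` P, (+) 1 ` P}" using alt[OF x(1)] coset_eq_iff[OF P(1), of x 0] coset_eq_iff[OF P(1), of x 1] by auto
  qed
  hence "card (cosets P) \<le> card {(+) 0 ` P, (+) 1 ` P}" by (intro card_mono) auto
  also have "\<dots> \<le> 2" by (simp add: card_insert_if)
  finally have "index P \<le> 2" by (simp add: index_def)
  thus "index P = 2" using index_proper[OF P(1) nz P(2)] by simp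
qed

lemma zeta_ge_norm_two:
  assumes s: "s > 1" and S: "finite S" "S \<subseteq> ideals_of_norm_two K"
  shows "real (card S) * 2 powr - s \<le> zeta_real s"
proof -
  have "real (card S) * 2 powr - s = (\<Sum>P\<in>S. real (index P) powr - s)"
    using norm_two_props(5) S(2) by (simp add: subset_iff)
  also have "\<dots> \<le> zeta_real s"
    by (rule zeta_ge[OF s S(1)]) (use norm_two_props(1,4) S(2) in \<open>unfold nz_ideals_def, blast\<close>)
  finally show ?thesis .
qed

text \<open>For a prime \<open>P\<close> above 3 with \<open>a + q * b = 1\<close> as in \<open>maximal_inverse\<close>, the element \<open>b\<close> lies in
  \<open>P\<close> but not in the square of \<open>P\<close>, and so does \<open>9 - 8 * b\<close>, which is therefore not a square.\<close>

lemma exists_nonsquare_cong_1_mod_8: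
  obtains b where "b \<in> ints" "\<And>w. w \<in> K \<Longrightarrow> w\<^sup>2 \<noteq> 9 - 8 * b"
proof -
  note J = multiples_ideal[of 3]
  obtain P where P: "is_maximal P" "(\<lambda>x. of_nat 3 * x) ` ints \<subseteq> P"
    using exists_maximal[of "(\<lambda>x. of_nat 3 * x) ` ints"] J by auto
  have P3: "3 \<in> P" using P(2) J(4) by auto
  have Pi: "is_ideal P" using maximal_ideal[OF P(1)] .
  obtain q a b where q: "q \<in> K" "q \<notin> ints" "\<And>x. x \<in> P \<Longrightarrow> q * x \<in> ints" and ab: "a \<in> P" "b \<in> P" "a + q * b = 1"
    using maximal_inverse[OF P(1)] by blast
  have bi: "b \<in> ints" using ideal_ints[OF Pi ab(2)] .
  have "w\<^sup>2 \<noteq> 9 - 8 * b" if w: "w \<in> K" for w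
  proof
    assume e: "w\<^sup>2 = 9 - 8 * b"
    have "algebraic_int (9 - 8 * b)" using bi by (intro algebraic_int_diff algebraic_int_add_mult) (auto simp: ints_def)
    hence "algebraic_int w"
      by (rule algebraic_int_root[of _ "monom 1 2"]) (auto simp: poly_monom e degree_monom_eq)
    hence wi: "w \<in> ints" using w by (simp add: ints_def)
    have "3 * 3 - 8 * b \<in> P" using P3 ab Pi by (intro ideal_diff[OF Pi] ideal_mult[OF Pi] ints_numeral)
    hence "w\<^sup>2 \<in> P" using e by simp
    hence "w \<in> P" using maximal_power[OF P(1) wi] by blast
    \<comment> \<open>Both terms are integral since \<open>w\<close> and 3 lie in \<open>P\<close>.
      As \<open>-8 * b + 9 * b = b\<close>, their difference is \<open>q^2 * b\<close>, and adding
      \<open>q * a\<close> leaves \<open>q * (a + q * b) = q\<close>, which is not integral.\<close>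
    hence "(q * w)\<^sup>2 - (q * 3)\<^sup>2 * (1 - b) \<in> ints"
      using ints_diff[OF ints_power[OF q(3)] ints_mult[OF ints_power[OF q(3)[OF P3]] ints_diff[OF ints_1 bi]]]
      by blast
    moreover have "(q * w)\<^sup>2 - (q * 3)\<^sup>2 * (1 - b) = q * (q * b)"
    proof -
      have "(q * w)\<^sup>2 = q\<^sup>2 * (9 - 8 * b)" by (simp add: power_mult_distrib e)
      thus ?thesis by (simp add: power2_eq_square algebra_simps)
    qed
    ultimately have "q * a + q * (q * b) \<in> ints" using q(3)[OF ab(1)] by (intro ints_add) auto
    also have "q * a + q * (q * b) = q * (a + q * b)" by (simp add: algebra_simps)
    finally show False using ab(3) q(2) by simp
  qed
  thus ?thesis using that bi by blast
qed

end

section \<open>Conjugation and splitting in quadratic extensions\<close>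

text \<open>An integer polynomial takes conjugate values \<open>s + t * w\<close> and
  \<open>s - t * w\<close> at the two points. If the first is 0 then \<open>t = 0\<close>, since
  \<open>w\<close> is not in \<open>K\<close>, and the second is 0 as well.\<close>

lemma algebraic_int_conjugate:
  assumes K: "numfield K n" and w: "w \<notin> K" "w\<^sup>2 = d" "d \<in> K"
    and uv: "u \<in> K" "v \<in> K" and alg: "algebraic_int (u + v * w)"
  shows "algebraic_int (u - v * w)"
proof -
  interpret numfield K n by fact
  obtain p :: "int poly" where p: "poly (map_poly of_int p) (u + v * w) = 0" "lead_coeff p = 1"
    using alg by (auto simp: algebraic_int_altdef_ipoly)
  have "\<exists>s\<in>K. \<exists>t\<in>K. poly (map_poly of_int p) (u + v * w) = s + t * w \<and>
      poly (map_poly of_int p) (u - v * w) = s - t * w" for p :: "int poly"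
  proof (induction p)
    case 0
    show ?case using zero_mem by (intro bexI[of _ 0]) auto
  next
    case (pCons a p)
    then obtain s t where st: "s \<in> K" "t \<in> K" "poly (map_poly of_int p) (u + v * w) = s + t * w"
      "poly (map_poly of_int p) (u - v * w) = s - t * w" by blast
    show ?case
    proof (intro bexI conjI)
      show "poly (map_poly of_int (pCons a p)) (u + v * w) = (of_int a + u * s + v * t * d) + (u * t + v * s) * w"
        by (simp add: of_int_hom.map_poly_pCons_hom st(3) algebra_simps power2_eq_square flip: w(2))
      show "poly (map_poly of_int (pCons a p)) (u - v * w) = (of_int a + u * s + v * t * d) - (u * t + v * s) * w"
        by (simp add: of_int_hom.map_poly_pCons_hom st(4) algebra_simps power2_eq_square flip: w(2))
    qed (use st uv w in \<open>auto intro!: add_mem mult_mem int_mem\<close>)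
  qed
  then obtain s t where st: "s \<in> K" "t \<in> K" "poly (map_poly of_int p) (u + v * w) = s + t * w"
      "poly (map_poly of_int p) (u - v * w) = s - t * w" by blast
  have "t = 0"
  proof (rule ccontr)
    assume t: "t \<noteq> 0"
    hence "w = - s / t" using p(1) st(3) by (simp add: field_simps eq_neg_iff_add_eq_0)
    thus False using w(1) st divide_mem uminus_mem by blast
  qed
  hence "poly (map_poly of_int p) (u - v * w) = 0" using st p(1) by simp
  thus ?thesis using p(2) unfolding algebraic_int_altdef_ipoly by blast
qed

lemma combine_map_mult: "CC.combine Ks (map ((*) w) Us) = w * CC.combine Ks Us"
proof (induction Ks arbitrary: Us)
  case (Cons k Ks)
  thus ?case by (cases Us) (auto simp: algebra_simps)
qed simp

lemma quadratic_extension_number_field: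
  assumes K: "number_field K" and w: "w\<^sup>2 \<in> K"
  shows "number_field {u + v * w | u v. u \<in> K \<and> v \<in> K}"
proof -
  obtain n where n: "numfield K n" using number_field_imp_numfield[OF K] .
  interpret numfield K n by fact
  obtain m where "CC.dimension m \<rat> K" using K by (auto simp: number_field_def CC.finite_dimension_def)
  then obtain Us where Us: "CC.Span \<rat> Us = K" using CC.exists_base[OF subfield_Rats] by blast
  define Vs where "Vs = Us @ map ((*) w) Us"
  have sub: "subalgebra \<rat> (CC.Span \<rat> Vs) CC" using CC.Span_is_subalgebra[OF subfield_Rats] by simp
  have base: "set Vs \<subseteq> CC.Span \<rat> Vs" using CC.Span_base_incl[OF subfield_Rats, of Vs] by simp
  have "set Us \<subseteq> CC.Span \<rat> Vs" "set (map ((*) w) Us) \<subseteq> CC.Span \<rat> Vs"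
    using base unfolding Vs_def set_append by blast+
  hence U: "CC.Span \<rat> Us \<subseteq> CC.Span \<rat> Vs" "CC.Span \<rat> (map ((*) w) Us) \<subseteq> CC.Span \<rat> Vs"
    using CC.subalgebra_Span_incl[OF subfield_Rats sub] by blast+
  have wU: "v * w \<in> CC.Span \<rat> Vs" if v: "v \<in> K" for v
  proof -
    obtain Ks where "set Ks \<subseteq> \<rat>" "v = CC.combine Ks Us"
      using v Us CC.Span_eq_combine_set[OF subfield_Rats, of Us] by auto
    hence "v * w \<in> CC.Span \<rat> (map ((*) w) Us)"
      using CC.Span_eq_combine_set[OF subfield_Rats, of "map ((*) w) Us"] combine_map_mult[of Ks w Us]
      by (auto simp: mult.commute)
    thus ?thesis using U by blast
  qed
  let ?L = "{u + v * w | u v. u \<in> K \<and> v \<in> K}"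
  show ?thesis
  proof (rule number_fieldI(1))
    show "\<rat> \<subseteq> ?L"
    proof
      fix x :: complex assume "x \<in> \<rat>"
      hence "x \<in> K" "x = x + 0 * w" using rat_mem by auto
      thus "x \<in> ?L" using zero_mem by blast
    qed
    show "?L \<subseteq> CC.Span \<rat> Vs"
      using wU U Us CC.Span_subgroup_props(3)[OF subfield_Rats, of Vs] by auto
    show "x + y \<in> ?L" if xy: "x \<in> ?L" "y \<in> ?L" for x y
    proof -
      obtain u v u' v' where *: "x = u + v * w" "y = u' + v' * w" "u \<in> K" "v \<in> K" "u' \<in> K" "v' \<in> K"
        using xy by blast
      hence "x + y = (u + u') + (v + v') * w" by (simp add: algebra_simps)
      thus ?thesis using * add_mem by blast
    qed
    show "x * y \<in> ?L" if xy: "x \<in> ?L" "y \<in> ?L" for x y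
    proof -
      obtain u v u' v' where *: "x = u + v * w" "y = u' + v' * w" "u \<in> K" "v \<in> K" "u' \<in> K" "v' \<in> K"
        using xy by blast
      hence "x * y = (u * u' + v * v' * w\<^sup>2) + (u * v' + v * u') * w" by (simp add: algebra_simps power2_eq_square)
      moreover have "u * u' + v * v' * w\<^sup>2 \<in> K" "u * v' + v * u' \<in> K"
        using * w by (auto intro!: add_mem mult_mem)
      ultimately show ?thesis by blast
    qed
  qed (rule order_refl)
qed

text \<open>Adjoin a square root \<open>w\<close> of \<open>d = 9 - 8 * b\<close>. As
  \<open>d\<close> is 1 modulo each \<open>P\<close> of norm 2, sending \<open>w\<close> to
  \<open>e = 1\<close> or to \<open>e = -1\<close> gives residue maps to the field with two
  elements. The signs agree modulo 2, but the maps differ on the integer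
  \<open>(1 + w) / 2\<close>.\<close>

lemma double_ideals_of_norm_two:
  assumes K: "number_field K" and S: "finite S" "S \<subseteq> ideals_of_norm_two K"
  obtains L S' where "number_field L" "finite S'" "S' \<subseteq> ideals_of_norm_two L" "card S' = 2 * card S"
proof -
  obtain n where n: "numfield K n" using number_field_imp_numfield[OF K] .
  interpret K: numfield K n by fact
  obtain b where b: "b \<in> K.ints" and nsq: "\<And>w. w \<in> K \<Longrightarrow> w\<^sup>2 \<noteq> 9 - 8 * b"
    using K.exists_nonsquare_cong_1_mod_8 by blast
  define d where "d = 9 - 8 * b"
  define w where "w = csqrt d"
  have w2: "w\<^sup>2 = d" by (simp add: w_def)
  have wK: "w \<notin> K" using nsq w2 d_def by blast
  have dO: "d \<in> K.ints" unfolding d_def using b by (intro K.ints_closed)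
  have dK: "d \<in> K" using dO K.ints_mem by blast
  define L where "L = {u + v * w | u v. u \<in> K \<and> v \<in> K}"
  have nL: "number_field L" unfolding L_def by (rule quadratic_extension_number_field[OF K]) (simp add: w2 dK)
  obtain m where m: "numfield L m" using number_field_imp_numfield[OF nL] .
  interpret L: numfield L m by fact
  have uniq: "u = u' \<and> v = v'" if "u + v * w = u' + v' * w" "u \<in> K" "v \<in> K" "u' \<in> K" "v' \<in> K" for u v u' v'
  proof -
    have "v = v'"
    proof (rule ccontr)
      assume ne: "v \<noteq> v'"
      hence "w = (u' - u) / (v - v')" using that(1) by (simp add: field_simps)
      thus False using wK that K.divide_mem K.diff_mem by blast
    qed
    thus ?thesis using that(1) by simp
  qed
  have wa: "algebraic_int w" unfolding w_def using dO by (auto simp: K.ints_def)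
  \<comment> \<open>Root of \<open>y^2 - y - 2 * (1 - b)\<close>, because
    \<open>(d - 1) / 4 = 2 * (1 - b)\<close>. Modulo \<open>P\<close> this polynomial is
    \<open>y * (y - 1)\<close>, the source of the two ideals.\<close>
  define \<beta> where "\<beta> = (1 + w) / 2"
  have \<beta>a: "algebraic_int \<beta>"
  proof (rule algebraic_int_root[of "2 * (1 - b)" "[:0, -1, 1:]"])
    show "algebraic_int (2 * (1 - b))" using b by (intro algebraic_int_add_mult algebraic_int_diff) (auto simp: K.ints_def)
    have "poly [:0, -1, 1:] \<beta> = (w\<^sup>2 - 1) / 4" by (simp add: \<beta>_def field_simps power2_eq_square)
    also have "\<dots> = 2 * (1 - b)" by (simp add: w2 d_def)
    finally show "poly [:0, -1, 1:] \<beta> = 2 * (1 - b)" .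
    show "\<forall>i. coeff [:0, -1, 1:: complex:] i \<in> \<int>" by (auto simp: coeff_pCons split: nat.splits)
  qed auto
  have \<beta>eq: "\<beta> = 1/2 + 1/2 * w" by (simp add: \<beta>_def field_simps)
  have half: "1/2 \<in> K" using K.rat_mem[of "1/2"] by (simp add: Rats_divide)
  have "\<beta> \<in> L" unfolding L_def \<beta>eq using half by blast
  hence \<beta>L: "\<beta> \<in> L.ints" using \<beta>a by (simp add: L.ints_def)
  \<comment> \<open>The factor \<open>d\<close> clears enough denominators and is harmless, being 1
    modulo \<open>P\<close>. The first claim comes from multiplying the difference of
    \<open>u + v * w\<close> and its conjugate by \<open>w\<close>, the others from subtracting a
    multiple of \<open>\<beta>\<close>.\<close>
  have coord: "2 * d * v \<in> K.ints" "d * (u + v) \<in> K.ints" "d * (u - v) \<in> K.ints"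
    if uv: "u \<in> K" "v \<in> K" "u + v * w \<in> L.ints" for u v
  proof -
    have a: "algebraic_int (u + v * w)" using uv by (simp add: L.ints_def)
    have c: "algebraic_int (u - v * w)" by (rule algebraic_int_conjugate[OF n wK w2 dK uv(1,2) a])
    have "algebraic_int (((u + v * w) - (u - v * w)) * w)"
      by (rule algebraic_int_add_mult(2)[OF algebraic_int_diff[OF a c] wa])
    also have "((u + v * w) - (u - v * w)) * w = 2 * d * v" by (simp add: algebra_simps power2_eq_square flip: w2)
    finally have a1: "algebraic_int (2 * d * v)" .
    have k1: "2 * d * v \<in> K" using uv dK K.ints_mem[OF K.ints_numeral] by (intro K.mult_mem)
    show i1: "2 * d * v \<in> K.ints" using a1 k1 by (simp add: K.ints_def)
    have "algebraic_int (d * (u + v * w) - 2 * d * v * \<beta>)"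
      using algebraic_int_diff[OF algebraic_int_add_mult(2)[OF _ a] algebraic_int_add_mult(2)[OF a1 \<beta>a]] dO
      by (auto simp: K.ints_def)
    also have "d * (u + v * w) - 2 * d * v * \<beta> = d * (u - v)" by (simp add: \<beta>_def field_simps)
    finally have "algebraic_int (d * (u - v))" .
    thus i2: "d * (u - v) \<in> K.ints" using uv dK by (simp add: K.ints_def K.mult_mem K.diff_mem)
    have "d * (u - v) + 2 * d * v \<in> K.ints" using i1 i2 by (intro K.ints_add)
    thus "d * (u + v) \<in> K.ints" by (simp add: algebra_simps)
  qed
  have coord': "d * (u + e * v) \<in> K.ints" if "u \<in> K" "v \<in> K" "u + v * w \<in> L.ints" "e \<in> {1, -1}" for u v e
    using coord[OF that(1-3)] that(4) by auto
  \<comment> \<open>Kernel of the residue map sending \<open>u + v * w\<close> to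
    \<open>u + e * v\<close> modulo \<open>P\<close>, with \<open>d\<close> inserted to make the
    value integral.\<close>
  define Q where "Q = (\<lambda>e P. {x \<in> L.ints. \<exists>u\<in>K. \<exists>v\<in>K. x = u + v * w \<and> d * (u + e * v) \<in> P})"
  have Qmem: "u + v * w \<in> Q e P \<longleftrightarrow> d * (u + e * v) \<in> P" if "u \<in> K" "v \<in> K" "u + v * w \<in> L.ints" for u v e P
  proof
    assume "u + v * w \<in> Q e P"
    then obtain u' v' where "u' \<in> K" "v' \<in> K" "u + v * w = u' + v' * w" "d * (u' + e * v') \<in> P"
      by (auto simp: Q_def)
    thus "d * (u + e * v) \<in> P" using uniq[of u v u' v'] that by auto
  qed (use that in \<open>auto simp: Q_def\<close>)
  have Lrep: "\<exists>u\<in>K. \<exists>v\<in>K. x = u + v * w" if "x \<in> L.ints" for x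
    using L.ints_mem[OF that] by (auto simp: L_def)
  have P_facts: "K.is_ideal P" "1 \<notin> P" "2 \<in> P" "\<And>x. x \<in> K.ints \<Longrightarrow> x \<in> P \<or> x - 1 \<in> P"
      "\<And>x. x \<in> K.ints \<Longrightarrow> d * x \<in> P \<longleftrightarrow> x \<in> P" "d - 1 \<in> P" if P: "P \<in> ideals_of_norm_two K" for P
  proof -
    show Pi: "K.is_ideal P" and P1: "1 \<notin> P" and P2: "2 \<in> P" using K.norm_two_props[OF P] by auto
    show "\<And>x. x \<in> K.ints \<Longrightarrow> x \<in> P \<or> x - 1 \<in> P" using P by (auto simp: ideals_of_norm_two_def)
    have "(4 * (1 - b)) * 2 \<in> P" using b P2 by (intro K.ideal_mult[OF Pi] K.ints_closed)
    thus d1: "d - 1 \<in> P" by (simp add: d_def algebra_simps)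
    fix x assume x: "x \<in> K.ints"
    have dx: "(d - 1) * x \<in> P" by (rule K.ideal_mult_right[OF Pi x d1])
    show "d * x \<in> P \<longleftrightarrow> x \<in> P"
      using K.ideal_add[OF Pi dx, of x] K.ideal_diff[OF Pi _ dx, of "d * x"] by (auto simp: algebra_simps)
  qed
  have Q2: "Q e P \<in> ideals_of_norm_two L" if P: "P \<in> ideals_of_norm_two K" and e: "e \<in> {1, -1}" for e P
  proof -
    note Pf = P_facts[OF P]
    have ee: "e * e = 1" using e by auto
    have "L.is_ideal (Q e P)"
    proof (rule L.is_idealI)
      show "Q e P \<subseteq> L.ints" by (auto simp: Q_def)
      show "0 \<in> Q e P"
        using Qmem[of 0 0 e P] K.zero_mem L.ints_0 K.ideal_0[OF Pf(1)] by simp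
    next
      fix x y assume xy: "x \<in> Q e P" "y \<in> Q e P"
      obtain u v where uv: "u \<in> K" "v \<in> K" "x = u + v * w" "d * (u + e * v) \<in> P" "x \<in> L.ints" using xy(1) by (auto simp: Q_def)
      obtain u' v' where uv': "u' \<in> K" "v' \<in> K" "y = u' + v' * w" "d * (u' + e * v') \<in> P" "y \<in> L.ints" using xy(2) by (auto simp: Q_def)
      have s: "x + y = (u + u') + (v + v') * w" using uv uv' by (simp add: algebra_simps)
      have "d * (u + e * v) + d * (u' + e * v') \<in> P" using uv uv' by (intro K.ideal_add[OF Pf(1)])
      hence "d * ((u + u') + e * (v + v')) \<in> P" by (simp add: algebra_simps)
      moreover have "(u + u') + (v + v') * w \<in> L.ints" using L.ints_add[OF uv(5) uv'(5)] unfolding s .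
      ultimately show "x + y \<in> Q e P"
        unfolding s using Qmem[OF K.add_mem[OF uv(1) uv'(1)] K.add_mem[OF uv(2) uv'(2)]] by blast
    next
      fix x y assume xy: "x \<in> L.ints" "y \<in> Q e P"
      obtain u v where uv: "u \<in> K" "v \<in> K" "x = u + v * w" using Lrep[OF xy(1)] by blast
      obtain u' v' where uv': "u' \<in> K" "v' \<in> K" "y = u' + v' * w" "d * (u' + e * v') \<in> P" "y \<in> L.ints" using xy(2) by (auto simp: Q_def)
      define U where "U = u * u' + v * v' * d"
      define V where "V = u * v' + v * u'"
      have UV: "U \<in> K" "V \<in> K" using uv uv' dK by (auto simp: U_def V_def intro!: K.add_mem K.mult_mem)
      have s: "x * y = U + V * w" using uv uv' by (simp add: U_def V_def algebra_simps power2_eq_square flip: w2)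
      have sO: "U + V * w \<in> L.ints" using L.ints_mult[OF xy(1) uv'(5)] s by simp
      \<comment> \<open>The map is multiplicative up to \<open>(d - 1) * v * v'\<close>, where
        \<open>d - 1 = 8 * (1 - b)\<close>. Two of the factors 2 make \<open>2 * d * v\<close> and
        \<open>2 * d * v'\<close> integral; the third puts the term into \<open>P\<close>.\<close>
      have "d * (u + e * v) * (d * (u' + e * v')) + (2 * d * v) * (2 * d * v') * (1 - b) * 2 \<in> P"
      proof (rule K.ideal_add[OF Pf(1)])
        have "d * (u + e * v) \<in> K.ints" using coord' uv xy(1) e by blast
        thus "d * (u + e * v) * (d * (u' + e * v')) \<in> P" using uv'(4) by (rule K.ideal_mult[OF Pf(1)])
        have "2 * d * v \<in> K.ints" "2 * d * v' \<in> K.ints" using coord(1) uv uv' xy(1) by blast+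
        hence "(2 * d * v) * (2 * d * v') * (1 - b) \<in> K.ints" using b K.ints_1 K.ints_mult K.ints_diff by presburger
        thus "(2 * d * v) * (2 * d * v') * (1 - b) * 2 \<in> P" using Pf(3) by (rule K.ideal_mult[OF Pf(1)])
      qed
      also have "d * (u + e * v) * (d * (u' + e * v')) + (2 * d * v) * (2 * d * v') * (1 - b) * 2
          = d * (d * (u * u' + (e * e) * v * v' + e * (u * v' + v * u'))) + d * d * v * v' * (8 * (1 - b))"
        by (simp add: algebra_simps)
      also have "8 * (1 - b) = d - 1" by (simp add: d_def)
      also have "d * (d * (u * u' + (e * e) * v * v' + e * (u * v' + v * u'))) + d * d * v * v' * (d - 1)
          = d * (d * (U + e * V))"
        unfolding ee U_def V_def by (simp add: algebra_simps)
      finally have "d * (U + e * V) \<in> P" using Pf(5) coord'[OF UV sO e] by blast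
      thus "x * y \<in> Q e P" unfolding s using Qmem[OF UV sO] by blast
    qed
    moreover have "1 \<notin> Q e P"
      using Qmem[of 1 0 e P] K.one_mem K.zero_mem L.ints_1 Pf(2) Pf(5)[OF K.ints_1] by simp
    moreover have "x \<in> Q e P \<or> x - 1 \<in> Q e P" if x: "x \<in> L.ints" for x
    proof -
      obtain u v where uv: "u \<in> K" "v \<in> K" "x = u + v * w" using Lrep[OF x] by blast
      have T: "d * (u + e * v) \<in> K.ints" using coord' uv x e by blast
      have x1: "x - 1 = (u - 1) + v * w" using uv by simp
      have x1O: "(u - 1) + v * w \<in> L.ints" using L.ints_diff[OF x L.ints_1] x1 by simp
      show ?thesis
      proof (cases "d * (u + e * v) \<in> P")
        case True
        thus ?thesis using Qmem uv x by blast
      next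
        case False
        hence "d * (u + e * v) - 1 \<in> P" using Pf(4)[OF T] by blast
        hence "(d * (u + e * v) - 1) - (d - 1) \<in> P" using Pf(6) by (rule K.ideal_diff[OF Pf(1)])
        hence "d * ((u - 1) + e * v) \<in> P" by (simp add: algebra_simps)
        thus ?thesis unfolding x1 using Qmem[OF K.diff_mem[OF uv(1) K.one_mem] uv(2) x1O] by blast
      qed
    qed
    ultimately show ?thesis by (auto simp: ideals_of_norm_two_def)
  qed
  \<comment> \<open>Distinctness of the new ideals: the integers of \<open>K\<close> in
    \<open>Q e P\<close> recover \<open>P\<close>, and \<open>\<beta>\<close>, whose residue is
    \<open>(1 + e) / 2\<close>, recovers the sign.\<close>
  have sub: "x \<in> Q e P \<longleftrightarrow> x \<in> P" if "P \<in> ideals_of_norm_two K" "x \<in> K.ints" for x e P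
  proof -
    have "x + 0 * w \<in> L" unfolding L_def using K.ints_mem[OF that(2)] K.zero_mem by blast
    hence "x \<in> L.ints" using that(2) by (simp add: L.ints_def K.ints_def)
    thus ?thesis using Qmem[of x 0 e P] P_facts(5)[OF that] K.ints_mem[OF that(2)] K.zero_mem by simp
  qed
  have bm: "\<beta> \<in> Q e P \<longleftrightarrow> e = -1" if P: "P \<in> ideals_of_norm_two K" and e: "e \<in> {1, -1}" for e P
  proof -
    have "\<beta> \<in> Q e P \<longleftrightarrow> d * (1/2 + e * (1/2)) \<in> P"
      using Qmem[OF half half] \<beta>L \<beta>eq by simp
    thus ?thesis using e K.ideal_0[OF P_facts(1)[OF P]] P_facts(5)[OF P K.ints_1] P_facts(2)[OF P] by auto
  qed
  define S' where "S' = (\<lambda>(e, P). Q e P) ` ({1, -1} \<times> S)"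
  have "inj_on (\<lambda>(e, P). Q e P) ({1, -1} \<times> S)"
  proof (rule inj_onI, clarify)
    fix e P e' P' assume *: "e \<in> {1, -1}" "e' \<in> {1, -1}" "P \<in> S" "P' \<in> S" "Q e P = Q e' P'"
    have PP: "P \<in> ideals_of_norm_two K" "P' \<in> ideals_of_norm_two K" using * S by auto
    have "e = e'" using bm[OF PP(1) *(1)] bm[OF PP(2) *(2)] * by auto
    moreover have "P = P'"
      using sub[OF PP(1)] sub[OF PP(2)] *(5) K.ideal_ints[OF P_facts(1)[OF PP(1)]] K.ideal_ints[OF P_facts(1)[OF PP(2)]]
      by blast
    ultimately show "e = e' \<and> P = P'" by blast
  qed
  hence "card S' = card ({1, -1 :: complex} \<times> S)" unfolding S'_def by (rule card_image)
  also have "\<dots> = 2 * card S" by (simp add: card_cartesian_product)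
  finally have "card S' = 2 * card S" .
  moreover have "finite S'" using S by (simp add: S'_def)
  moreover have "S' \<subseteq> ideals_of_norm_two L" using Q2 S by (auto simp: S'_def)
  ultimately show ?thesis using that nL by blast
qed

lemma number_field_Rats: "number_field \<rat>"
proof (rule number_fieldI(1))
  show "\<rat> \<subseteq> CC.Span \<rat> [1]"
  proof
    fix x :: complex assume x: "x \<in> \<rat>"
    have "1 \<in> CC.Span \<rat> [1]" using CC.Span_base_incl[OF subfield_Rats, of "[1]"] by simp
    hence "x \<otimes>\<^bsub>CC\<^esub> 1 \<in> CC.Span \<rat> [1]"
      by (rule CC.Span_smult_closed[OF subfield_Rats _ x, rotated]) simp
    thus "x \<in> CC.Span \<rat> [1]" by simp
  qed
qed auto

lemma many_ideals_of_norm_two: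
  "\<exists>K S. number_field K \<and> finite S \<and> S \<subseteq> ideals_of_norm_two K \<and> card S = 2 ^ r"
proof (induction r)
  case 0
  obtain n where n: "numfield \<rat> n" using number_field_imp_numfield[OF number_field_Rats] .
  interpret numfield "\<rat>" n by fact
  have ints: "ints = \<int>"
    using rational_algebraic_int_is_int int_imp_algebraic_int Ints_subset_Rats by (auto simp: ints_def)
  define P where "P = (\<lambda>k. of_int (2 * k) :: complex) ` UNIV"
  have Pm: "of_int k \<in> P \<longleftrightarrow> even k" for k unfolding P_def by (auto simp del: of_int_mult)
  have "is_ideal P"
  proof (rule is_idealI)
    show "P \<subseteq> ints" by (auto simp: P_def ints)
    show "0 \<in> P" using Pm[of 0] by simp
    fix x y assume "x \<in> P" "y \<in> P"
    then obtain k l where "x = of_int (2 * k)" "y = of_int (2 * l)" unfolding P_def by blast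
    thus "x + y \<in> P" using Pm[of "2 * k + 2 * l"] by simp
  next
    fix x y assume "x \<in> ints" "y \<in> P"
    then obtain k l where "x = of_int k" "y = of_int (2 * l)" unfolding P_def ints by (auto elim: Ints_cases)
    thus "x * y \<in> P" using Pm[of "k * (2 * l)"] by simp
  qed
  moreover have "1 \<notin> P" using Pm[of 1] by simp
  moreover have "x \<in> P \<or> x - 1 \<in> P" if x: "x \<in> ints" for x
  proof -
    obtain k where k: "x = of_int k" using x unfolding ints by (auto elim: Ints_cases)
    show ?thesis using Pm[of k] Pm[of "k - 1"] k by auto
  qed
  ultimately have "{P} \<subseteq> ideals_of_norm_two \<rat>" by (auto simp: ideals_of_norm_two_def)
  thus ?case using number_field_Rats by (intro exI[of _ "\<rat>"] exI[of _ "{P}"]) auto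
next
  case (Suc r)
  then obtain K S where "number_field K" "finite S" "S \<subseteq> ideals_of_norm_two K" "card S = 2 ^ r" by blast
  thus ?case using double_ideals_of_norm_two[of K S] by (metis power_Suc)
qed

section \<open>Integer polynomials modulo a maximal ideal\<close>

definition ipoly :: "int poly \<Rightarrow> complex \<Rightarrow> complex" where
  "ipoly f x = poly (map_poly of_int f) x"

lemma ipoly_simps [simp]:
  "ipoly 0 x = 0" "ipoly 1 x = 1" "ipoly (f + g) x = ipoly f x + ipoly g x"
  "ipoly (f - g) x = ipoly f x - ipoly g x" "ipoly (f * g) x = ipoly f x * ipoly g x"
  "ipoly (smult c f) x = of_int c * ipoly f x" "ipoly (monom c k) x = of_int c * x ^ k"
  "ipoly (pCons c f) x = of_int c + x * ipoly f x"
proof -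
  show "ipoly 0 x = 0" "ipoly 1 x = 1" by (simp_all add: ipoly_def)
  show "ipoly (f + g) x = ipoly f x + ipoly g x" "ipoly (f * g) x = ipoly f x * ipoly g x"
    by (simp_all add: ipoly_def of_int_poly_hom.hom_add of_int_poly_hom.hom_mult)
  have "map_poly of_int (f - g) = (map_poly of_int f - map_poly of_int g :: complex poly)"
    by (rule poly_eqI) (simp add: coeff_map_poly)
  thus "ipoly (f - g) x = ipoly f x - ipoly g x" by (simp add: ipoly_def)
  show "ipoly (pCons c f) x = of_int c + x * ipoly f x"
    by (simp add: ipoly_def of_int_hom.map_poly_pCons_hom)
  have "map_poly of_int (smult c f) = (smult (of_int c) (map_poly of_int f) :: complex poly)"
    by (rule poly_eqI) (simp add: coeff_map_poly)
  thus "ipoly (smult c f) x = of_int c * ipoly f x" by (simp add: ipoly_def)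
  have "map_poly of_int (monom c k) = (monom (of_int c) k :: complex poly)"
    by (rule poly_eqI) (simp add: coeff_map_poly)
  thus "ipoly (monom c k) x = of_int c * x ^ k" by (simp add: ipoly_def poly_monom)
qed

context numfield begin

lemma ints_ipoly: "x \<in> ints \<Longrightarrow> ipoly f x \<in> ints"
  unfolding ipoly_def by (rule ints_poly)

lemma ipoly_mem_ideal:
  assumes "is_ideal P" "of_nat p \<in> P" "x \<in> ints" "\<And>i. int p dvd coeff f i"
  shows "ipoly f x \<in> P"
  using assms(4)
proof (induction f)
  case 0
  thus ?case using ideal_0[OF assms(1)] by simp
next
  case (pCons a f)
  have "int p dvd a" using pCons.prems[of 0] by simp
  then obtain k where "a = int p * k" by blast
  hence "of_int a \<in> P" using ideal_mult_right[OF assms(1) ints_of_int[of k] assms(2)] by simp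
  moreover have "int p dvd coeff f i" for i using pCons.prems[of "Suc i"] by simp
  hence "x * ipoly f x \<in> P" using pCons.IH ideal_mult[OF assms(1,3)] by blast
  ultimately show ?case using ideal_add[OF assms(1)] by simp
qed

text \<open>Replaces normalising a polynomial over the prime field: a leading coefficient prime to
  \<open>p\<close> is inverted, with a multiple of \<open>p\<close> added to make it exactly 1, and
  one divisible by \<open>p\<close> is discarded.\<close>

lemma monic_of_not_dvd:
  assumes P: "is_maximal P" and p: "prime p" "of_nat p \<in> P" and x: "x \<in> ints"
    and r: "ipoly r x \<in> P" "\<exists>i. \<not> int p dvd coeff r i"
  shows "\<exists>g. lead_coeff g = 1 \<and> degree g \<le> degree r \<and> ipoly g x \<in> P"
  using r
proof (induction "degree r" arbitrary: r rule: less_induct)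
  case less
  have Pi: "is_ideal P" using maximal_ideal[OF P] .
  define c where "c = lead_coeff r"
  show ?case
  proof (cases "int p dvd c")
    case False
    hence "coprime (int p) c" using p(1) by (intro prime_imp_coprime) auto
    hence "coprime c (int p)" by (rule coprime_imp_coprime) auto
    then obtain u v where uv: "u * c + v * int p = 1" by (metis bezout_int coprime_imp_gcd_eq_1)
    define g where "g = smult u r + monom (v * int p) (degree r)"
    have le: "degree g \<le> degree r"
      unfolding g_def by (intro degree_add_le degree_smult_le degree_monom_le)
    have c1: "coeff g (degree r) = 1" using uv by (simp add: g_def c_def)
    hence "degree g = degree r" using le le_degree[of g "degree r"] by simp
    moreover have "ipoly g x \<in> P"
    proof -
      have "of_int u * ipoly r x + (of_int v * x ^ degree r) * of_nat p \<in> P"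
        using less.prems(1) p(2) x by (intro ideal_add[OF Pi] ideal_mult[OF Pi _ less.prems(1)]
          ideal_mult[OF Pi _ p(2)] ints_closed)
      thus ?thesis by (simp add: g_def mult_ac)
    qed
    ultimately show ?thesis using c1 by (intro exI[of _ g]) auto
  next
    case True
    define s where "s = r - monom c (degree r)"
    have cs: "coeff s i = (if i = degree r then 0 else coeff r i)" for i
      by (simp add: s_def c_def)
    have ds: "degree s \<le> degree r"
      unfolding s_def by (intro degree_diff_le degree_monom_le) simp
    obtain i where i: "\<not> int p dvd coeff r i" using less.prems by blast
    hence i': "\<not> int p dvd coeff s i" using True cs[of i] c_def by auto
    hence "s \<noteq> 0" by auto
    hence "degree s \<noteq> degree r" using cs[of "degree r"] by (metis leading_coeff_0_iff)
    hence lt: "degree s < degree r" using ds by simp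
    obtain k where k: "c = int p * k" using True by blast
    have "ipoly r x - (of_int k * x ^ degree r) * of_nat p \<in> P"
      by (intro ideal_diff[OF Pi less.prems(1)] ideal_mult[OF Pi _ p(2)] ints_closed x)
    hence "ipoly s x \<in> P" by (simp add: s_def k mult_ac)
    then obtain g where "lead_coeff g = 1" "degree g \<le> degree s" "ipoly g x \<in> P"
      using less.hyps[OF lt] i' by blast
    thus ?thesis using lt by (meson less_imp_le order_trans)
  qed
qed

text \<open>Distinct coefficient vectors with entries below \<open>p\<close> stay distinct modulo
  \<open>p\<close>, so a congruence between their values would yield a monic relation of degree
  below \<open>k\<close>.\<close>

lemma polynomial_residues_distinct:
  assumes P: "is_maximal P" and p: "prime p" "of_nat p \<in> P" and x: "x \<in> ints"
    and no: "\<And>g. \<lbrakk>lead_coeff g = 1; degree g < k\<rbrakk> \<Longrightarrow> ipoly g x \<notin> P"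
    and cd: "c \<in> {..<k} \<rightarrow>\<^sub>E {..<p}" "d \<in> {..<k} \<rightarrow>\<^sub>E {..<p}"
    and diff: "ipoly (\<Sum>i<k. monom (int (c i)) i) x - ipoly (\<Sum>i<k. monom (int (d i)) i) x \<in> P"
  shows "c = d"
proof -
  define r where "r = (\<Sum>i<k. monom (int (c i)) i) - (\<Sum>i<k. monom (int (d i)) i)"
  have cr: "coeff r i = (if i < k then int (c i) - int (d i) else 0)" for i
    by (simp add: r_def coeff_sum)
  have "int p dvd coeff r i" for i
  proof (rule ccontr)
    assume nd: "\<not> int p dvd coeff r i"
    hence "k > 0" using cr[of i] by (cases k) auto
    obtain g where g: "lead_coeff g = 1" "degree g \<le> degree r" "ipoly g x \<in> P"
      using monic_of_not_dvd[OF P p x, of r] diff nd by (auto simp: r_def)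
    have "degree r < k" using \<open>k > 0\<close> cr by (intro degree_lessI) auto
    thus False using no[OF g(1)] g by simp
  qed
  hence "c i = d i" if i: "i < k" for i
  proof -
    have "int p dvd int (c i) - int (d i)" using \<open>\<And>i. int p dvd coeff r i\<close>[of i] cr[of i] i by simp
    moreover have "c i < p" "d i < p" using cd i by auto
    hence "\<bar>int (c i) - int (d i)\<bar> < int p" by linarith
    ultimately have "int (c i) - int (d i) = 0" using dvd_imp_le_int[of "int (c i) - int (d i)" "int p"] by fastforce
    thus ?thesis by simp
  qed
  thus ?thesis by (intro PiE_ext[OF cd]) auto
qed

lemma prime_power_le_index:
  assumes P: "is_maximal P" and p: "prime p" "of_nat p \<in> P" and x: "x \<in> ints"
    and no: "\<And>g. \<lbrakk>lead_coeff g = 1; degree g < k\<rbrakk> \<Longrightarrow> ipoly g x \<notin> P"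
  shows "p ^ k \<le> index P"
proof -
  have "card ({..<k} \<rightarrow>\<^sub>E {..<p}) \<le> index P"
  proof (rule card_le_index[of P _ "\<lambda>c. ipoly (\<Sum>i<k. monom (int (c i)) i) x"])
    show "is_ideal P" "P \<noteq> {0}" using P by (auto simp: is_maximal_def)
    show "ipoly (\<Sum>i<k. monom (int (c i)) i) x \<in> ints" for c by (rule ints_ipoly[OF x])
  qed (rule polynomial_residues_distinct[OF P p x no])
  thus ?thesis by (simp add: card_PiE)
qed

section \<open>Root counting and Frobenius modulo an ideal\<close>

text \<open>Root counting over the residue field, carried out upstairs: synthetic division keeps the
  quotient monic with integral coefficients, and at another root \<open>t\<close> the factor
  \<open>t - s\<close> is outside the prime ideal \<open>P\<close>.\<close>

lemma roots_mod_maximal: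
  assumes P: "is_maximal P"
    and f: "\<And>i. coeff f i \<in> ints" "lead_coeff f = 1"
    and S: "finite S" "S \<subseteq> ints" "\<And>s t. \<lbrakk>s \<in> S; t \<in> S; s - t \<in> P\<rbrakk> \<Longrightarrow> s = t"
      "\<And>s. s \<in> S \<Longrightarrow> poly f s \<in> P"
  shows "card S \<le> degree f"
  using f S
proof (induction "degree f" arbitrary: f S)
  case 0
  have "f = 1" using "0.hyps" "0.prems"(2) by (metis degree_eq_zeroE lead_coeff_pCons(2) pCons_one degree_pCons_0 coeff_pCons_0)
  hence "S = {}" using "0.prems"(6) maximal_one[OF P] by auto
  thus ?case by simp
next
  case (Suc k)
  show ?case
  proof (cases "S = {}")
    case False
    then obtain s where s: "s \<in> S" by blast
    have Pi: "is_ideal P" using maximal_ideal[OF P] .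
    have si: "s \<in> ints" using s Suc.prems by blast
    define q where "q = synthetic_div f s"
    have fq: "f = [:-s, 1:] * q + [:poly f s:]" by (simp only: q_def synthetic_div_correct')
    have dq: "degree q = k" using Suc.hyps(2) by (simp add: q_def degree_synthetic_div)
    have pi: "poly g s \<in> ints" if "\<And>i. coeff g i \<in> ints" for g
      unfolding poly_altdef using that si by (intro ints_closed)
    have "coeff (synthetic_div g s) i \<in> ints" if "\<And>i. coeff g i \<in> ints" for g i
      using that
    proof (induction g arbitrary: i)
      case (pCons a g)
      have "coeff g j \<in> ints" for j using pCons.prems[of "Suc j"] by simp
      thus ?case using pCons.IH pi by (cases i) auto
    qed (simp add: ints_0)
    hence cq: "coeff q i \<in> ints" for i using Suc.prems(1) by (simp add: q_def)
    have q0: "q \<noteq> 0" using Suc.hyps(2) by (simp add: q_def synthetic_div_eq_0_iff)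
    have "degree [:poly f s:] < degree ([:-s, 1:] * q)" using q0 by (subst degree_mult_eq) auto
    hence "lead_coeff ([:poly f s:] + [:-s, 1:] * q) = lead_coeff ([:-s, 1:] * q)"
      by (rule lead_coeff_add_le)
    also have "[:poly f s:] + [:-s, 1:] * q = f" using fq by (metis add.commute)
    finally have "lead_coeff f = lead_coeff [:-s, 1:] * lead_coeff q" by (simp only: lead_coeff_mult)
    hence lq: "lead_coeff q = 1" using Suc.prems(2) by simp
    have "card (S - {s}) \<le> degree q"
    proof (rule Suc.hyps(1)[OF dq[symmetric] cq lq])
      fix t assume t: "t \<in> S - {s}"
      have ti: "t \<in> ints" using t Suc.prems by blast
      have "poly f t = (t - s) * poly q t + poly f s" by (subst fq) (simp add: algebra_simps)
      hence "(t - s) * poly q t = poly f t - poly f s" by simp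
      also have "\<dots> \<in> P" using t s Suc.prems(6) by (intro ideal_diff[OF Pi]) auto
      finally have "(t - s) * poly q t \<in> P" .
      moreover have "poly q t \<in> ints" unfolding poly_altdef using cq ti by (intro ints_closed)
      moreover have "t - s \<notin> P" using Suc.prems(5)[of t s] t s by blast
      ultimately show "poly q t \<in> P" using maximal_prime[OF P ints_diff[OF ti si]] by blast
    qed (use Suc.prems in auto)
    moreover have "card S = Suc (card (S - {s}))" using s Suc.prems(3) by (metis card_Suc_Diff1)
    ultimately show ?thesis using dq Suc.hyps(2) by simp
  qed simp
qed

lemma freshman_mod:
  assumes P: "is_ideal P" and p: "prime p" "of_nat p \<in> P" and ab: "a \<in> ints" "b \<in> ints"
  shows "(a + b) ^ p - (a ^ p + b ^ p) \<in> P"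
proof -
  have p0: "p > 0" using prime_gt_0_nat[OF p(1)] .
  have "(a + b) ^ p = (\<Sum>k\<le>p. of_nat (p choose k) * a ^ k * b ^ (p - k))"
    by (rule binomial_ring)
  also have "{..p} = insert 0 (insert p {1..<p})" using p0 by auto
  also have "(\<Sum>k\<in>\<dots>. of_nat (p choose k) * a ^ k * b ^ (p - k)) =
      b ^ p + (a ^ p + (\<Sum>k\<in>{1..<p}. of_nat (p choose k) * a ^ k * b ^ (p - k)))"
    using p0 by (subst sum.insert; simp)+
  finally have "(a + b) ^ p - (a ^ p + b ^ p) = (\<Sum>k\<in>{1..<p}. of_nat (p choose k) * a ^ k * b ^ (p - k))"
    by simp
  also have "\<dots> \<in> P"
  proof (rule ideal_sum[OF P])
    fix k assume k: "k \<in> {1..<p}"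
    hence "p dvd (p choose k)" using dvd_choose_prime[of k p] p(1) by auto
    then obtain m where m: "p choose k = p * m" by blast
    have "(of_nat m * a ^ k * b ^ (p - k)) * of_nat p \<in> P"
      using ab by (intro ideal_mult[OF P _ p(2)] ints_closed)
    thus "of_nat (p choose k) * a ^ k * b ^ (p - k) \<in> P" by (simp add: m mult_ac)
  qed
  finally show ?thesis .
qed

lemma fermat_mod:
  assumes P: "is_ideal P" and p: "prime p" "of_nat p \<in> P"
  shows "(of_int k) ^ p - of_int k \<in> P"
proof -
  have nat: "(of_nat k) ^ p - of_nat k \<in> P" for k
  proof (induction k)
    case 0
    thus ?case using ideal_0[OF P] prime_gt_0_nat[OF p(1)] by (simp add: power_0_left)
  next
    case (Suc k)
    have "((of_nat k + 1) ^ p - (of_nat k ^ p + 1 ^ p)) + (of_nat k ^ p - of_nat k) \<in> P"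
      using freshman_mod[OF P p ints_of_nat ints_1] Suc by (intro ideal_add[OF P])
    thus ?case by (simp add: algebra_simps)
  qed
  define m where "m = nat (k mod int p)"
  have "int p > 0" using prime_gt_0_nat[OF p(1)] by simp
  hence "int m = k mod int p" by (simp add: m_def)
  hence "k = int m + int p * (k div int p)" by simp
  hence km: "(of_int k :: complex) = of_nat m + of_int (k div int p) * of_nat p"
    by (metis mult.commute of_int_add of_int_mult of_int_of_nat_eq)
  have kP: "of_int k - of_nat m \<in> P"
    unfolding km using ideal_mult[OF P ints_of_int[of "k div int p"] p(2)] by simp
  have "(of_int k) ^ p - (of_nat m) ^ p = (of_int k - of_nat m) * (\<Sum>i<p. of_nat m ^ (p - Suc i) * of_int k ^ i :: complex)"
    by (rule power_diff_sumr2)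
  also have "\<dots> \<in> P" using kP by (intro ideal_mult_right[OF P]) (auto intro!: ints_closed)
  finally have "(of_int k) ^ p - (of_nat m) ^ p \<in> P" .
  from ideal_diff[OF P ideal_add[OF P this nat[of m]] kP]
  show ?thesis by simp
qed

lemma power_cong:
  assumes P: "is_ideal P" and "x \<in> ints" "y \<in> ints" "x - y \<in> P"
  shows "x ^ k - y ^ k \<in> P"
proof -
  have "x ^ k - y ^ k = (x - y) * (\<Sum>i<k. y ^ (k - Suc i) * x ^ i)" by (rule power_diff_sumr2)
  also have "\<dots> \<in> P" using assms by (intro ideal_mult_right[OF P]) (auto intro!: ints_closed)
  finally show ?thesis .
qed

lemma frobenius_ipoly:
  assumes P: "is_ideal P" and p: "prime p" "of_nat p \<in> P" and x: "x \<in> ints"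
  shows "ipoly g x ^ p - ipoly g (x ^ p) \<in> P"
proof (induction g)
  case 0
  thus ?case using ideal_0[OF P] prime_gt_0_nat[OF p(1)] by (simp add: power_0_left)
next
  case (pCons a g)
  have "((of_int a + x * ipoly g x) ^ p - (of_int a ^ p + (x * ipoly g x) ^ p)) + (of_int a ^ p - of_int a)
      + x ^ p * (ipoly g x ^ p - ipoly g (x ^ p)) \<in> P"
    using x by (intro ideal_add[OF P] freshman_mod[OF P p] fermat_mod[OF P p] ideal_mult[OF P _ pCons.IH]
      ints_mult ints_of_int ints_power ints_ipoly)
  thus ?case by (simp add: algebra_simps power_mult_distrib)
qed

lemma frobenius_ipoly_iterate:
  assumes P: "is_ideal P" and p: "prime p" "of_nat p \<in> P" and x: "x \<in> ints"
  shows "ipoly g x ^ (p ^ i) - ipoly g (x ^ (p ^ i)) \<in> P"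
proof (induction i)
  case 0
  thus ?case using ideal_0[OF P] by simp
next
  case (Suc i)
  have "(ipoly g x ^ (p ^ i)) ^ p - (ipoly g (x ^ (p ^ i))) ^ p \<in> P"
    using x by (intro power_cong[OF P _ _ Suc] ints_power ints_ipoly)
  moreover have "ipoly g (x ^ (p ^ i)) ^ p - ipoly g ((x ^ (p ^ i)) ^ p) \<in> P"
    by (rule frobenius_ipoly[OF P p ints_power[OF x]])
  ultimately have "((ipoly g x ^ (p ^ i)) ^ p - (ipoly g (x ^ (p ^ i))) ^ p)
      + (ipoly g (x ^ (p ^ i)) ^ p - ipoly g ((x ^ (p ^ i)) ^ p)) \<in> P" by (rule ideal_add[OF P])
  thus ?case by (simp add: mult.commute flip: power_mult)
qed

end

section \<open>Irreducibility modulo a prime\<close>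

lemma monic_division:
  fixes f g :: "int poly"
  assumes "lead_coeff g = 1"
  obtains k r where "f = g * k + r" "r = 0 \<or> degree r < degree g"
proof -
  have g0: "g \<noteq> 0" using assms by auto
  obtain k r where kr: "pseudo_divmod f g = (k, r)" by (cases "pseudo_divmod f g")
  show ?thesis using pseudo_divmod[OF g0 kr] assms that by simp
qed

text \<open>Irreducibility over the prime field, phrased with monic integer lifts: these keep their
  degree under reduction.\<close>

definition irreducible_mod :: "nat \<Rightarrow> int poly \<Rightarrow> bool" where
  "irreducible_mod p h \<longleftrightarrow> (\<forall>g k. lead_coeff g = 1 \<and> lead_coeff k = 1 \<and> degree g < degree h \<and> degree k < degree h
     \<longrightarrow> (\<exists>i. \<not> int p dvd coeff (h - g * k) i))"

text \<open>Let \<open>q\<close> be a monic relation of least degree. Dividing \<open>h\<close> by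
  \<open>q\<close> leaves a remainder whose value is in \<open>P\<close>; minimality makes it vanish
  modulo \<open>p\<close>, so \<open>h\<close> would factor as \<open>q * k\<close> modulo
  \<open>p\<close>.\<close>

lemma (in numfield) irreducible_mod_no_small_relation:
  assumes P: "is_maximal P" and p: "prime p" "of_nat p \<in> P" and x: "x \<in> ints"
    and h: "lead_coeff h = 1" "irreducible_mod p h" "ipoly h x \<in> P"
    and g: "lead_coeff g = 1" "degree g < degree h"
  shows "ipoly g x \<notin> P"
proof
  assume "ipoly g x \<in> P"
  have Pi: "is_ideal P" using maximal_ideal[OF P] .
  define A where "A = (\<lambda>d. \<exists>g. lead_coeff g = 1 \<and> degree g = d \<and> ipoly g x \<in> P)"
  define d where "d = (LEAST d. A d)"
  have Ag: "A (degree g)" using g \<open>ipoly g x \<in> P\<close> by (auto simp: A_def)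
  have "A d" unfolding d_def by (rule LeastI[of A, OF Ag])
  then obtain q where q: "lead_coeff q = 1" "degree q = d" "ipoly q x \<in> P" by (auto simp: A_def)
  have dh: "d < degree h" using Least_le[of A, OF Ag] g(2) by (simp add: d_def)
  have d0: "d \<noteq> 0"
  proof
    assume "d = 0"
    hence "q = 1" using q by (metis degree_eq_zeroE lead_coeff_pCons(2) pCons_one degree_pCons_0 coeff_pCons_0)
    thus False using q(3) maximal_one[OF P] by simp
  qed
  obtain k r where kr: "h = q * k + r" "r = 0 \<or> degree r < degree q" using monic_division[OF q(1)] by blast
  have "ipoly r x = ipoly h x - ipoly q x * ipoly k x" unfolding kr(1) by simp
  also have "\<dots> \<in> P" using q h x by (intro ideal_diff[OF Pi] ideal_mult_right[OF Pi] ints_ipoly)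
  finally have rP: "ipoly r x \<in> P" .
  have dr: "degree r < d" using kr(2) q(2) d0 by auto
  have "int p dvd coeff r i" for i
  proof (rule ccontr)
    assume "\<not> int p dvd coeff r i"
    then obtain s where s: "lead_coeff s = 1" "degree s \<le> degree r" "ipoly s x \<in> P"
      using monic_of_not_dvd[OF P p x rP] by blast
    hence "A (degree s)" by (auto simp: A_def)
    hence "d \<le> degree s" unfolding d_def by (rule Least_le)
    thus False using s dr by simp
  qed
  hence dvd: "\<forall>i. int p dvd coeff (h - q * k) i" using kr(1) by simp
  have hr: "degree (- r + h) = degree h" "lead_coeff (- r + h) = lead_coeff h"
  proof -
    have "degree (- r) < degree h" using dr dh by simp
    thus "degree (- r + h) = degree h" "lead_coeff (- r + h) = lead_coeff h"
      by (rule degree_add_eq_right, rule lead_coeff_add_le)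
  qed
  have qk: "q * k = - r + h" using kr(1) by simp
  have lk: "lead_coeff k = 1"
  proof -
    have "lead_coeff (q * k) = lead_coeff q * lead_coeff k" by (rule lead_coeff_mult)
    thus ?thesis using hr(2) qk q(1) h(1) by simp
  qed
  hence "k \<noteq> 0" "q \<noteq> 0" using q(1) by auto
  hence "degree (q * k) = degree q + degree k" by (intro degree_mult_eq)
  hence "degree k < degree h" using qk hr(1) q(2) d0 by simp
  thus False using h(2) q lk dh dvd unfolding irreducible_mod_def by blast
qed

section \<open>Simple extensions of the rationals\<close>

lemma Span_rat_sum:
  assumes "\<And>i. i \<in> S \<Longrightarrow> q i \<in> \<rat>" "\<And>i. i \<in> S \<Longrightarrow> f i \<in> CC.Span \<rat> Us"
  shows "(\<Sum>i\<in>S. q i * f i) \<in> CC.Span \<rat> Us"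
proof -
  have z: "0 \<in> CC.Span \<rat> Us" using CC.Span_subgroup_props(2)[OF subfield_Rats, of Us] by simp
  have a: "x + y \<in> CC.Span \<rat> Us" if "x \<in> CC.Span \<rat> Us" "y \<in> CC.Span \<rat> Us" for x y
    using CC.Span_subgroup_props(3)[OF subfield_Rats, of Us] that by simp
  have m: "r * x \<in> CC.Span \<rat> Us" if "r \<in> \<rat>" "x \<in> CC.Span \<rat> Us" for r x
    using CC.Span_smult_closed[OF subfield_Rats, of Us] that by simp
  show ?thesis
    using assms by (induction S rule: infinite_finite_induct) (auto intro: z a m)
qed

lemma sum_mem_Rats: "(\<And>i. i \<in> S \<Longrightarrow> q i \<in> \<rat>) \<Longrightarrow> sum q S \<in> \<rat>"
  by (induction S rule: infinite_finite_induct) auto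

lemma simple_extension_number_field:
  fixes f :: "int poly"
  assumes f: "lead_coeff f = 1" "degree f = n" "ipoly f \<alpha> = 0"
  obtains K where "number_field K" "numfield K n" "\<alpha> \<in> K" "algebraic_int \<alpha>"
proof -
  have alg: "algebraic_int \<alpha>"
    using f unfolding algebraic_int_altdef_ipoly ipoly_def by blast
  define Us where "Us = map (\<lambda>i. \<alpha> ^ i) [0..<n]"
  have base: "\<alpha> ^ i \<in> CC.Span \<rat> Us" if "i < n" for i
    using CC.Span_base_incl[OF subfield_Rats, of Us] that by (auto simp: Us_def)
  have "0 = (\<Sum>i\<le>n. of_int (coeff f i) * \<alpha> ^ i)"
    using f(2,3) by (simp add: ipoly_def poly_altdef coeff_map_poly)
  also have "\<dots> = (\<Sum>i<n. of_int (coeff f i) * \<alpha> ^ i) + \<alpha> ^ n"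
    using f(1,2) by (simp flip: lessThan_Suc_atMost)
  finally have an: "\<alpha> ^ n = (\<Sum>i<n. of_int (- coeff f i) * \<alpha> ^ i)"
    by (simp add: sum_negf eq_neg_iff_add_eq_0 add.commute)
  have pw: "\<alpha> ^ k \<in> CC.Span \<rat> Us" for k
  proof (induction k rule: less_induct)
    case (less k)
    show ?case
    proof (cases "k < n")
      case False
      have "\<alpha> ^ k = \<alpha> ^ (k - n) * \<alpha> ^ n" using False by (simp flip: power_add)
      also have "\<dots> = (\<Sum>i<n. of_int (- coeff f i) * \<alpha> ^ (k - n + i))"
        unfolding an by (simp add: sum_distrib_left power_add mult_ac)
      also have "\<dots> \<in> CC.Span \<rat> Us" using False by (intro Span_rat_sum less.IH) auto
      finally show ?thesis .
    qed (rule base)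
  qed
  define K where "K = {poly q \<alpha> | q. \<forall>i. coeff q i \<in> \<rat>}"
  have KI: "poly q \<alpha> \<in> K" if "\<And>i. coeff q i \<in> \<rat>" for q using that by (auto simp: K_def)
  have c: "\<rat> \<subseteq> K"
  proof
    fix x :: complex assume x: "x \<in> \<rat>"
    have "poly [:x:] \<alpha> \<in> K" by (rule KI) (auto simp: coeff_pCons x split: nat.splits)
    thus "x \<in> K" by simp
  qed
  have add: "x + y \<in> K" if xy: "x \<in> K" "y \<in> K" for x y
  proof -
    obtain q r where "x = poly q \<alpha>" "y = poly r \<alpha>" "\<And>i. coeff q i \<in> \<rat>" "\<And>i. coeff r i \<in> \<rat>"
      using xy by (auto simp: K_def)
    thus ?thesis using KI[of "q + r"] by simp
  qed
  have mult: "x * y \<in> K" if xy: "x \<in> K" "y \<in> K" for x y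
  proof -
    obtain q r where "x = poly q \<alpha>" "y = poly r \<alpha>" "\<And>i. coeff q i \<in> \<rat>" "\<And>i. coeff r i \<in> \<rat>"
      using xy by (auto simp: K_def)
    thus ?thesis using KI[of "q * r"] by (simp add: coeff_mult sum_mem_Rats)
  qed
  have "K \<subseteq> CC.Span \<rat> Us"
  proof
    fix x assume "x \<in> K"
    then obtain q where "x = poly q \<alpha>" "\<And>i. coeff q i \<in> \<rat>" by (auto simp: K_def)
    thus "x \<in> CC.Span \<rat> Us" by (simp add: poly_altdef Span_rat_sum pw)
  qed
  moreover have "length Us \<le> n" by (simp add: Us_def)
  ultimately have "number_field K" "numfield K n" using number_fieldI[OF c add mult] by blast+
  moreover have "poly [:0, 1:] \<alpha> \<in> K" by (rule KI) (auto simp: coeff_pCons split: nat.splits)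
  hence "\<alpha> \<in> K" by simp
  ultimately show ?thesis using that alg by blast
qed

section \<open>Irreducible polynomials modulo a prime\<close>

text \<open>A primitive root of unity of order \<open>p ^ n - 1\<close> keeps its order modulo a prime above \<open>p\<close>. The monic
  polynomial of least degree vanishing at it modulo that prime has the \<open>n\<close> Frobenius conjugates as
  roots; on the other hand all residues it generates are roots of \<open>y ^ (p ^ n) - y\<close>.\<close>

lemma exists_irreducible_mod:
  assumes p: "prime p" and n: "n > 0"
  obtains h :: "int poly" where "lead_coeff h = 1" "degree h = n" "irreducible_mod p h"
proof -
  define N where "N = p ^ n - 1"
  have p2: "p \<ge> 2" using prime_ge_2_nat[OF p] .
  have pn: "p ^ n \<ge> 2" using p2 n by (metis One_nat_def Suc_leI order_trans self_le_power one_le_numeral)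
  hence N1: "N \<ge> 1" and NS: "p ^ n = Suc N" by (auto simp: N_def)
  define z where "z = exp (2 * of_real pi * \<i> * of_nat 1 / of_nat N)"
  have zj: "z ^ j = exp (2 * of_real pi * \<i> * of_nat j / of_nat N)" for j
    unfolding z_def by (simp add: mult_ac flip: exp_of_nat_mult)
  have z1: "z ^ j = 1 \<longleftrightarrow> N dvd j" for j unfolding zj by (rule complex_root_unity_eq_1[OF N1])
  define c where "c = (monom 1 N - 1 :: int poly)"
  have dc: "degree c = N"
  proof -
    have "degree (- 1 + monom 1 N :: int poly) = degree (monom 1 N :: int poly)"
      by (rule degree_add_eq_right) (use N1 in \<open>simp add: degree_monom_eq\<close>)
    thus ?thesis by (simp add: c_def degree_monom_eq)
  qed
  have lc: "lead_coeff c = 1" unfolding dc using N1 by (simp add: c_def)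
  have "ipoly c z = 0" using z1[of N] by (simp add: c_def)
  then obtain K where K: "numfield K N" "z \<in> K" "algebraic_int z"
    using simple_extension_number_field[OF lc dc] by blast
  interpret numfield K N by fact
  have zi: "z \<in> ints" using K by (simp add: ints_def)
  note J = multiples_ideal[OF p2]
  obtain P where P: "is_maximal P" "(\<lambda>x. of_nat p * x) ` ints \<subseteq> P" using exists_maximal[OF J(1-3)] .
  have pP: "of_nat p \<in> P" using P(2) J(4) by blast
  have Pi: "is_ideal P" using maximal_ideal[OF P(1)] .
  have zP: "z ^ j \<notin> P" for j
  proof
    assume "z ^ j \<in> P"
    hence "z \<in> P" by (rule maximal_power[OF P(1) zi])
    hence "z * z ^ (N - 1) \<in> P" using ideal_mult_right[OF Pi ints_power[OF zi]] by blast
    also have "z * z ^ (N - 1) = z ^ N" using N1 by (cases N) auto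
    also have "\<dots> = 1" using z1[of N] by simp
    finally show False using maximal_one[OF P(1)] by simp
  qed
  \<comment> \<open>If \<open>z^j\<close> were 1 modulo \<open>P\<close>, the vanishing geometric
    sum of its \<open>N\<close> powers would reduce to \<open>N\<close>; but
    \<open>N = p^n - 1\<close> is -1 modulo \<open>P\<close>.\<close>
  have order: "z ^ j - 1 \<notin> P" if j: "0 < j" "j < N" for j
  proof
    assume a: "z ^ j - 1 \<in> P"
    have ne: "z ^ j \<noteq> 1" using z1[of j] j by (auto dest: dvd_imp_le)
    have "(z ^ j - 1) * (\<Sum>i<N. (z ^ j) ^ i) = (z ^ j) ^ N - 1"
      by (simp add: power_diff_1_eq)
    also have "(z ^ j) ^ N = 1" using z1[of "j * N"] by (simp add: power_mult)
    finally have s0: "(\<Sum>i<N. (z ^ j) ^ i) = 0" using ne by simp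
    have "(\<Sum>i<N. (z ^ j) ^ i - 1 ^ i) \<in> P"
      using a zi by (intro ideal_sum[OF Pi] power_cong[OF Pi] ints_power ints_1)
    hence "- of_nat N \<in> P" using s0 by (simp add: sum_subtractf)
    hence "of_nat N \<in> P" using ideal_uminus[OF Pi] by fastforce
    moreover have "of_nat p ^ n \<in> P"
      using ideal_mult_right[OF Pi ints_power[OF ints_of_nat] pP] n by (cases n) auto
    ultimately have "of_nat p ^ n - of_nat N \<in> P" by (intro ideal_diff[OF Pi])
    also have "(of_nat p ^ n :: complex) = of_nat (p ^ n)" by simp
    also have "\<dots> - of_nat N = 1" unfolding NS by simp
    finally show False using maximal_one[OF P(1)] by simp
  qed
  define A where "A = (\<lambda>d. \<exists>g. lead_coeff g = 1 \<and> degree g = d \<and> ipoly g z \<in> P)"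
  define d where "d = (LEAST d. A d)"
  have "A N" unfolding A_def using lc dc \<open>ipoly c z = 0\<close> ideal_0[OF Pi] by auto
  hence "A d" unfolding d_def by (rule LeastI)
  then obtain h where h: "lead_coeff h = 1" "degree h = d" "ipoly h z \<in> P" by (auto simp: A_def)
  have least: "ipoly g z \<notin> P" if "lead_coeff g = 1" "degree g < d" for g
    using that not_less_Least[of "degree g" A] by (auto simp: A_def d_def)
  have "d \<le> n"
  proof -
    define ev where "ev = (\<lambda>c::nat \<Rightarrow> nat. ipoly (\<Sum>i<d. monom (int (c i)) i) z)"
    define C where "C = {..<d} \<rightarrow>\<^sub>E {..<p}"
    have dist: "c = c'" if "c \<in> C" "c' \<in> C" "ev c - ev c' \<in> P" for c c'
      using polynomial_residues_distinct[OF P(1) p pP zi least] that by (simp add: ev_def C_def)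
    have inj: "inj_on ev C" using dist ideal_0[OF Pi] by (intro inj_onI) auto
    define M where "M = p ^ n"
    define q where "q = (monom 1 M - monom 1 1 :: complex poly)"
    have dq: "degree q = M"
    proof -
      have "degree (- monom 1 1 + monom 1 M :: complex poly) = degree (monom 1 M :: complex poly)"
        by (rule degree_add_eq_right) (use pn in \<open>simp add: degree_monom_eq M_def\<close>)
      thus ?thesis by (simp add: q_def degree_monom_eq)
    qed
    have "card (ev ` C) \<le> degree q"
    proof (rule roots_mod_maximal[OF P(1)])
      show "coeff q i \<in> ints" for i unfolding q_def by (auto intro: ints_closed)
      show "lead_coeff q = 1" unfolding dq using pn by (simp add: q_def M_def)
      show "finite (ev ` C)" by (simp add: C_def finite_PiE)
      show "ev ` C \<subseteq> ints" using ints_ipoly[OF zi] by (auto simp: ev_def)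
      show "s = t" if "s \<in> ev ` C" "t \<in> ev ` C" "s - t \<in> P" for s t using that dist by blast
      fix s assume "s \<in> ev ` C"
      then obtain g where g: "s = ipoly g z" by (auto simp: ev_def)
      \<comment> \<open>The order of \<open>z\<close> is \<open>p^n - 1\<close>, so \<open>n\<close>
        Frobenius steps fix \<open>z\<close>, and with it every integer polynomial value at
        \<open>z\<close> modulo \<open>P\<close>.\<close>
      have "z ^ (p ^ n) = z" unfolding NS using z1[of N] by simp
      hence "s ^ M - s \<in> P" using frobenius_ipoly_iterate[OF Pi p pP zi, of g n] g by (simp add: M_def)
      thus "poly q s \<in> P" by (simp add: q_def poly_monom)
    qed
    moreover have "card (ev ` C) = p ^ d" using inj by (simp add: card_image C_def card_PiE)
    ultimately show ?thesis using dq p2 by (simp add: M_def power_le_imp_le_exp)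
  qed
  moreover have "n \<le> d"
  proof -
    define r where "r = (\<lambda>i. z ^ (p ^ i))"
    have dist: "\<not> r i - r j \<in> P" if ij: "i < j" "j < n" for i j
    proof
      assume a: "r i - r j \<in> P"
      have lt: "p ^ i < p ^ j" using ij p2 by (intro power_strict_increasing) auto
      have "p ^ j < p ^ n" using ij p2 by (intro power_strict_increasing) auto
      moreover have "p ^ i \<ge> 1" using p2 by simp
      ultimately have lt2: "p ^ j - p ^ i < N" using lt NS by linarith
      have "r i - r j = z ^ (p ^ i) * (1 - z ^ (p ^ j - p ^ i))"
        using lt by (simp add: r_def algebra_simps flip: power_add)
      hence "1 - z ^ (p ^ j - p ^ i) \<in> P"
        using a maximal_prime[OF P(1) ints_power[OF zi] ints_diff[OF ints_1 ints_power[OF zi]]] zP by metis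
      hence "z ^ (p ^ j - p ^ i) - 1 \<in> P" using ideal_uminus[OF Pi] by fastforce
      thus False using order[of "p ^ j - p ^ i"] lt lt2 by simp
    qed
    have dist': "i = j" if "i < n" "j < n" "r i - r j \<in> P" for i j
    proof (rule ccontr)
      assume "i \<noteq> j"
      moreover have "r j - r i \<in> P" using ideal_uminus[OF Pi that(3)] by simp
      ultimately show False using dist[of i j] dist[of j i] that by (meson linorder_neqE_nat)
    qed
    have inj: "inj_on r {..<n}" using dist' ideal_0[OF Pi] by (intro inj_onI) auto
    have "card (r ` {..<n}) \<le> degree (map_poly of_int h :: complex poly)"
    proof (rule roots_mod_maximal[OF P(1)])
      show "coeff (map_poly of_int h) i \<in> ints" for i by (simp add: coeff_map_poly ints_of_int)
      show "lead_coeff (map_poly of_int h :: complex poly) = 1" using h(1) by (simp add: coeff_map_poly)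
      show "r ` {..<n} \<subseteq> ints" using ints_power[OF zi] by (auto simp: r_def)
      show "s = t" if "s \<in> r ` {..<n}" "t \<in> r ` {..<n}" "s - t \<in> P" for s t using that dist' by blast
      fix s assume "s \<in> r ` {..<n}"
      then obtain i where i: "s = z ^ (p ^ i)" by (auto simp: r_def)
      have "p ^ i > 0" using p2 by simp
      then obtain l where l: "p ^ i = Suc l" by (cases "p ^ i") auto
      have "ipoly h z ^ (p ^ i) \<in> P"
        unfolding l using ideal_mult_right[OF Pi ints_power[OF ints_ipoly[OF zi]] h(3)] by simp
      hence "ipoly h z ^ (p ^ i) - (ipoly h z ^ (p ^ i) - ipoly h (z ^ (p ^ i))) \<in> P"
        using frobenius_ipoly_iterate[OF Pi p pP zi] by (rule ideal_diff[OF Pi])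
      thus "poly (map_poly of_int h) s \<in> P" by (simp add: i ipoly_def)
    qed simp
    thus ?thesis using inj h(2) by (simp add: card_image)
  qed
  ultimately have dn: "d = n" by simp
  \<comment> \<open>A factorisation modulo \<open>p\<close> would put the value at \<open>z\<close>
    of a monic factor of smaller degree into the prime ideal \<open>P\<close>.\<close>
  have "irreducible_mod p h"
    unfolding irreducible_mod_def
  proof (intro allI impI)
    fix g k :: "int poly" assume gk: "lead_coeff g = 1 \<and> lead_coeff k = 1 \<and> degree g < degree h \<and> degree k < degree h"
    show "\<exists>i. \<not> int p dvd coeff (h - g * k) i"
    proof (rule ccontr)
      assume "\<not> ?thesis"
      hence "ipoly (h - g * k) z \<in> P" using ipoly_mem_ideal[OF Pi pP zi] by blast
      hence "ipoly h z - ipoly (h - g * k) z \<in> P" by (rule ideal_diff[OF Pi h(3)])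
      hence "ipoly g z * ipoly k z \<in> P" by simp
      hence "ipoly g z \<in> P \<or> ipoly k z \<in> P" using maximal_prime[OF P(1) ints_ipoly[OF zi] ints_ipoly[OF zi]] by blast
      thus False using least gk h(2) by auto
    qed
  qed
  thus ?thesis using that h dn by blast
qed

section \<open>Fields in which all small primes are inert\<close>

text \<open>Chinese remaindering coefficient by coefficient below degree \<open>n\<close>, with the
  leading coefficient fixed to 1.\<close>

lemma exists_monic_cong:
  fixes h :: "nat \<Rightarrow> int poly"
  assumes A: "finite A" "\<And>p. p \<in> A \<Longrightarrow> prime p" and h: "\<And>p. p \<in> A \<Longrightarrow> lead_coeff (h p) = 1 \<and> degree (h p) = n"
  obtains f where "lead_coeff f = 1" "degree f = n" "\<And>p i. p \<in> A \<Longrightarrow> int p dvd coeff (h p - f) i"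
proof -
  have "\<exists>x. \<forall>p\<in>A. [x = nat (coeff (h p) i mod int p)] (mod p)" for i
    using A by (intro chinese_remainder_nat) (auto intro: primes_coprime)
  then obtain x where x: "\<And>i p. p \<in> A \<Longrightarrow> [x i = nat (coeff (h p) i mod int p)] (mod p)" by metis
  define f where "f = (\<Sum>i<n. monom (int (x i)) i) + monom 1 n"
  have cf: "coeff f i = (if i < n then int (x i) else if i = n then 1 else 0)" for i
    by (auto simp: f_def coeff_sum)
  have df: "degree f = n"
    by (rule antisym[OF degree_le le_degree]) (auto simp: cf)
  have "int p dvd coeff (h p - f) i" if p: "p \<in> A" for p i
  proof -
    consider "i < n" | "i = n" | "i > n" by linarith
    thus ?thesis
    proof cases
      case 1
      have p0: "int p > 0" using A(2)[OF p] prime_gt_0_nat by simp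
      have "[int (x i) = int (nat (coeff (h p) i mod int p))] (mod int p)" using x[OF p, of i] by (simp only: cong_int_iff)
      hence "[int (x i) = coeff (h p) i] (mod int p)" using p0 by (simp add: cong_def)
      thus ?thesis using 1 by (simp add: cf cong_iff_dvd_diff dvd_diff_commute)
    qed (use h[OF p] in \<open>auto simp: cf coeff_eq_0\<close>)
  qed
  thus ?thesis using that[of f] df cf by simp
qed

text \<open>A root of one polynomial congruent to an irreducible one modulo every prime up to
  \<open>B\<close>. No monic polynomial of degree below \<open>n\<close> vanishes at it modulo
  \<open>P\<close>, so the \<open>p ^ n\<close> reduced polynomial values are distinct
  residues.\<close>

lemma exists_number_field_inert:
  assumes n: "n > 0"
  obtains K where "number_field K" "numfield K n"
    "\<And>p P. \<lbrakk>prime p; p \<le> B; numfield.is_maximal K P; of_nat p \<in> P\<rbrakk> \<Longrightarrow> p ^ n \<le> numfield.index K P"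
proof -
  define A where "A = {p. prime p \<and> p \<le> B}"
  have "finite A" by (rule finite_subset[of _ "{..B}"]) (auto simp: A_def)
  have "\<forall>p. \<exists>h::int poly. p \<in> A \<longrightarrow> lead_coeff h = 1 \<and> degree h = n \<and> irreducible_mod p h"
    using exists_irreducible_mod[OF _ n] unfolding A_def by (metis mem_Collect_eq)
  then obtain h :: "nat \<Rightarrow> int poly"
    where h: "\<And>p. p \<in> A \<Longrightarrow> lead_coeff (h p) = 1 \<and> degree (h p) = n \<and> irreducible_mod p (h p)" by metis
  obtain f where f: "lead_coeff f = 1" "degree f = n" "\<And>p i. p \<in> A \<Longrightarrow> int p dvd coeff (h p - f) i"
    using exists_monic_cong[OF \<open>finite A\<close>, of h n] h by (auto simp: A_def)
  have "\<not> constant (poly (map_poly of_int f :: complex poly))"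
    using n f(2) by (simp add: constant_degree)
  then obtain a where a: "ipoly f a = 0"
    using fundamental_theorem_of_algebra by (auto simp: ipoly_def)
  obtain K where K: "number_field K" "numfield K n" "a \<in> K" "algebraic_int a"
    using simple_extension_number_field[OF f(1,2) a] .
  interpret numfield K n by fact
  have ai: "a \<in> ints" using K by (simp add: ints_def)
  have "p ^ n \<le> index P" if pP: "prime p" "p \<le> B" "is_maximal P" "of_nat p \<in> P" for p P
  proof (rule prime_power_le_index[OF pP(3,1,4) ai])
    have pA: "p \<in> A" using pP by (simp add: A_def)
    have "ipoly (h p - f) a \<in> P" using ipoly_mem_ideal[OF maximal_ideal[OF pP(3)] pP(4) ai f(3)[OF pA]] .
    hence hP: "ipoly (h p) a \<in> P" using a by simp
    show "ipoly g a \<notin> P" if "lead_coeff g = 1" "degree g < n" for g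
      using irreducible_mod_no_small_relation[OF pP(3,1,4) ai _ _ hP that(1)] h[OF pA] that(2) by blast
  qed
  thus ?thesis using that K by blast
qed

section \<open>Zeta values close to one\<close>

text \<open>The exponent separates the primes up to \<open>B\<close> from the rest. \<open>B\<close>
  is chosen after \<open>n\<close>, so the final bound does not mention it.\<close>

lemma exists_zeta_le:
  fixes s :: real
  assumes s: "s > 1" and n: "n \<ge> 2"
  obtains K where "number_field K" "numfield K n"
    "numfield.zeta_real K s \<le> exp (2 * real n * ((\<Sum>k. real k powr -2) * (4 / 2 ^ n) + 1 / real n ^ 2))"
proof -
  define C where "C = (\<Sum>k. real k powr -2)"
  have sm2: "summable (\<lambda>k. real k powr -2)" by (subst summable_real_powr_iff) simp
  have sms: "summable (\<lambda>k. real k powr - s)" using s by (subst summable_real_powr_iff) simp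
  define Z where "Z = (\<Sum>k. real k powr - s)"
  have e0: "1 / real n ^ 2 > 0" using n by simp
  have "(\<lambda>B. \<Sum>k\<le>B. real k powr - s) \<longlonglongrightarrow> Z" unfolding Z_def by (rule summable_LIMSEQ'[OF sms])
  \<comment> \<open>The allowance \<open>1 / n^2\<close> for the tail is small enough to survive the
    factor \<open>2 * n\<close> in the exponent.\<close>
  hence "\<forall>\<^sub>F B in sequentially. (\<Sum>k\<le>B. real k powr - s) > Z - 1 / real n ^ 2"
    using e0 by (intro order_tendstoD) auto
  then obtain B where B: "(\<Sum>k\<le>B. real k powr - s) > Z - 1 / real n ^ 2"
    by (auto simp: eventually_sequentially)
  obtain K where K: "number_field K" "numfield K n"
    and inert: "\<And>p P. \<lbrakk>prime p; p \<le> B; numfield.is_maximal K P; of_nat p \<in> P\<rbrakk> \<Longrightarrow> p ^ n \<le> numfield.index K P"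
    using exists_number_field_inert[of n B] n by auto
  interpret numfield K n by fact
  have pw: "x ^ n = x ^ 2 * x ^ (n - 2)" for x :: real
    using n by (metis le_add_diff_inverse power_add)
  \<comment> \<open>For inert \<open>p\<close>, lowering the exponent to 1 leaves
    \<open>1 / p^n\<close>, at most \<open>1 / p^2\<close> times \<open>1 / 2^(n - 2)\<close>: the
    square secures convergence, and the rest is \<open>4 / 2^n\<close>.\<close>
  define w where "w = (\<lambda>p. if p \<le> B then real p powr -2 * (4 / 2 ^ n) else real p powr - s)"
  have "zeta_real s \<le> exp (2 * real n * (C * (4 / 2 ^ n) + 1 / real n ^ 2))"
  proof (rule zeta_le[OF s], rule sum_index_le_exp[OF s])
    fix P p assume P: "is_maximal P" and p: "prime p" "of_nat p \<in> P"
    have p2: "real p \<ge> 2" using prime_ge_2_nat[OF p(1)] by simp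
    show "real (index P) powr - s \<le> w p"
    proof (cases "p \<le> B")
      case True
      have "real (p ^ n) \<le> real (index P)" using inert[OF p(1) True P p(2)] by (simp only: of_nat_le_iff)
      hence "real (index P) powr - s \<le> real (p ^ n) powr - s"
        using p2 s by (intro powr_mono2') auto
      also have "\<dots> \<le> real (p ^ n) powr - 1" using p2 s by (intro powr_mono) (auto simp: one_le_power)
      also have "\<dots> = 1 / real p ^ n" using p2 by (simp add: powr_minus_divide)
      also have "\<dots> = 1 / real p ^ 2 * (1 / real p ^ (n - 2))"
        using pw[of "real p"] by simp
      also have "\<dots> \<le> 1 / real p ^ 2 * (1 / 2 ^ (n - 2))"
        using p2 by (intro mult_left_mono divide_left_mono power_mono mult_pos_pos) auto
      also have "1 / 2 ^ (n - 2) = (4 / 2 ^ n :: real)" using pw[of 2] by simp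
      also have "1 / real p ^ 2 = real p powr -2" using p2 by (simp add: powr_minus_divide)
      finally show ?thesis using True by (simp add: w_def)
    next
      case False
      thus ?thesis using prime_le_index[OF P p] p2 s by (simp add: w_def powr_mono2')
    qed
  next
    fix Q :: "nat set" assume Q: "finite Q" "Q \<subseteq> {p. prime p}"
    have "(\<Sum>p\<in>Q. w p) = (\<Sum>p\<in>Q \<inter> {..B}. w p) + (\<Sum>p\<in>Q - {..B}. w p)"
      by (rule sum.Int_Diff[OF Q(1)])
    also have "(\<Sum>p\<in>Q \<inter> {..B}. w p) = (\<Sum>p\<in>Q \<inter> {..B}. real p powr -2) * (4 / 2 ^ n)"
      unfolding sum_distrib_right by (intro sum.cong) (auto simp: w_def)
    also have "\<dots> \<le> C * (4 / 2 ^ n)"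
      unfolding C_def using Q by (intro mult_right_mono sum_le_suminf sm2) auto
    also have "(\<Sum>p\<in>Q - {..B}. w p) = (\<Sum>p\<in>Q - {..B}. real p powr - s)"
      by (intro sum.cong) (auto simp: w_def)
    also have "\<dots> = (\<Sum>k\<in>(Q - {..B}) \<union> {..B}. real k powr - s) - (\<Sum>k\<le>B. real k powr - s)"
      using Q by (subst sum.union_disjoint) auto
    also have "(\<Sum>k\<in>(Q - {..B}) \<union> {..B}. real k powr - s) \<le> Z"
      unfolding Z_def using Q by (intro sum_le_suminf sms) auto
    finally show "(\<Sum>p\<in>Q. w p) \<le> C * (4 / 2 ^ n) + 1 / real n ^ 2" using B by simp
  qed
  thus ?thesis using that K by (simp add: C_def)
qed

section \<open>Isomorphic fields have the same zeta function\<close>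

definition field_iso :: "complex set \<Rightarrow> complex set \<Rightarrow> (complex \<Rightarrow> complex) \<Rightarrow> bool" where
  "field_iso K L \<phi> \<longleftrightarrow> bij_betw \<phi> K L \<and> \<phi> 1 = 1 \<and>
     (\<forall>x\<in>K. \<forall>y\<in>K. \<phi> (x + y) = \<phi> x + \<phi> y \<and> \<phi> (x * y) = \<phi> x * \<phi> y)"

lemma field_iso_inv:
  assumes K: "numfield K n" and \<phi>: "field_iso K L \<phi>"
  shows "field_iso L K (inv_into K \<phi>)"
proof -
  interpret numfield K n by fact
  have b: "bij_betw \<phi> K L" using \<phi> by (simp add: field_iso_def)
  have b': "bij_betw (inv_into K \<phi>) L K" by (rule bij_betw_inv_into[OF b])
  have eq: "inv_into K \<phi> y = x \<longleftrightarrow> \<phi> x = y" if "x \<in> K" "y \<in> L" for x y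
    using that b by (metis bij_betw_inv_into_left bij_betw_inv_into_right)
  have m: "inv_into K \<phi> y \<in> K" "\<phi> (inv_into K \<phi> y) = y" if "y \<in> L" for y
    using that b b' by (auto simp: bij_betw_inv_into_right bij_betwE)
  have L: "\<phi> x \<in> L" if "x \<in> K" for x using b that by (auto simp: bij_betw_def)
  have \<phi>a: "\<phi> (x + y) = \<phi> x + \<phi> y" "\<phi> (x * y) = \<phi> x * \<phi> y" if "x \<in> K" "y \<in> K" for x y
    using \<phi> that by (auto simp: field_iso_def)
  show ?thesis
    unfolding field_iso_def
  proof (intro conjI ballI b')
    have "1 \<in> L" using L[OF one_mem] \<phi> by (simp add: field_iso_def)
    thus "inv_into K \<phi> 1 = 1" using eq[OF one_mem] \<phi> by (simp add: field_iso_def)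
  next
    fix x y assume xy: "x \<in> L" "y \<in> L"
    have 1: "\<phi> (inv_into K \<phi> x + inv_into K \<phi> y) = x + y" "\<phi> (inv_into K \<phi> x * inv_into K \<phi> y) = x * y"
      using \<phi>a m xy by auto
    have k: "inv_into K \<phi> x + inv_into K \<phi> y \<in> K" "inv_into K \<phi> x * inv_into K \<phi> y \<in> K"
      using m xy by (auto intro: add_mem mult_mem)
    have "x + y \<in> L" "x * y \<in> L" using L[OF k(1)] L[OF k(2)] 1 by auto
    thus "inv_into K \<phi> (x + y) = inv_into K \<phi> x + inv_into K \<phi> y"
      "inv_into K \<phi> (x * y) = inv_into K \<phi> x * inv_into K \<phi> y"
      using eq k 1 by blast+
  qed
qed

lemma field_iso_ints:
  assumes K: "numfield K n" and L: "numfield L m" and \<phi>: "field_iso K L \<phi>" and x: "x \<in> numfield.ints K"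
  shows "\<phi> x \<in> numfield.ints L"
proof -
  interpret K: numfield K n by fact
  interpret L: numfield L m by fact
  have \<phi>a: "\<phi> (x + y) = \<phi> x + \<phi> y" "\<phi> (x * y) = \<phi> x * \<phi> y" if "x \<in> K" "y \<in> K" for x y
    using \<phi> that by (auto simp: field_iso_def)
  have \<phi>0: "\<phi> 0 = 0" using \<phi>a(1)[OF K.zero_mem K.zero_mem] by simp
  have \<phi>1: "\<phi> 1 = 1" using \<phi> by (simp add: field_iso_def)
  have nat: "\<phi> (of_nat k) = of_nat k" for k
    by (induction k) (simp_all add: \<phi>0 \<phi>1 \<phi>a K.one_mem K.nat_mem)
  have neg: "\<phi> (- y) = - \<phi> y" if "y \<in> K" for y
    using \<phi>a(1)[OF that K.uminus_mem[OF that]] by (simp add: \<phi>0 eq_neg_iff_add_eq_0 add.commute)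
  have int: "\<phi> (of_int k) = of_int k" for k
  proof (cases "k \<ge> 0")
    case True
    thus ?thesis using nat[of "nat k"] by simp
  next
    case False
    thus ?thesis using neg[OF K.nat_mem[of "nat (- k)"]] nat[of "nat (- k)"] by simp
  qed
  have xK: "x \<in> K" and xa: "algebraic_int x" using x by (auto simp: K.ints_def)
  have ip: "\<phi> (ipoly f x) = ipoly f (\<phi> x)" for f
  proof (induction f)
    case (pCons a f)
    have "ipoly f x \<in> K" using K.ints_mem[OF K.ints_ipoly[OF x]] .
    thus ?case using pCons by (simp add: \<phi>a int K.int_mem K.mult_mem xK)
  qed (simp add: \<phi>0)
  obtain f :: "int poly" where f: "ipoly f x = 0" "lead_coeff f = 1"
    using xa by (auto simp: algebraic_int_altdef_ipoly ipoly_def)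
  have "ipoly f (\<phi> x) = 0" using ip[of f] f(1) \<phi>0 by simp
  hence "algebraic_int (\<phi> x)" using f(2) unfolding algebraic_int_altdef_ipoly ipoly_def by blast
  moreover have "\<phi> x \<in> L" using \<phi> xK by (auto simp: field_iso_def bij_betw_def)
  ultimately show ?thesis by (simp add: L.ints_def)
qed

lemma field_iso_ideal:
  assumes K: "numfield K n" and L: "numfield L m" and \<phi>: "field_iso K L \<phi>" and I: "I \<in> numfield.nz_ideals K"
  shows "\<phi> ` I \<in> numfield.nz_ideals L"
proof -
  interpret K: numfield K n by fact
  interpret L: numfield L m by fact
  have Ii: "K.is_ideal I" "I \<noteq> {0}" using I by (auto simp: K.nz_ideals_def)
  have \<phi>a: "\<phi> (x + y) = \<phi> x + \<phi> y" "\<phi> (x * y) = \<phi> x * \<phi> y" if "x \<in> K" "y \<in> K" for x y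
    using \<phi> that by (auto simp: field_iso_def)
  have \<phi>0: "\<phi> 0 = 0" using \<phi>a(1)[OF K.zero_mem K.zero_mem] by simp
  have b: "bij_betw \<phi> K L" using \<phi> by (simp add: field_iso_def)
  have IK: "x \<in> K" if "x \<in> I" for x using K.ideal_ints[OF Ii(1) that] K.ints_mem by blast
  have "L.is_ideal (\<phi> ` I)"
  proof (rule L.is_idealI)
    show "\<phi> ` I \<subseteq> L.ints" using field_iso_ints[OF K L \<phi>] K.ideal_ints[OF Ii(1)] by blast
    show "0 \<in> \<phi> ` I" using K.ideal_0[OF Ii(1)] \<phi>0 by (metis imageI)
  next
    fix x y assume "x \<in> \<phi> ` I" "y \<in> \<phi> ` I"
    then obtain a b where ab: "a \<in> I" "b \<in> I" "x = \<phi> a" "y = \<phi> b" by blast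
    hence "x + y = \<phi> (a + b)" using \<phi>a IK by simp
    thus "x + y \<in> \<phi> ` I" using K.ideal_add[OF Ii(1)] ab by blast
  next
    fix r x assume r: "r \<in> L.ints" and "x \<in> \<phi> ` I"
    then obtain a where a: "a \<in> I" "x = \<phi> a" by blast
    define t where "t = inv_into K \<phi> r"
    have ti: "t \<in> K.ints" unfolding t_def by (rule field_iso_ints[OF L K field_iso_inv[OF K \<phi>] r])
    have "\<phi> t = r" unfolding t_def using b r L.ints_mem by (metis bij_betw_inv_into_right)
    hence "r * x = \<phi> (t * a)" using \<phi>a a IK K.ints_mem[OF ti] by simp
    thus "r * x \<in> \<phi> ` I" using K.ideal_mult[OF Ii(1) ti a(1)] by blast
  qed
  moreover have "\<phi> ` I \<noteq> {0}"
  proof -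
    obtain x where x: "x \<in> I" "x \<noteq> 0" using Ii K.ideal_0 by blast
    have "\<phi> x \<noteq> \<phi> 0" using b x IK K.zero_mem by (auto simp: bij_betw_def inj_on_def)
    thus ?thesis using x \<phi>0 by auto
  qed
  ultimately show ?thesis by (simp add: L.nz_ideals_def)
qed

lemma field_iso_index:
  assumes K: "numfield K n" and L: "numfield L m" and \<phi>: "field_iso K L \<phi>" and I: "I \<in> numfield.nz_ideals K"
  shows "numfield.index L (\<phi> ` I) = numfield.index K I"
proof -
  interpret K: numfield K n by fact
  interpret L: numfield L m by fact
  have Ii: "K.is_ideal I" using I by (auto simp: K.nz_ideals_def)
  have \<phi>a: "\<phi> (x + y) = \<phi> x + \<phi> y" if "x \<in> K" "y \<in> K" for x y
    using \<phi> that by (auto simp: field_iso_def)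
  have b: "bij_betw \<phi> K L" using \<phi> by (simp add: field_iso_def)
  have IK: "x \<in> K" if "x \<in> I" for x using K.ideal_ints[OF Ii that] K.ints_mem by blast
  have surj: "\<phi> ` K.ints = L.ints"
  proof
    show "\<phi> ` K.ints \<subseteq> L.ints" using field_iso_ints[OF K L \<phi>] by blast
    show "L.ints \<subseteq> \<phi> ` K.ints"
    proof
      fix r assume r: "r \<in> L.ints"
      have "inv_into K \<phi> r \<in> K.ints" by (rule field_iso_ints[OF L K field_iso_inv[OF K \<phi>] r])
      moreover have "\<phi> (inv_into K \<phi> r) = r" using b r L.ints_mem by (metis bij_betw_inv_into_right)
      ultimately show "r \<in> \<phi> ` K.ints" by (metis imageI)
    qed
  qed
  have c: "\<phi> ` ((+) x ` I) = (+) (\<phi> x) ` (\<phi> ` I)" if "x \<in> K.ints" for x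
    unfolding image_image using \<phi>a[OF K.ints_mem[OF that] IK] by (intro image_cong) auto
  have "L.cosets (\<phi> ` I) = (\<lambda>x. (+) (\<phi> x) ` (\<phi> ` I)) ` K.ints"
    unfolding L.cosets_def surj[symmetric] image_image ..
  also have "\<dots> = (\<lambda>x. \<phi> ` ((+) x ` I)) ` K.ints" by (intro image_cong refl c[symmetric])
  also have "\<dots> = image \<phi> ` K.cosets I" by (auto simp: K.cosets_def)
  finally have e: "L.cosets (\<phi> ` I) = image \<phi> ` K.cosets I" .
  have "\<Union> (K.cosets I) \<subseteq> K" using IK K.add_mem K.ints_mem by (auto simp: K.cosets_def)
  hence "inj_on (image \<phi>) (K.cosets I)"
    using b by (intro inj_on_image) (auto simp: bij_betw_def intro: inj_on_subset)
  thus ?thesis unfolding L.index_def K.index_def e by (rule card_image)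
qed

text \<open>An isomorphism preserves integrality, hence carries ideals to ideals of the same norm,
  and the series agree term by term for every \<open>s\<close>. This gives \<open>the_elem\<close>
  in \<open>zeta_height\<close> its meaning.\<close>

lemma dedekind_zeta_iso:
  assumes "(K, L) \<in> number_field_iso"
  shows "dedekind_zeta L = dedekind_zeta K"
proof
  fix s
  have nf: "number_field K" "number_field L" using assms by (auto simp: number_field_iso_def)
  obtain n where K: "numfield K n" using number_field_imp_numfield[OF nf(1)] .
  obtain m where L: "numfield L m" using number_field_imp_numfield[OF nf(2)] .
  interpret K: numfield K n by fact
  interpret L: numfield L m by fact
  obtain \<phi> where "\<phi> \<in> ring_iso (CC\<lparr>carrier := K\<rparr>) (CC\<lparr>carrier := L\<rparr>)"
    using assms by (auto simp: number_field_iso_def is_ring_iso_def)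
  hence \<phi>: "field_iso K L \<phi>" by (auto simp: ring_iso_def Ring.ring_hom_def field_iso_def)
  have b: "bij_betw \<phi> K L" using \<phi> by (simp add: field_iso_def)
  have sub: "I \<subseteq> K" if "I \<in> K.nz_ideals" for I
    using that K.ideal_ints K.ints_mem by (auto simp: K.nz_ideals_def)
  have "bij_betw (image \<phi>) K.nz_ideals L.nz_ideals"
  proof (rule bij_betw_imageI)
    show "inj_on (image \<phi>) K.nz_ideals"
      using b sub by (intro inj_on_image) (auto simp: bij_betw_def intro: inj_on_subset)
    show "image \<phi> ` K.nz_ideals = L.nz_ideals"
    proof
      show "image \<phi> ` K.nz_ideals \<subseteq> L.nz_ideals" using field_iso_ideal[OF K L \<phi>] by blast
      show "L.nz_ideals \<subseteq> image \<phi> ` K.nz_ideals"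
      proof
        fix J assume J: "J \<in> L.nz_ideals"
        have JL: "x \<in> L" if "x \<in> J" for x
          using J L.ideal_ints[OF _ that] L.ints_mem by (auto simp: L.nz_ideals_def)
        have "\<phi> ` (inv_into K \<phi> ` J) = (\<lambda>x. \<phi> (inv_into K \<phi> x)) ` J" by (simp add: image_image)
        also have "\<dots> = (\<lambda>x. x) ` J" using b JL by (intro image_cong) (auto simp: bij_betw_inv_into_right)
        finally have "J = \<phi> ` (inv_into K \<phi> ` J)" by simp
        thus "J \<in> image \<phi> ` K.nz_ideals" using field_iso_ideal[OF L K field_iso_inv[OF K \<phi>] J] by blast
      qed
    qed
  qed
  hence "(\<Sum>\<^sub>\<infinity>I\<in>K.nz_ideals. of_nat (L.index (\<phi> ` I)) powr - s) = (\<Sum>\<^sub>\<infinity>I\<in>L.nz_ideals. of_nat (L.index I) powr - s :: complex)"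
    by (rule infsum_reindex_bij_betw)
  moreover have "(\<Sum>\<^sub>\<infinity>I\<in>K.nz_ideals. of_nat (L.index (\<phi> ` I)) powr - s)
      = (\<Sum>\<^sub>\<infinity>I\<in>K.nz_ideals. of_nat (K.index I) powr - s :: complex)"
    by (intro infsum_cong) (simp add: field_iso_index[OF K L \<phi>])
  ultimately show "dedekind_zeta L s = dedekind_zeta K s"
    by (simp add: dedekind_zeta_def K.nonzero_ideals_eq L.nonzero_ideals_eq K.ideal_norm_eq L.ideal_norm_eq)
qed

text \<open>The class contains \<open>K\<close> and all its members share one value, so the image is
  a singleton. Positivity removes the absolute value and excludes a zero of zeta.\<close>

lemma zeta_height_class:
  assumes K: "numfield K n" "number_field K" and s: "s > 1"
  shows "zeta_height (of_real s) (number_field_iso `` {K}) = numfield.zeta_real K s"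
proof -
  interpret numfield K n by fact
  have pos: "zeta_real s > 1" using zeta_gt_1[OF s] .
  hence "dedekind_zeta K (of_real s) \<noteq> 0" unfolding dedekind_zeta_of_real[OF s] by simp
  hence lc: "leading_laurent_coeff (dedekind_zeta K) (of_real s) = of_real (zeta_real s)"
    using leading_laurent_coeff_analytic[OF dedekind_zeta_analytic[OF s]] dedekind_zeta_of_real[OF s] by simp
  have refl: "K \<in> number_field_iso `` {K}"
    using K(2) ring_iso_refl by (auto simp: number_field_iso_def)
  have "cmod (leading_laurent_coeff (dedekind_zeta L) (of_real s)) = zeta_real s"
    if "L \<in> number_field_iso `` {K}" for L
    using dedekind_zeta_iso[of K L] that lc pos by simp
  hence "(\<lambda>L. cmod (leading_laurent_coeff (dedekind_zeta L) (of_real s))) ` (number_field_iso `` {K})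
      = (\<lambda>_. zeta_real s) ` (number_field_iso `` {K})"
    by (intro image_cong) auto
  also have "\<dots> = {zeta_real s}" using refl by (intro image_constant)
  finally have "(\<lambda>L. cmod (leading_laurent_coeff (dedekind_zeta L) (of_real s))) ` (number_field_iso `` {K})
      = {zeta_real s}" .
  thus ?thesis by (simp add: zeta_height_def)
qed

section \<open>Both limits and the failure of isolation\<close>

theorem mainTheorem4:
  fixes \<sigma> :: real
  assumes "\<sigma> > 1"
  shows "(\<exists>K K' :: nat \<Rightarrow> complex set.
            (\<forall>d. number_field (K d)) \<and> (\<forall>d. number_field (K' d)) \<and>
            (\<lambda>d. dedekind_zeta (K d) (complex_of_real \<sigma>)) \<longlonglongrightarrow> 1 \<and>
            (\<forall>d. dedekind_zeta (K' d) (complex_of_real \<sigma>) \<in> \<real>) \<and>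
            filterlim (\<lambda>d. Re (dedekind_zeta (K' d) (complex_of_real \<sigma>))) at_top sequentially) \<and>
         \<not> bogomolov_property (zeta_height (complex_of_real \<sigma>))"
proof -
  define C where "C = (\<Sum>k. real k powr -2)"
  define b where "b = (\<lambda>d::nat. exp (2 * real (d + 2) * (C * (4 / 2 ^ (d + 2)) + 1 / real (d + 2) ^ 2)))"
  have "\<forall>d. \<exists>K. number_field K \<and> numfield K (d + 2) \<and> numfield.zeta_real K \<sigma> \<le> b d"
  proof
    fix d
    show "\<exists>K. number_field K \<and> numfield K (d + 2) \<and> numfield.zeta_real K \<sigma> \<le> b d"
      using exists_zeta_le[OF assms, of "d + 2"] unfolding b_def C_def by (metis le_add2)
  qed
  then obtain K where K: "\<And>d. number_field (K d)" "\<And>d. numfield (K d) (d + 2)"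
      "\<And>d. numfield.zeta_real (K d) \<sigma> \<le> b d"
    by metis
  \<comment> \<open>With \<open>n = d + 2\<close>, both parts of the exponent vanish in the limit:
    they are of order \<open>n / 2^n\<close> and \<open>1 / n\<close>.\<close>
  have "(\<lambda>d. C * (2 * real (d + 2) * (4 / 2 ^ (d + 2))) + 2 * real (d + 2) / real (d + 2) ^ 2) \<longlonglongrightarrow> C * 0 + 0"
    by (intro tendsto_add tendsto_mult tendsto_const) real_asymp+
  hence "(\<lambda>d. exp (C * (2 * real (d + 2) * (4 / 2 ^ (d + 2))) + 2 * real (d + 2) / real (d + 2) ^ 2)) \<longlonglongrightarrow> exp (C * 0 + 0)"
    by (rule tendsto_exp)
  also have "(\<lambda>d. exp (C * (2 * real (d + 2) * (4 / 2 ^ (d + 2))) + 2 * real (d + 2) / real (d + 2) ^ 2)) = b"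
    by (auto simp: b_def fun_eq_iff algebra_simps)
  finally have b1: "b \<longlonglongrightarrow> 1" by simp
  have Kz: "(\<lambda>d. numfield.zeta_real (K d) \<sigma>) \<longlonglongrightarrow> 1"
  proof (rule tendsto_sandwich[OF _ _ tendsto_const b1])
    show "\<forall>\<^sub>F d in sequentially. 1 \<le> numfield.zeta_real (K d) \<sigma>"
      using numfield.zeta_gt_1[OF K(2) assms] by (auto intro!: always_eventually less_imp_le)
    show "\<forall>\<^sub>F d in sequentially. numfield.zeta_real (K d) \<sigma> \<le> b d"
      using K(3) by (auto intro: always_eventually)
  qed
  have Kd: "(\<lambda>d. dedekind_zeta (K d) (complex_of_real \<sigma>)) \<longlonglongrightarrow> 1"
  proof -
    have "(\<lambda>d. complex_of_real (numfield.zeta_real (K d) \<sigma>)) \<longlonglongrightarrow> of_real 1"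
      by (rule tendsto_of_real[OF Kz])
    thus ?thesis by (simp add: numfield.dedekind_zeta_of_real[OF K(2) assms])
  qed
  have "\<forall>d. \<exists>K' S. number_field K' \<and> finite S \<and> S \<subseteq> ideals_of_norm_two K' \<and> card S = 2 ^ d"
    using many_ideals_of_norm_two by blast
  then obtain K' S where K': "\<And>d. number_field (K' d)" "\<And>d. finite (S d)"
      "\<And>d. S d \<subseteq> ideals_of_norm_two (K' d)" "\<And>d. card (S d) = 2 ^ d"
    by metis
  have "\<exists>m. numfield (K' d) m" for d using number_field_imp_numfield[OF K'(1)] by blast
  then obtain m where m: "\<And>d. numfield (K' d) (m d)" by metis
  have ge: "2 powr - \<sigma> * 2 ^ d \<le> numfield.zeta_real (K' d) \<sigma>" for d
    using numfield.zeta_ge_norm_two[OF m assms K'(2,3), of d] K'(4)[of d] by (simp add: mult.commute)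
  have "filterlim (\<lambda>d. 2 powr - \<sigma> * 2 ^ d) at_top sequentially"
    by (rule filterlim_tendsto_pos_mult_at_top[OF tendsto_const]) (simp, real_asymp)
  hence "filterlim (\<lambda>d. numfield.zeta_real (K' d) \<sigma>) at_top sequentially"
    by (rule filterlim_at_top_mono) (use ge in \<open>auto intro: always_eventually\<close>)
  hence K'd: "filterlim (\<lambda>d. Re (dedekind_zeta (K' d) (complex_of_real \<sigma>))) at_top sequentially"
    by (simp add: numfield.dedekind_zeta_of_real[OF m assms])
  have K'r: "dedekind_zeta (K' d) (complex_of_real \<sigma>) \<in> \<real>" for d
    by (simp add: numfield.dedekind_zeta_of_real[OF m assms])
  define H where "H = zeta_height (complex_of_real \<sigma>) ` number_field_classes"
  have gt: "x > 1" if x: "x \<in> H" for x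
  proof -
    obtain c where c: "c \<in> number_field_classes" "x = zeta_height (complex_of_real \<sigma>) c" using x by (auto simp: H_def)
    obtain F where F: "number_field F" "c = number_field_iso `` {F}"
      using c(1) by (auto simp: number_field_classes_def elim: quotientE)
    obtain k where k: "numfield F k" using number_field_imp_numfield[OF F(1)] .
    show ?thesis using zeta_height_class[OF k F(1) assms] numfield.zeta_gt_1[OF k assms] c F by simp
  qed
  have mem: "numfield.zeta_real (K d) \<sigma> \<in> H" for d
  proof -
    have "number_field_iso `` {K d} \<in> number_field_classes"
      unfolding number_field_classes_def by (rule quotientI) (simp add: K(1))
    thus ?thesis using zeta_height_class[OF K(2) K(1) assms, of d] unfolding H_def by (metis imageI)
  qed
  \<comment> \<open>Together with \<open>gt\<close> this places a height strictly inside every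
    interval to the right of 1.\<close>
  have near: "\<exists>x\<in>H. x < 1 + e" if "e > 0" for e
  proof -
    have "\<forall>\<^sub>F d in sequentially. numfield.zeta_real (K d) \<sigma> < 1 + e"
      using Kz that by (intro order_tendstoD) auto
    then obtain d where "numfield.zeta_real (K d) \<sigma> < 1 + e" by (auto simp: eventually_sequentially)
    thus ?thesis using mem by blast
  qed
  have "Inf H = 1"
  proof (rule cInf_eq_non_empty)
    show "H \<noteq> {}" using mem by blast
    show "1 \<le> x" if "x \<in> H" for x using gt[OF that] by simp
    fix y assume y: "\<And>x. x \<in> H \<Longrightarrow> y \<le> x"
    show "y \<le> 1"
    proof (rule ccontr)
      assume "\<not> y \<le> 1"
      then obtain x where "x \<in> H" "x < 1 + (y - 1)" using near[of "y - 1"] by auto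
      thus False using y by fastforce
    qed
  qed
  hence "\<not> bogomolov_property (zeta_height (complex_of_real \<sigma>))"
    unfolding bogomolov_property_def H_def[symmetric] using near gt by fastforce
  thus ?thesis using K(1) K'(1) Kd K'd K'r by blast
qed

end
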